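(* Let $d$ and $T$ be non-zero integers, let $\beta\in(0,1)$, and let $T$ be a known upper bound on the number of time steps; the total flippancy $K$ of the input is not known to the algorithm. Then there exist: 1. for any $\epsilon>0$, an item-level $\epsilon$-differentially private algorithm for the \textsc{CountDistinct} problem in the general model with error at most $$O\left(\min\left(d,K,\ln K\sqrt{\epsilon^{-1}K\ln(T/\beta)},\epsilon^{-1}T\log(T/\beta)\right)+\epsilon^{-1}\ln^2K\ln(\ln K/\beta)\right)$$ at all time steps with probability at least $1-\beta$; 2. for any $0<\delta<1$ and $0<\epsilon<1$, an item-level $(\epsilon,\delta)$-differentially private algorithm for the \textsc{CountDistinct} problem in the general model with error at most $$O\left(\min\left(d,K,\left(\epsilon^{-2}K\ln^2K\ln(1/\delta)\ln^2(T/\beta)\right)^{1/3},\epsilon^{-1}\sqrt{T\ln(1/\delta)\log(T/\beta)}\right)+\epsilon^{-1}\ln^2K\ln(\ln K/\beta)\right)$$ at all time steps with probability at least $1-\beta$.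
   Context: Fix $d\ge1$. An input stream of length $T$ is $x=(x^1,\dots,x^T)$ with $x^t\in\{-1,0,1\}^d$ (several coordinates may be non-zero at a time step); every such stream is valid in the general model. For item $i$, $f^t(x_i)=1$ if $\sum_{t'\le t}x_i^{t'}>0$ and $0$ otherwise; $\textsc{CountDistinct}(x)^t=\sum_i f^t(x_i)$. The \textsc{CountDistinct} problem asks a continual-observation algorithm to output at each time $t$ (using only $x^1,\dots,x^t$) an estimate of $\textsc{CountDistinct}(x)^t$; the error is the maximum absolute deviation over time steps. The total flippancy of $x$ is $K=\sum_{i=1}^d\sum_{t=2}^T\mathbb{1}(f^t(x_i)\ne f^{t-1}(x_i))$. Streams $x,y$ are item-level neighboring if there is an item $i^*$ with $x_i^t=y_i^t$ for all $t$ and $i\ne i^*$. An algorithm with output sequence $A^T(x)$ is item-level $(\epsilon,\delta)$-differentially private if for all item-level neighboring $x,y$ and all sets $S$ of output sequences $\Pr[A^T(x)\in S]\le e^\epsilon\Pr[A^T(y)\in S]+\delta$; $\delta=0$ gives item-level $\epsilon$-differential privacy.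
   Formalization: In the error bounds ln K is read as ln(max(3,K)) and ln(1/δ) as max(1, ln(1/δ)), because the literal bounds are undefined or negative for K ≤ 2 and cannot hold with an absolute constant as δ tends to 1. *)

theory Defs
  imports "HOL-Probability.Probability"
begin

section \<open>Input streams\<close>

text \<open>
  A stream is the list of its updates, an update the list of its \<open>d\<close> coordinates.
  Time steps are numbered from 1, so \<open>x\<^sup>t\<close> is \<open>x ! (t - 1)\<close>; items are numbered from 0.
\<close>

type_synonym stream = "int list list"

definition streams :: "nat \<Rightarrow> nat \<Rightarrow> stream set" where
  "streams d T = {x. length x \<le> T \<and> (\<forall>u\<in>set x. length u = d \<and> set u \<subseteq> {-1, 0, 1})}"

definition present :: "stream \<Rightarrow> nat \<Rightarrow> nat \<Rightarrow> nat" where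
  "present x i t = (if (\<Sum>s = 1..t. x ! (s - 1) ! i) > 0 then 1 else 0)"

definition count_distinct :: "nat \<Rightarrow> stream \<Rightarrow> nat \<Rightarrow> nat" where
  "count_distinct d x t = (\<Sum>i<d. present x i t)"

definition total_flippancy :: "nat \<Rightarrow> stream \<Rightarrow> nat" where
  "total_flippancy d x =
     (\<Sum>i<d. \<Sum>t = 2..length x. if present x i t \<noteq> present x i (t - 1) then 1 else 0)"

definition item_neighboring :: "nat \<Rightarrow> stream \<Rightarrow> stream \<Rightarrow> bool" where
  "item_neighboring d x y \<longleftrightarrow> length x = length y \<and>
     (\<exists>j<d. \<forall>t\<in>{1..length x}. \<forall>i<d. i \<noteq> j \<longrightarrow> x ! (t - 1) ! i = y ! (t - 1) ! i)"

section \<open>Continual-observation algorithms\<close>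

text \<open>
  A randomized algorithm draws its random coins once; the output at a time step is a function of
  the coins and of the updates received so far. The coins are an arbitrary probability measure on
  real sequences, which provides as many independent real random variables as needed.
\<close>

record algorithm =
  coins :: "(nat \<Rightarrow> real) measure"
  answer :: "(nat \<Rightarrow> real) \<Rightarrow> stream \<Rightarrow> real"

definition continual_algorithm :: "algorithm \<Rightarrow> bool" where
  "continual_algorithm A \<longleftrightarrow>
     prob_space (coins A) \<and> (\<forall>p. (\<lambda>\<omega>. answer A \<omega> p) \<in> borel_measurable (coins A))"

definition output_at :: "algorithm \<Rightarrow> stream \<Rightarrow> (nat \<Rightarrow> real) \<Rightarrow> nat \<Rightarrow> real" where
  "output_at A x \<omega> t = answer A \<omega> (take t x)"

definition output_space :: "nat \<Rightarrow> (nat \<Rightarrow> real) measure" where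
  "output_space n = (\<Pi>\<^sub>M t\<in>{1..n}. borel)"

definition output_law :: "algorithm \<Rightarrow> stream \<Rightarrow> (nat \<Rightarrow> real) measure" where
  "output_law A x =
     distr (coins A) (output_space (length x)) (\<lambda>\<omega>. restrict (output_at A x \<omega>) {1..length x})"

definition item_dp :: "nat \<Rightarrow> nat \<Rightarrow> real \<Rightarrow> real \<Rightarrow> algorithm \<Rightarrow> bool" where
  "item_dp d T \<epsilon> \<delta> A \<longleftrightarrow>
     (\<forall>x\<in>streams d T. \<forall>y\<in>streams d T. item_neighboring d x y \<longrightarrow>
        (\<forall>S\<in>sets (output_space (length x)).
           measure (output_law A x) S \<le> exp \<epsilon> * measure (output_law A y) S + \<delta>))"

definition pure_item_dp :: "nat \<Rightarrow> nat \<Rightarrow> real \<Rightarrow> algorithm \<Rightarrow> bool" where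
  "pure_item_dp d T \<epsilon> A \<longleftrightarrow> item_dp d T \<epsilon> 0 A"

text \<open>The error bound \<open>err\<close> may depend on the flippancy of the input, the algorithm may not.\<close>

definition count_distinct_accurate ::
    "nat \<Rightarrow> nat \<Rightarrow> real \<Rightarrow> (nat \<Rightarrow> real) \<Rightarrow> algorithm \<Rightarrow> bool" where
  "count_distinct_accurate d T \<beta> err A \<longleftrightarrow>
     (\<forall>x\<in>streams d T.
        measure (coins A)
          {\<omega> \<in> space (coins A). \<forall>t\<in>{1..length x}.
             \<bar>output_at A x \<omega> t - real (count_distinct d x t)\<bar> \<le> err (total_flippancy d x)}
        \<ge> 1 - \<beta>)"

section \<open>Error bounds\<close>

text \<open>
  Logarithms inside the asymptotic bounds are not meant to vanish or to become negative.
  Read literally they would for \<open>K \<le> 2\<close> and as \<open>\<delta>\<close> tends to 1, and the bounds could not be met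
  with an absolute constant. Therefore \<open>ln K\<close> is read as \<open>ln (max 3 K)\<close> (so that also \<open>ln (ln K / \<beta>) > 0\<close>) and
  \<open>ln (1 / \<delta>)\<close> as \<open>max 1 (ln (1 / \<delta>))\<close>. Nothing changes for \<open>K \<ge> 3\<close> and \<open>\<delta> \<le> exp (- 1)\<close>.
\<close>

definition lnK :: "nat \<Rightarrow> real" where
  "lnK K = ln (max 3 (real K))"

definition ln_inv :: "real \<Rightarrow> real" where
  "ln_inv \<delta> = max 1 (ln (1 / \<delta>))"

definition pure_bound :: "nat \<Rightarrow> nat \<Rightarrow> real \<Rightarrow> real \<Rightarrow> nat \<Rightarrow> real" where
  "pure_bound d T \<beta> \<epsilon> K =
     Min {real d,
          real K,
          lnK K * sqrt (1 / \<epsilon> * real K * ln (real T / \<beta>)),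
          1 / \<epsilon> * real T * ln (real T / \<beta>)}
     + 1 / \<epsilon> * (lnK K)\<^sup>2 * ln (lnK K / \<beta>)"

definition approx_bound :: "nat \<Rightarrow> nat \<Rightarrow> real \<Rightarrow> real \<Rightarrow> real \<Rightarrow> nat \<Rightarrow> real" where
  "approx_bound d T \<beta> \<epsilon> \<delta> K =
     Min {real d,
          real K,
          root 3 (1 / \<epsilon>\<^sup>2 * real K * (lnK K)\<^sup>2 * ln_inv \<delta> * (ln (real T / \<beta>))\<^sup>2),
          1 / \<epsilon> * sqrt (real T * ln_inv \<delta> * ln (real T / \<beta>))}
     + 1 / \<epsilon> * (lnK K)\<^sup>2 * ln (lnK K / \<beta>)"

end

theory Submission
  imports Defs "HOL-Library.Nat_Bijection"
begin

text \<open>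
  The algorithm releases a noisy count at the first time step, and afterwards only when a sparse
  vector test (noisy threshold, noisy queries) reports that the released value is outdated. The
  \<open>m\<close>-th test has noise level \<open>X m\<close>, threshold \<open>4 * X m\<close>, and error of order \<open>X m\<close>. When it fires, at
  least \<open>X m\<close> flips must have occurred since the previous release, so after \<open>k\<close> firings the flippancy
  \<open>K\<close> is at least \<open>X 1 + \<dots> + X k\<close>, and at least \<open>k\<close>: the noise level is tied to \<open>K\<close> although \<open>K\<close> is
  never estimated. The privacy budget of the \<open>m\<close>-th test is proportional to \<open>1 / (m ln\<^sup>2 m)\<close>, which is
  summable. Under pure privacy this gives \<open>X m\<close> of order \<open>m ln\<^sup>2 m\<close>, hence \<open>K\<close> of order at least
  \<open>m * X m\<close> and an error of order \<open>ln K * sqrt K\<close>. Under approximate privacy the squares of the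
  parameters add up (Renyi composition), so \<open>X m\<close> is only of order \<open>sqrt m * ln m\<close> and the error of
  order \<open>(K ln\<^sup>2 K)\<^sup>1\<^sup>/\<^sup>3\<close>. Once \<open>X m\<close> exceeds the noise that a release at every time step would need,
  the algorithm switches to the latter. All noise is integer-valued, so that the laws of the
  outputs are discrete.
\<close>

text \<open>Flips are counted from time 2 on, so the first count may be as large as \<open>d\<close>
  while \<open>K = 0\<close>. Its release is therefore forced, and its error must fit into the
  additive term, which does not depend on \<open>T\<close>; this is why block 0 has a share
  \<open>\<beta> / 2\<close> of the failure probability to itself. One item can change the count at
  every time step, but never by more than 1. A sparse test tolerates this at a price that does not
  depend on how long it stays quiet, so privacy is paid per release and not per time step. The
  constant must be uniform in all parameters. For \<open>T = 1\<close> and \<open>\<beta>\<close>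
  near 1, \<open>ln (T / \<beta>)\<close> vanishes while a union bound still costs a constant. For
  very small \<open>\<beta>\<close>, a term linear in this logarithm is not dominated by its square
  root times \<open>sqrt T\<close>. In both cases the additive term has to help.\<close>

section \<open>Comparing probability mass functions\<close>

text \<open>A change of noise: in the privacy proofs \<open>\<phi>\<close> sends noise that causes
  an output on one input to noise that causes the same output on the neighbouring input, in the tail
  bounds it shifts a tail. Injectivity keeps masses of \<open>Q\<close> from being counted
  twice.\<close>

lemma prob_le_prob_by_injection:
  assumes inj: "inj_on \<phi> (A \<inter> set_pmf P)"
    and maps: "\<And>a. a \<in> A \<Longrightarrow> a \<in> set_pmf P \<Longrightarrow> \<phi> a \<in> B"
    and le: "\<And>a. a \<in> A \<Longrightarrow> a \<in> set_pmf P \<Longrightarrow> pmf P a \<le> c * pmf Q (\<phi> a)"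
    and c: "0 \<le> c"
  shows "measure_pmf.prob P A \<le> c * measure_pmf.prob Q B"
proof -
  let ?A = "A \<inter> set_pmf P"
  have "emeasure P A = emeasure P ?A"
    by (rule emeasure_Int_set_pmf[symmetric])
  also have "\<dots> = (\<integral>\<^sup>+a. pmf P a \<partial>count_space ?A)"
    by (rule nn_integral_pmf[symmetric])
  also have "\<dots> \<le> (\<integral>\<^sup>+a. ennreal c * pmf Q (\<phi> a) \<partial>count_space ?A)"
    by (rule nn_integral_mono) (use le c in \<open>auto simp: ennreal_mult[symmetric] intro: ennreal_leI\<close>)
  also have "\<dots> = ennreal c * emeasure Q (\<phi> ` ?A)"
    by (subst nn_integral_cmult) (simp_all add: nn_integral_pmf'[OF inj])
  also have "\<dots> \<le> ennreal c * emeasure Q B"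
    by (intro mult_left_mono emeasure_mono) (use maps in auto)
  finally have "ennreal (measure_pmf.prob P A) \<le> ennreal (c * measure_pmf.prob Q B)"
    by (simp add: measure_pmf.emeasure_eq_measure ennreal_mult c)
  thus ?thesis
    using c by (subst (asm) ennreal_le_iff) auto
qed

lemma prob_le_prob_pointwise:
  assumes "\<And>a. a \<in> A \<Longrightarrow> pmf P a \<le> c * pmf Q a" "0 \<le> c"
  shows "measure_pmf.prob P A \<le> c * measure_pmf.prob Q A"
  by (rule prob_le_prob_by_injection[where \<phi> = id]) (use assms in auto)

lemma nn_integral_pmf_ratio:
  assumes "set_pmf P = set_pmf Q"
  shows "(\<integral>\<^sup>+a. ennreal (pmf Q a / pmf P a) \<partial>measure_pmf P) = 1"
proof -
  have "(\<integral>\<^sup>+a. ennreal (pmf Q a / pmf P a) \<partial>measure_pmf P)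
      = (\<integral>\<^sup>+a. ennreal (pmf P a) * ennreal (pmf Q a / pmf P a) \<partial>count_space UNIV)"
    by (rule nn_integral_measure_pmf)
  also have "\<dots> = (\<integral>\<^sup>+a. ennreal (pmf Q a) \<partial>count_space UNIV)"
    using assms by (intro nn_integral_cong)
      (auto simp: ennreal_mult[symmetric] pmf_nonneg pmf_eq_0_set_pmf)
  also have "\<dots> = 1"
    by (simp add: nn_integral_pmf)
  finally show ?thesis .
qed

subsection \<open>Renyi differential privacy\<close>

text \<open>
  The moment of order \<open>s\<close> of the likelihood ratio: \<open>(1 / s) * \<kappa>\<close> bounds the Renyi divergence of
  order \<open>s + 1\<close>. Integer orders suffice, and for them the discrete Gaussian admits a closed form.
\<close>

definition renyi_le :: "nat \<Rightarrow> real \<Rightarrow> 'a pmf \<Rightarrow> 'a pmf \<Rightarrow> bool" where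
  "renyi_le s \<kappa> P Q \<longleftrightarrow> set_pmf P \<subseteq> set_pmf Q \<and>
     (\<integral>\<^sup>+a. ennreal ((pmf P a / pmf Q a) ^ s) \<partial>measure_pmf P) \<le> ennreal (exp \<kappa>)"

lemma renyi_le_mono: "renyi_le s \<kappa> P Q \<Longrightarrow> \<kappa> \<le> \<kappa>' \<Longrightarrow> renyi_le s \<kappa>' P Q"
  unfolding renyi_le_def by (auto elim!: order_trans intro!: ennreal_leI)

lemma renyi_le_return: "renyi_le s 0 (return_pmf a) (return_pmf a)"
  unfolding renyi_le_def by (simp add: nn_integral_return)

lemma set_pmf_subset_of_pmf_le:
  assumes "\<And>a. pmf P a \<le> exp \<alpha> * pmf Q a"
  shows "set_pmf P \<subseteq> set_pmf Q"
proof
  fix a assume "a \<in> set_pmf P"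
  hence "0 < pmf P a" by (simp add: pmf_positive)
  also have "\<dots> \<le> exp \<alpha> * pmf Q a" by (rule assms)
  finally show "a \<in> set_pmf Q"
    by (auto simp: zero_less_mult_iff set_pmf_iff)
qed

text \<open>Linear in \<open>s\<close>, unlike the quadratic bound of the next lemma. It is the
  better one when \<open>\<alpha>\<close> is a constant fraction of \<open>\<epsilon>\<close>: with
  \<open>s\<close> of order \<open>ln_inv \<delta> / \<epsilon>\<close> the quadratic bound would
  cost the square of \<open>ln_inv \<delta>\<close>.\<close>

lemma renyi_le_of_pmf_le:
  assumes le: "\<And>a. pmf P a \<le> exp \<alpha> * pmf Q a"
  shows "renyi_le s (real s * \<alpha>) P Q"
proof -
  have sub: "set_pmf P \<subseteq> set_pmf Q"
    using le by (rule set_pmf_subset_of_pmf_le)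
  have "(\<integral>\<^sup>+a. ennreal ((pmf P a / pmf Q a) ^ s) \<partial>measure_pmf P)
      \<le> (\<integral>\<^sup>+a. ennreal (exp (real s * \<alpha>)) \<partial>measure_pmf P)"
  proof (rule nn_integral_mono_AE, rule AE_pmfI, rule ennreal_leI)
    fix a assume "a \<in> set_pmf P"
    hence "0 < pmf Q a" using sub by (auto intro: pmf_positive)
    hence "pmf P a / pmf Q a \<le> exp \<alpha>"
      using le[of a] by (simp add: field_simps)
    hence "(pmf P a / pmf Q a) ^ s \<le> exp \<alpha> ^ s"
      by (intro power_mono) (auto simp: pmf_nonneg)
    thus "(pmf P a / pmf Q a) ^ s \<le> exp (real s * \<alpha>)"
      by (simp add: exp_of_nat_mult)
  qed
  thus ?thesis
    using sub by (simp add: renyi_le_def measure_pmf.emeasure_space_1[simplified])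
qed

text \<open>
  Hoeffding's lemma is applied twice to the log-likelihood ratio \<open>Z\<close>, which lies in
  \<open>[-\<alpha>, \<alpha>]\<close>: to \<open>-Z\<close>, because \<open>exp (-Z)\<close> has mean 1, it yields the bound \<open>\<alpha>\<^sup>2 / 2\<close> on the mean
  of \<open>Z\<close>; to \<open>s * Z\<close> it then yields the claim.
\<close>

lemma renyi_le_of_pmf_le_both:
  assumes le: "\<And>a. pmf P a \<le> exp \<alpha> * pmf Q a" and ge: "\<And>a. pmf Q a \<le> exp \<alpha> * pmf P a"
    and s: "1 \<le> s" and \<alpha>: "0 \<le> \<alpha>"
  shows "renyi_le s (real s * (real s + 1) * \<alpha>\<^sup>2 / 2) P Q"
proof -
  have eq: "set_pmf P = set_pmf Q"
    using set_pmf_subset_of_pmf_le[OF le] set_pmf_subset_of_pmf_le[OF ge] by auto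
  define Z where "Z a = ln (pmf P a / pmf Q a)" for a
  have expZ: "exp (Z a) = pmf P a / pmf Q a" and Z: "Z a \<in> {-\<alpha>..\<alpha>}" if "a \<in> set_pmf P" for a
  proof -
    have pos: "0 < pmf P a" "0 < pmf Q a"
      using that eq by (auto intro: pmf_positive)
    show e: "exp (Z a) = pmf P a / pmf Q a"
      using pos by (simp add: Z_def)
    have "exp (Z a) \<le> exp \<alpha>"
      unfolding e using pos le[of a] by (simp add: field_simps)
    moreover have "exp (-\<alpha>) \<le> exp (Z a)"
      unfolding e using pos ge[of a] by (simp add: field_simps exp_minus)
    ultimately show "Z a \<in> {-\<alpha>..\<alpha>}" by simp
  qed
  interpret Z: interval_bounded_random_variable "measure_pmf P" Z "-\<alpha>" \<alpha>
    by unfold_locales (auto simp: AE_measure_pmf_iff dest: Z)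
  interpret mZ: interval_bounded_random_variable "measure_pmf P" "\<lambda>a. - Z a" "-\<alpha>" \<alpha>
    by unfold_locales (auto simp: AE_measure_pmf_iff dest: Z)
  define \<mu> where "\<mu> = measure_pmf.expectation P Z"
  have mean: "\<mu> \<le> \<alpha>\<^sup>2 / 2"
  proof -
    have "(\<integral>\<^sup>+a. ennreal (exp (1 * (- Z a - measure_pmf.expectation P (\<lambda>a. - Z a)))) \<partial>measure_pmf P)
        \<le> ennreal (exp (1\<^sup>2 * (\<alpha> - -\<alpha>)\<^sup>2 / 8))"
      by (rule mZ.Hoeffdings_lemma_nn_integral) simp
    also have "(\<integral>\<^sup>+a. ennreal (exp (1 * (- Z a - measure_pmf.expectation P (\<lambda>a. - Z a)))) \<partial>measure_pmf P)
        = (\<integral>\<^sup>+a. ennreal (exp \<mu>) * ennreal (pmf Q a / pmf P a) \<partial>measure_pmf P)"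
      by (intro nn_integral_cong_AE AE_pmfI)
        (auto simp: \<mu>_def exp_diff expZ ennreal_mult[symmetric] pmf_nonneg)
    also have "\<dots> = ennreal (exp \<mu>)"
      by (subst nn_integral_cmult) (simp_all add: nn_integral_pmf_ratio[OF eq])
    finally show ?thesis
      by (simp add: power2_eq_square)
  qed
  have "(\<integral>\<^sup>+a. ennreal ((pmf P a / pmf Q a) ^ s) \<partial>measure_pmf P)
      = (\<integral>\<^sup>+a. ennreal (exp (real s * \<mu>)) * ennreal (exp (real s * (Z a - \<mu>))) \<partial>measure_pmf P)"
  proof (intro nn_integral_cong_AE AE_pmfI)
    fix a assume "a \<in> set_pmf P"
    hence "(pmf P a / pmf Q a) ^ s = exp (real s * Z a)"
      by (simp add: expZ exp_of_nat_mult)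
    also have "\<dots> = exp (real s * \<mu>) * exp (real s * (Z a - \<mu>))"
      by (simp add: exp_add[symmetric] algebra_simps)
    finally show "ennreal ((pmf P a / pmf Q a) ^ s)
        = ennreal (exp (real s * \<mu>)) * ennreal (exp (real s * (Z a - \<mu>)))"
      by (simp add: ennreal_mult)
  qed
  also have "\<dots> = ennreal (exp (real s * \<mu>))
      * (\<integral>\<^sup>+a. ennreal (exp (real s * (Z a - \<mu>))) \<partial>measure_pmf P)"
    by (rule nn_integral_cmult) simp
  also have "\<dots> \<le> ennreal (exp (real s * \<mu>)) * ennreal (exp ((real s)\<^sup>2 * (\<alpha> - -\<alpha>)\<^sup>2 / 8))"
    unfolding \<mu>_def by (intro mult_left_mono Z.Hoeffdings_lemma_nn_integral) (use s in auto)
  also have "\<dots> = ennreal (exp (real s * \<mu> + (real s)\<^sup>2 * \<alpha>\<^sup>2 / 2))"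
    by (simp add: ennreal_mult[symmetric] exp_add[symmetric] power2_eq_square)
  also have "\<dots> \<le> ennreal (exp (real s * (real s + 1) * \<alpha>\<^sup>2 / 2))"
  proof -
    have "real s * \<mu> \<le> real s * (\<alpha>\<^sup>2 / 2)"
      by (rule mult_left_mono[OF mean]) simp
    thus ?thesis
      by (intro ennreal_leI) (simp add: algebra_simps power2_eq_square)
  qed
  finally show ?thesis
    using eq by (simp add: renyi_le_def)
qed

section \<open>Adaptive composition of Renyi bounds and conversion to approximate privacy\<close>

lemma pmf_bind_map_Cons:
  "pmf (bind_pmf P (\<lambda>a. map_pmf ((#) a) (R a))) (b # bs) = pmf P b * pmf (R b) bs"
proof -
  have "pmf (map_pmf ((#) a) (R a)) (b # bs) = indicator {b} a * pmf (R b) bs" for a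
  proof (cases "a = b")
    case True
    thus ?thesis by (simp add: pmf_map_inj')
  next
    case False
    thus ?thesis by (auto simp: pmf_eq_0_set_pmf)
  qed
  thus ?thesis
    by (simp add: pmf_bind measure_pmf_single)
qed

lemma pmf_bind_map_Cons_Nil [simp]: "pmf (bind_pmf P (\<lambda>a. map_pmf ((#) a) (R a))) [] = 0"
  by (auto simp: pmf_eq_0_set_pmf)

text \<open>As the list records the first outcome, its likelihood ratio is the product of the two
  ratios and the moment is an iterated integral. The inner one is at most
  \<open>exp \<kappa>'\<close> whatever the first outcome is.\<close>

lemma renyi_le_bind_Cons:
  assumes 1: "renyi_le s \<kappa> P Q" and 2: "\<And>a. renyi_le s \<kappa>' (P' a) (Q' a)"
  shows "renyi_le s (\<kappa> + \<kappa>') (bind_pmf P (\<lambda>a. map_pmf ((#) a) (P' a)))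
                              (bind_pmf Q (\<lambda>a. map_pmf ((#) a) (Q' a)))"
proof -
  let ?P = "bind_pmf P (\<lambda>a. map_pmf ((#) a) (P' a))" and ?Q = "bind_pmf Q (\<lambda>a. map_pmf ((#) a) (Q' a))"
  have "(\<integral>\<^sup>+as. ennreal ((pmf ?P as / pmf ?Q as) ^ s) \<partial>measure_pmf ?P)
      = (\<integral>\<^sup>+a. \<integral>\<^sup>+as. ennreal ((pmf P a / pmf Q a) ^ s) * ennreal ((pmf (P' a) as / pmf (Q' a) as) ^ s)
           \<partial>measure_pmf (P' a) \<partial>measure_pmf P)"
    by (simp add: pmf_bind_map_Cons ennreal_mult[symmetric] power_mult_distrib[symmetric] pmf_nonneg)
  also have "\<dots> = (\<integral>\<^sup>+a. ennreal ((pmf P a / pmf Q a) ^ s)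
      * (\<integral>\<^sup>+as. ennreal ((pmf (P' a) as / pmf (Q' a) as) ^ s) \<partial>measure_pmf (P' a)) \<partial>measure_pmf P)"
    by (simp add: nn_integral_cmult)
  also have "\<dots> \<le> (\<integral>\<^sup>+a. ennreal ((pmf P a / pmf Q a) ^ s) * ennreal (exp \<kappa>') \<partial>measure_pmf P)"
    by (intro nn_integral_mono mult_left_mono) (use 2 in \<open>auto simp: renyi_le_def\<close>)
  also have "\<dots> = (\<integral>\<^sup>+a. ennreal ((pmf P a / pmf Q a) ^ s) \<partial>measure_pmf P) * ennreal (exp \<kappa>')"
    by (simp add: nn_integral_multc)
  also have "\<dots> \<le> ennreal (exp \<kappa>) * ennreal (exp \<kappa>')"
    by (intro mult_right_mono) (use 1 in \<open>auto simp: renyi_le_def\<close>)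
  also have "\<dots> = ennreal (exp (\<kappa> + \<kappa>'))"
    by (simp add: ennreal_mult[symmetric] exp_add)
  moreover have "set_pmf ?P \<subseteq> set_pmf ?Q"
    using 1 2 by (fastforce simp: renyi_le_def)
  ultimately show ?thesis
    by (simp add: renyi_le_def)
qed

text \<open>Where the likelihood ratio is at most \<open>exp \<epsilon>\<close> the pure bound
  holds; the other outcomes, collected in \<open>B\<close>, have small mass by Markov's inequality
  for the \<open>s\<close>-th power of the ratio.\<close>

lemma prob_le_of_renyi_le:
  assumes "renyi_le s \<kappa> P Q"
  shows "measure_pmf.prob P A \<le> exp \<epsilon> * measure_pmf.prob Q A + exp (\<kappa> - real s * \<epsilon>)"
proof -
  define B where "B = {a. pmf P a > exp \<epsilon> * pmf Q a}"
  have "measure_pmf.prob P A \<le> measure_pmf.prob P ((A - B) \<union> B)"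
    by (rule measure_pmf.finite_measure_mono) auto
  also have "\<dots> \<le> measure_pmf.prob P (A - B) + measure_pmf.prob P B"
    by (rule measure_Un_le) auto
  also have "measure_pmf.prob P (A - B) \<le> exp \<epsilon> * measure_pmf.prob Q (A - B)"
    by (rule prob_le_prob_pointwise) (auto simp: B_def)
  also have "\<dots> \<le> exp \<epsilon> * measure_pmf.prob Q A"
    by (intro mult_left_mono measure_pmf.finite_measure_mono) auto
  also have "measure_pmf.prob P B \<le> exp (\<kappa> - real s * \<epsilon>)"
  proof -
    have "ennreal (exp (real s * \<epsilon>)) * emeasure P B
        = (\<integral>\<^sup>+a. ennreal (exp (real s * \<epsilon>)) * indicator B a \<partial>measure_pmf P)"
      by (simp add: nn_integral_cmult_indicator)
    also have "\<dots> \<le> (\<integral>\<^sup>+a. ennreal ((pmf P a / pmf Q a) ^ s) \<partial>measure_pmf P)"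
    proof (intro nn_integral_mono_AE AE_pmfI)
      fix a assume "a \<in> set_pmf P"
      hence pos: "0 < pmf Q a"
        using assms by (auto simp: renyi_le_def intro: pmf_positive)
      show "ennreal (exp (real s * \<epsilon>)) * indicator B a \<le> ennreal ((pmf P a / pmf Q a) ^ s)"
      proof (cases "a \<in> B")
        case True
        hence "exp \<epsilon> \<le> pmf P a / pmf Q a"
          using pos by (simp add: B_def field_simps)
        hence "exp \<epsilon> ^ s \<le> (pmf P a / pmf Q a) ^ s"
          by (intro power_mono) auto
        thus ?thesis
          using True by (simp add: exp_of_nat_mult ennreal_leI)
      qed simp
    qed
    also have "\<dots> \<le> ennreal (exp \<kappa>)"
      using assms by (simp add: renyi_le_def)
    finally have "exp (real s * \<epsilon>) * measure_pmf.prob P B \<le> exp \<kappa>"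
      by (simp add: measure_pmf.emeasure_eq_measure ennreal_mult[symmetric])
    thus ?thesis
      by (simp add: exp_diff field_simps)
  qed
  finally show ?thesis by simp
qed

section \<open>Discrete noise\<close>

definition weighted_pmf :: "(int \<Rightarrow> real) \<Rightarrow> int pmf" where
  "weighted_pmf w = embed_pmf (\<lambda>n. w n / enn2real (\<integral>\<^sup>+k. ennreal (w k) \<partial>count_space UNIV))"

text \<open>\<open>int_decode\<close> enumerates 0, -1, 1, -2, ..., so its \<open>n\<close>-th value
  has modulus at least \<open>n / 2\<close> and a geometric series dominates.\<close>

lemma nn_integral_exp_abs_int_finite:
  assumes "0 < (b::real)"
  shows "(\<integral>\<^sup>+k. ennreal (exp (- b * \<bar>real_of_int k\<bar>)) \<partial>count_space UNIV) < \<infinity>"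
proof -
  have abs_ge: "real n / 2 \<le> \<bar>real_of_int (int_decode n)\<bar>" for n
  proof (cases "even n")
    case True
    thus ?thesis
      by (auto simp: int_decode_def sum_decode_def elim!: evenE)
  next
    case False
    thus ?thesis
      by (auto simp: int_decode_def sum_decode_def elim!: oddE)
  qed
  have "(\<integral>\<^sup>+k. ennreal (exp (- b * \<bar>real_of_int k\<bar>)) \<partial>count_space UNIV)
      = (\<integral>\<^sup>+n. ennreal (exp (- b * \<bar>real_of_int (int_decode n)\<bar>)) \<partial>count_space UNIV)"
    by (rule nn_integral_bij_count_space[symmetric]) (rule bij_int_decode)
  also have "\<dots> \<le> (\<integral>\<^sup>+n. ennreal (exp (- b / 2) ^ n) \<partial>count_space UNIV)"
  proof (intro nn_integral_mono ennreal_leI)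
    fix n
    show "exp (- b * \<bar>real_of_int (int_decode n)\<bar>) \<le> exp (- b / 2) ^ n"
      using mult_left_mono[OF abs_ge[of n], of b] assms
      unfolding exp_of_nat_mult[symmetric] by (simp add: mult.commute)
  qed
  also have "\<dots> = (\<Sum>n. ennreal (exp (- b / 2) ^ n))"
    by (rule nn_integral_count_space_nat)
  also have "\<dots> < \<infinity>"
  proof -
    have "(\<Sum>n. ennreal (exp (- b / 2) ^ n)) \<noteq> top"
      by (rule ennreal_suminf_neq_top) (use assms in \<open>simp_all add: summable_geometric\<close>)
    thus ?thesis by (simp add: less_top)
  qed
  finally show ?thesis .
qed

text \<open>\<open>Z\<close> stays abstract: later arguments only compare masses at two points,
  where it cancels.\<close>

lemma pmf_weighted_pmf:
  assumes pos: "\<And>n. 0 < w n" and b: "0 < b" and le: "\<And>n. w n \<le> exp (- b * \<bar>real_of_int n\<bar>)"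
  shows "\<exists>Z>0. \<forall>n. pmf (weighted_pmf w) n = w n / Z"
proof -
  define I where "I = (\<integral>\<^sup>+k. ennreal (w k) \<partial>count_space UNIV)"
  have "I \<le> (\<integral>\<^sup>+k. ennreal (exp (- b * \<bar>real_of_int k\<bar>)) \<partial>count_space UNIV)"
    unfolding I_def by (intro nn_integral_mono ennreal_leI le)
  hence fin: "I < \<infinity>"
    using nn_integral_exp_abs_int_finite[OF b] by (rule le_less_trans)
  have "0 < ennreal (w 0)"
    using pos by simp
  also have "\<dots> \<le> I"
    unfolding I_def by (rule nn_integral_ge_point) simp
  finally have nz: "0 < I" .
  have Z: "0 < enn2real I" "ennreal (enn2real I) = I"
    using fin nz by (auto simp: enn2real_positive_iff)
  have "(\<integral>\<^sup>+n. ennreal (w n / enn2real I) \<partial>count_space UNIV)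
      = (\<integral>\<^sup>+n. ennreal (w n) * ennreal (1 / enn2real I) \<partial>count_space UNIV)"
    using pos Z(1) by (intro nn_integral_cong) (simp add: ennreal_mult[symmetric] less_imp_le)
  also have "\<dots> = ennreal (enn2real I) * ennreal (1 / enn2real I)"
    by (subst nn_integral_multc) (simp_all add: I_def[symmetric] Z)
  also have "\<dots> = 1"
    using Z(1) by (simp add: ennreal_mult[symmetric])
  finally have "pmf (weighted_pmf w) n = w n / enn2real I" for n
    unfolding weighted_pmf_def I_def[symmetric]
    by (intro pmf_embed_pmf) (use pos Z(1) in \<open>auto simp: less_imp_le\<close>)
  with Z(1) show ?thesis by blast
qed

lemma prob_abs_gt_le:
  fixes p :: "int pmf"
  assumes right: "\<And>k. 0 \<le> k \<Longrightarrow> measure_pmf.prob p {n. k \<le> n} \<le> h (real_of_int k)"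
    and left: "\<And>k. 0 \<le> k \<Longrightarrow> measure_pmf.prob p {n. n \<le> - k} \<le> h (real_of_int k)"
    and h: "\<And>u v. 0 \<le> u \<Longrightarrow> u \<le> v \<Longrightarrow> h v \<le> h u" and x: "0 \<le> x"
  shows "measure_pmf.prob p {n. x < \<bar>real_of_int n\<bar>} \<le> 2 * h x"
proof -
  have "measure_pmf.prob p {n. x < \<bar>real_of_int n\<bar>} \<le> measure_pmf.prob p ({n. \<lceil>x\<rceil> \<le> n} \<union> {n. n \<le> - \<lceil>x\<rceil>})"
    by (intro measure_pmf.finite_measure_mono) (auto, linarith)
  also have "\<dots> \<le> measure_pmf.prob p {n. \<lceil>x\<rceil> \<le> n} + measure_pmf.prob p {n. n \<le> - \<lceil>x\<rceil>}"
    by (rule measure_Un_le) auto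
  also have "\<dots> \<le> h \<lceil>x\<rceil> + h \<lceil>x\<rceil>"
    using x by (intro add_mono right left) auto
  also have "h \<lceil>x\<rceil> \<le> h x"
    using x by (intro h) auto
  finally show ?thesis by simp
qed

subsection \<open>Two-sided geometric distribution\<close>

definition geo :: "real \<Rightarrow> int pmf" where
  "geo a = weighted_pmf (\<lambda>n. exp (- a * \<bar>real_of_int n\<bar>))"

lemma pmf_geo:
  assumes "0 < a"
  shows "\<exists>Z>0. \<forall>n. pmf (geo a) n = exp (- a * \<bar>real_of_int n\<bar>) / Z"
  unfolding geo_def by (rule pmf_weighted_pmf[where b = a]) (use assms in auto)

lemma pmf_geo_shift:
  assumes "0 < a"
  shows "pmf (geo a) n \<le> exp (a * \<bar>real_of_int k\<bar>) * pmf (geo a) (n + k)"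
proof -
  obtain Z where Z: "0 < Z" "\<And>n. pmf (geo a) n = exp (- a * \<bar>real_of_int n\<bar>) / Z"
    using pmf_geo[OF assms] by blast
  have "\<bar>real_of_int (n + k)\<bar> \<le> \<bar>real_of_int n\<bar> + \<bar>real_of_int k\<bar>"
    by simp
  hence "a * \<bar>real_of_int (n + k)\<bar> \<le> a * \<bar>real_of_int n\<bar> + a * \<bar>real_of_int k\<bar>"
    using assms by (metis distrib_left mult_left_mono less_imp_le)
  thus ?thesis
    using Z(1) unfolding Z(2) by (simp add: exp_add[symmetric] divide_right_mono)
qed

text \<open>No series is summed: moving the tail inwards by \<open>k\<close> multiplies each mass by
  \<open>exp (a * k)\<close>, and the moved tail still has mass at most 1.\<close>

lemma prob_geo_gt:
  assumes a: "0 < a" and x: "0 \<le> x"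
  shows "measure_pmf.prob (geo a) {n. x < \<bar>real_of_int n\<bar>} \<le> 2 * exp (- a * x)"
proof (rule prob_abs_gt_le[where h = "\<lambda>x. exp (- a * x)", OF _ _ _ x])
  obtain Z where Z: "0 < Z" "\<And>n. pmf (geo a) n = exp (- a * \<bar>real_of_int n\<bar>) / Z"
    using pmf_geo[OF a] by blast
  fix k :: int assume k: "0 \<le> k"
  have "measure_pmf.prob (geo a) {n. k \<le> n} \<le> exp (- a * k) * measure_pmf.prob (geo a) UNIV"
    by (rule prob_le_prob_by_injection[where \<phi> = "\<lambda>n. n - k"])
      (use k Z(1) in \<open>auto simp: inj_on_def Z(2) exp_add[symmetric] algebra_simps divide_right_mono\<close>)
  thus "measure_pmf.prob (geo a) {n. k \<le> n} \<le> exp (- a * k)" by simp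
  have "measure_pmf.prob (geo a) {n. n \<le> - k} \<le> exp (- a * k) * measure_pmf.prob (geo a) UNIV"
    by (rule prob_le_prob_by_injection[where \<phi> = "\<lambda>n. n + k"])
      (use k Z(1) in \<open>auto simp: inj_on_def Z(2) exp_add[symmetric] algebra_simps divide_right_mono\<close>)
  thus "measure_pmf.prob (geo a) {n. n \<le> - k} \<le> exp (- a * k)" by simp
qed (use a in auto)

subsection \<open>Discrete Gaussian distribution\<close>

definition gauss :: "real \<Rightarrow> int pmf" where
  "gauss v = weighted_pmf (\<lambda>n. exp (- (real_of_int n)\<^sup>2 / (2 * v)))"

lemma pmf_gauss:
  assumes "0 < v"
  shows "\<exists>Z>0. \<forall>n. pmf (gauss v) n = exp (- (real_of_int n)\<^sup>2 / (2 * v)) / Z"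
proof -
  have "exp (- (real_of_int n)\<^sup>2 / (2 * v)) \<le> exp (- (1 / (2 * v)) * \<bar>real_of_int n\<bar>)" for n
  proof -
    have "\<bar>n\<bar> * 1 \<le> \<bar>n\<bar> * \<bar>n\<bar>"
      by (cases "n = 0") (simp, intro mult_left_mono, auto)
    hence "\<bar>real_of_int n\<bar> \<le> (real_of_int n)\<^sup>2"
      by (simp add: power2_eq_square flip: of_int_abs of_int_mult)
    thus ?thesis
      using assms by (simp add: divide_right_mono)
  qed
  thus ?thesis
    unfolding gauss_def by (intro pmf_weighted_pmf[where b = "1 / (2 * v)"]) (use assms in auto)
qed

lemma prob_gauss_gt:
  assumes v: "0 < v" and x: "0 \<le> x"
  shows "measure_pmf.prob (gauss v) {n. x < \<bar>real_of_int n\<bar>} \<le> 2 * exp (- x\<^sup>2 / (2 * v))"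
proof (rule prob_abs_gt_le[where h = "\<lambda>x. exp (- x\<^sup>2 / (2 * v))", OF _ _ _ x])
  obtain Z where Z: "0 < Z" "\<And>n. pmf (gauss v) n = exp (- (real_of_int n)\<^sup>2 / (2 * v)) / Z"
    using pmf_gauss[OF v] by blast
  fix k :: int assume k: "0 \<le> k"
  \<comment> \<open>The tail again moves inwards by \<open>k\<close>, and
    \<open>(\<bar>m\<bar> + k)\<^sup>2\<close> is at least
    \<open>m\<^sup>2 + k\<^sup>2\<close>.\<close>
  have le: "pmf (gauss v) n \<le> exp (- ((real_of_int k)\<^sup>2 / (2 * v))) * pmf (gauss v) m"
    if "\<bar>n\<bar> = \<bar>m\<bar> + k" for n m
  proof -
    have n: "\<bar>real_of_int n\<bar> = \<bar>real_of_int m\<bar> + real_of_int k"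
      using that by linarith
    have "(real_of_int m)\<^sup>2 + (real_of_int k)\<^sup>2 \<le> \<bar>real_of_int n\<bar>\<^sup>2"
      using k unfolding n by (simp add: power2_sum)
    hence "- (real_of_int n)\<^sup>2 / (2 * v) \<le> - (real_of_int k)\<^sup>2 / (2 * v) + - (real_of_int m)\<^sup>2 / (2 * v)"
      using v by (simp add: field_simps)
    hence "exp (- (real_of_int n)\<^sup>2 / (2 * v))
        \<le> exp (- (real_of_int k)\<^sup>2 / (2 * v)) * exp (- (real_of_int m)\<^sup>2 / (2 * v))"
      by (simp only: exp_add[symmetric] exp_le_cancel_iff)
    thus ?thesis
      using Z(1) unfolding Z(2) by (simp add: divide_right_mono)
  qed
  have "measure_pmf.prob (gauss v) {n. k \<le> n}
      \<le> exp (- (real_of_int k)\<^sup>2 / (2 * v)) * measure_pmf.prob (gauss v) UNIV"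
    by (rule prob_le_prob_by_injection[where \<phi> = "\<lambda>n. n - k"]) (use k in \<open>simp_all add: inj_on_def le\<close>)
  thus "measure_pmf.prob (gauss v) {n. k \<le> n} \<le> exp (- (real_of_int k)\<^sup>2 / (2 * v))" by simp
  have "measure_pmf.prob (gauss v) {n. n \<le> - k}
      \<le> exp (- (real_of_int k)\<^sup>2 / (2 * v)) * measure_pmf.prob (gauss v) UNIV"
    by (rule prob_le_prob_by_injection[where \<phi> = "\<lambda>n. n + k"]) (use k in \<open>simp_all add: inj_on_def le\<close>)
  thus "measure_pmf.prob (gauss v) {n. n \<le> - k} \<le> exp (- (real_of_int k)\<^sup>2 / (2 * v))" by simp
next
  fix x y :: real assume "0 \<le> x" "x \<le> y"
  hence "x\<^sup>2 \<le> y\<^sup>2" by simp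
  thus "exp (- y\<^sup>2 / (2 * v)) \<le> exp (- x\<^sup>2 / (2 * v))"
    using v by (simp only: exp_le_cancel_iff) (intro divide_right_mono, auto)
qed

lemma set_pmf_gauss: "0 < v \<Longrightarrow> set_pmf (gauss v) = UNIV"
proof -
  assume "0 < v"
  then obtain Z where "0 < Z" "\<And>n. pmf (gauss v) n = exp (- (real_of_int n)\<^sup>2 / (2 * v)) / Z"
    using pmf_gauss by blast
  hence "pmf (gauss v) n \<noteq> 0" for n by simp
  thus ?thesis by (auto simp: set_pmf_iff)
qed

text \<open>Completing the square turns the integrand into the mass function shifted by \<open>s * k\<close>.\<close>

lemma nn_integral_gauss_ratio:
  assumes v: "0 < v" and k: "\<bar>k\<bar> \<le> 1"
  shows "(\<integral>\<^sup>+n. ennreal ((pmf (gauss v) n / pmf (gauss v) (n + k)) ^ s) \<partial>measure_pmf (gauss v))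
    \<le> ennreal (exp (real s * (real s + 1) / (2 * v)))"
proof -
  obtain Z where Z: "0 < Z" "\<And>n. pmf (gauss v) n = exp (- (real_of_int n)\<^sup>2 / (2 * v)) / Z"
    using pmf_gauss[OF v] by blast
  let ?c = "exp (real s * (real s + 1) * (real_of_int k)\<^sup>2 / (2 * v))"
  have "(\<integral>\<^sup>+n. ennreal ((pmf (gauss v) n / pmf (gauss v) (n + k)) ^ s) \<partial>measure_pmf (gauss v))
    = (\<integral>\<^sup>+n. ennreal ?c * ennreal (pmf (gauss v) (n - int s * k)) \<partial>count_space UNIV)"
    unfolding nn_integral_measure_pmf
  proof (intro nn_integral_cong)
    fix n :: int
    let ?e = "\<lambda>n. - (real_of_int n)\<^sup>2 / (2 * v)"
    have "pmf (gauss v) n / pmf (gauss v) (n + k) = exp (?e n - ?e (n + k))"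
      using Z(1) unfolding Z(2) exp_diff by simp
    hence "pmf (gauss v) n * (pmf (gauss v) n / pmf (gauss v) (n + k)) ^ s
        = exp (?e n + real s * (?e n - ?e (n + k))) / Z"
      unfolding exp_add exp_of_nat_mult by (simp add: Z(2))
    also have "?e n + real s * (?e n - ?e (n + k))
        = real s * (real s + 1) * (real_of_int k)\<^sup>2 / (2 * v) + ?e (n - int s * k)"
      using v by (simp add: field_simps power2_eq_square)
    also have "exp \<dots> / Z = ?c * pmf (gauss v) (n - int s * k)"
      unfolding exp_add Z(2) by simp
    finally show "ennreal (pmf (gauss v) n) * ennreal ((pmf (gauss v) n / pmf (gauss v) (n + k)) ^ s)
        = ennreal ?c * ennreal (pmf (gauss v) (n - int s * k))"
      by (simp add: ennreal_mult[symmetric] pmf_nonneg)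
  qed
  also have "\<dots> = ennreal ?c * emeasure (gauss v) (range (\<lambda>n. n - int s * k))"
    by (subst nn_integral_cmult) (simp_all add: nn_integral_pmf' inj_on_def)
  also have "\<dots> \<le> ennreal ?c * 1"
    by (intro mult_left_mono measure_pmf.emeasure_le_1) auto
  also have "\<dots> \<le> ennreal (exp (real s * (real s + 1) / (2 * v)))"
  proof -
    have "(real_of_int k)\<^sup>2 \<le> 1"
      using k by (simp add: abs_square_le_1 flip: of_int_abs)
    hence "real s * (real s + 1) * (real_of_int k)\<^sup>2 \<le> real s * (real s + 1) * 1"
      by (intro mult_left_mono) auto
    thus ?thesis
      using v by (simp add: ennreal_leI divide_right_mono)
  qed
  finally show ?thesis .
qed

text \<open>\<open>f\<close> and \<open>g\<close> turn noise into output on the two inputs, and a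
  shift of the noise by \<open>k\<close> makes up for the difference of the inputs.\<close>

lemma renyi_le_map_gauss:
  assumes v: "0 < v" and f: "inj f" and k: "\<bar>k\<bar> \<le> 1" and g: "\<And>n. g (n + k) = f n"
  shows "renyi_le s (real s * (real s + 1) / (2 * v)) (map_pmf f (gauss v)) (map_pmf g (gauss v))"
proof -
  have g_eq: "g = (\<lambda>n. f (n - k))"
    by (rule ext) (metis diff_add_cancel g)
  hence inj_g: "inj g"
    using f unfolding inj_def by (metis diff_add_cancel)
  have "pmf (map_pmf g (gauss v)) (f n) = pmf (gauss v) (n + k)" for n
    by (subst g[symmetric]) (rule pmf_map_inj'[OF inj_g])
  moreover have "range f \<subseteq> range g"
  proof
    fix y assume "y \<in> range f"
    then obtain n where "y = f n" by blast
    hence "y = g (n + k)" by (simp only: g)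
    thus "y \<in> range g" by simp
  qed
  ultimately show ?thesis
    using nn_integral_gauss_ratio[OF v k, of s]
    by (simp add: renyi_le_def pmf_map_inj'[OF f] set_pmf_gauss[OF v])
qed

section \<open>Independent sequences\<close>

fun seq_pmf :: "'a pmf list \<Rightarrow> 'a list pmf" where
  "seq_pmf [] = return_pmf []"
| "seq_pmf (p # ps) = bind_pmf p (\<lambda>a. map_pmf ((#) a) (seq_pmf ps))"

lemma length_seq_pmf: "xs \<in> set_pmf (seq_pmf ps) \<Longrightarrow> length xs = length ps"
  by (induction ps arbitrary: xs) auto

lemma pmf_seq_pmf:
  "length xs = length ps \<Longrightarrow> pmf (seq_pmf ps) xs = (\<Prod>i<length ps. pmf (ps ! i) (xs ! i))"
proof (induction ps arbitrary: xs)
  case Nil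
  thus ?case by simp
next
  case (Cons p ps)
  then obtain y ys where "xs = y # ys" "length ys = length ps"
    by (cases xs) auto
  thus ?case
    using Cons.IH by (simp add: pmf_bind_map_Cons prod.lessThan_Suc_shift del: prod.lessThan_Suc)
qed

lemma map_nth_seq_pmf: "i < length ps \<Longrightarrow> map_pmf (\<lambda>xs. xs ! i) (seq_pmf ps) = ps ! i"
proof (induction ps arbitrary: i)
  case (Cons p ps)
  show ?case
  proof (cases i)
    case 0
    thus ?thesis
      by (simp add: map_bind_pmf pmf.map_comp o_def map_pmf_const bind_return_pmf')
  next
    case (Suc j)
    hence "map_pmf (\<lambda>xs. xs ! i) (seq_pmf (p # ps)) = bind_pmf p (\<lambda>_. map_pmf (\<lambda>xs. xs ! j) (seq_pmf ps))"
      by (simp add: map_bind_pmf pmf.map_comp o_def)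
    thus ?thesis
      using Suc Cons by simp
  qed
qed simp

lemma prob_seq_pmf_ex_le:
  "measure_pmf.prob (seq_pmf ps) {xs. \<exists>i<length ps. xs ! i \<in> B i}
    \<le> (\<Sum>i<length ps. measure_pmf.prob (ps ! i) (B i))"
proof -
  have "{xs. \<exists>i<length ps. xs ! i \<in> B i} = (\<Union>i<length ps. (\<lambda>xs. xs ! i) -` B i)"
    by auto
  hence "measure_pmf.prob (seq_pmf ps) {xs. \<exists>i<length ps. xs ! i \<in> B i}
      \<le> (\<Sum>i<length ps. measure_pmf.prob (seq_pmf ps) ((\<lambda>xs. xs ! i) -` B i))"
    by (simp add: measure_UNION_le)
  also have "\<dots> = (\<Sum>i<length ps. measure_pmf.prob (ps ! i) (B i))"
    by (intro sum.cong refl) (metis lessThan_iff map_nth_seq_pmf measure_map_pmf)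
  finally show ?thesis .
qed

section \<open>Sparse release of a sequence of counts\<close>

text \<open>
  The state is the pair of the time and the value of the last release. The \<open>m\<close>-th release draws
  a block of fresh noise: entry 0 of its list perturbs the threshold, entry \<open>s\<close> the query at time
  \<open>s\<close>, and its second component is added to the released count. In mode \<open>always\<close> a release happens
  at the next time step; otherwise once the released value is noticeably outdated. The time
  \<open>Suc n\<close>, beyond the horizon \<open>n\<close>, encodes that no further release takes place.
\<close>

type_synonym block = "int list \<times> int"

locale sparse_release =
  fixes T :: nat and always :: "nat \<Rightarrow> bool" and threshold :: "nat \<Rightarrow> real"
    and query_noise answer_noise :: "nat \<Rightarrow> int pmf"
begin

definition block :: "nat \<Rightarrow> block pmf" where
  "block m = pair_pmf (seq_pmf (replicate (Suc T) (query_noise m))) (answer_noise m)"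

definition fires :: "(nat \<Rightarrow> int) \<Rightarrow> nat \<Rightarrow> block \<Rightarrow> int \<Rightarrow> nat \<Rightarrow> bool" where
  "fires c m b v s \<longleftrightarrow> always m \<or> threshold m + fst b ! 0 \<le> \<bar>c s - v\<bar> + fst b ! s"

definition advance :: "(nat \<Rightarrow> int) \<Rightarrow> nat \<Rightarrow> nat \<Rightarrow> block \<Rightarrow> nat \<times> int \<Rightarrow> nat \<times> int" where
  "advance c n m b st =
     (if \<exists>s. fst st < s \<and> s \<le> n \<and> fires c m b (snd st) s
      then let s = LEAST s. fst st < s \<and> fires c m b (snd st) s in (s, c s + snd b)
      else (Suc n, snd st))"

fun run :: "(nat \<Rightarrow> int) \<Rightarrow> nat \<Rightarrow> block list \<Rightarrow> nat \<Rightarrow> nat \<times> int \<Rightarrow> (nat \<times> int) list" where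
  "run c n [] m st = []"
| "run c n (b # bs) m st = advance c n m b st # run c n bs (Suc m) (advance c n m b st)"

text \<open>Removes \<open>LEAST\<close>: the event that a given time and value are released becomes
  a conjunction of conditions on the noise, to which a shift of the noise can be applied.\<close>

lemma advance_eq_iff:
  assumes "s \<le> n"
  shows "advance c n m b (t, v) = (s, w) \<longleftrightarrow>
    t < s \<and> fires c m b v s \<and> (\<forall>r. t < r \<longrightarrow> r < s \<longrightarrow> \<not> fires c m b v r) \<and> w = c s + snd b"
proof
  assume *: "advance c n m b (t, v) = (s, w)"
  let ?P = "\<lambda>s. t < s \<and> fires c m b v s"
  have ex: "\<exists>s. ?P s" and s: "s = (LEAST s. ?P s)" and w: "w = c s + snd b"
    using * assms by (auto simp: advance_def Let_def split: if_splits)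
  have "?P s"
    unfolding s by (rule LeastI_ex[OF ex])
  moreover have "\<not> ?P r" if "r < s" for r
    using that unfolding s by (rule not_less_Least)
  ultimately show "t < s \<and> fires c m b v s \<and> (\<forall>r. t < r \<longrightarrow> r < s \<longrightarrow> \<not> fires c m b v r) \<and> w = c s + snd b"
    using w by blast
next
  assume *: "t < s \<and> fires c m b v s \<and> (\<forall>r. t < r \<longrightarrow> r < s \<longrightarrow> \<not> fires c m b v r) \<and> w = c s + snd b"
  hence "(LEAST s. t < s \<and> fires c m b v s) = s"
    by (intro Least_equality) (auto intro: leI)
  thus "advance c n m b (t, v) = (s, w)"
    using * assms by (auto simp: advance_def Let_def)
qed

lemma advance_eq_Suc_iff:
  "advance c n m b (t, v) = (Suc n, w) \<longleftrightarrow> w = v \<and> (\<forall>r. t < r \<longrightarrow> r \<le> n \<longrightarrow> \<not> fires c m b v r)"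
proof (cases "\<exists>s. t < s \<and> s \<le> n \<and> fires c m b v s")
  case True
  then obtain s where s: "t < s" "s \<le> n" "fires c m b v s" by blast
  hence "(LEAST s. t < s \<and> fires c m b v s) \<le> s"
    by (intro Least_le) auto
  with s show ?thesis
    by (auto simp: advance_def Let_def)
next
  case False
  thus ?thesis by (auto simp: advance_def)
qed

lemma advance_cases:
  obtains s where "t < s" "s \<le> n" "advance c n m b (t, v) = (s, c s + snd b)"
  | "advance c n m b (t, v) = (Suc n, v)"
proof (cases "\<exists>s. t < s \<and> s \<le> n \<and> fires c m b v s")
  case True
  let ?P = "\<lambda>s. t < s \<and> fires c m b v s" and ?s = "LEAST s. t < s \<and> fires c m b v s"
  obtain s where "?P s" "s \<le> n" using True by blast
  hence "?P ?s" "?s \<le> n"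
    using LeastI[of ?P s] Least_le[of ?P s] by auto
  thus thesis
    using True that(1)[of ?s] by (simp add: advance_def Let_def)
next
  case False
  thus thesis by (intro that(2)) (auto simp: advance_def)
qed

lemma advance_always:
  assumes "always m"
  shows "advance c n m b (t, v) = (if t < n then (Suc t, c (Suc t) + snd b) else (Suc n, v))"
proof (cases "t < n")
  case True
  thus ?thesis
    using assms by (simp add: advance_eq_iff fires_def)
next
  case False
  thus ?thesis
    by (simp add: advance_eq_Suc_iff)
qed

subsection \<open>Privacy\<close>

definition step_law :: "(nat \<Rightarrow> int) \<Rightarrow> nat \<Rightarrow> nat \<Rightarrow> nat \<times> int \<Rightarrow> (nat \<times> int) pmf" where
  "step_law c n m st = map_pmf (\<lambda>b. advance c n m b st) (block m)"

fun trace_law :: "(nat \<Rightarrow> int) \<Rightarrow> nat \<Rightarrow> nat \<Rightarrow> nat \<Rightarrow> nat \<times> int \<Rightarrow> (nat \<times> int) list pmf" where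
  "trace_law c n 0 m st = return_pmf []"
| "trace_law c n (Suc k) m st =
     bind_pmf (step_law c n m st) (\<lambda>st'. map_pmf ((#) st') (trace_law c n k (Suc m) st'))"

definition block_list :: "nat \<Rightarrow> nat \<Rightarrow> block list pmf" where
  "block_list m k = seq_pmf (map block [m..<m + k])"

text \<open>Each release has a fresh block, so drawing all blocks beforehand, as the algorithm does,
  gives the same trace as the Markov chain that draws each block when it is needed. Composition
  arguments work on the chain.\<close>

lemma map_run_block_list: "map_pmf (\<lambda>bs. run c n bs m st) (block_list m k) = trace_law c n k m st"
proof (induction k arbitrary: m st)
  case 0
  thus ?case by (simp add: block_list_def)
next
  case (Suc k)
  have upt: "[m..<m + Suc k] = m # [Suc m..<Suc m + k]"
    by (simp add: upt_conv_Cons)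
  have "map_pmf (\<lambda>bs. run c n bs m st) (block_list m (Suc k))
      = bind_pmf (block m) (\<lambda>b. map_pmf ((#) (advance c n m b st))
          (map_pmf (\<lambda>bs. run c n bs (Suc m) (advance c n m b st)) (block_list (Suc m) k)))"
    unfolding block_list_def upt by (simp add: map_bind_pmf pmf.map_comp o_def Let_def del: upt_Suc)
  also have "\<dots> = trace_law c n (Suc k) m st"
    unfolding Suc.IH by (simp add: step_law_def bind_map_pmf)
  finally show ?case .
qed

lemma pmf_trace_law_le:
  assumes "\<And>i st a. i < m + k \<Longrightarrow> pmf (step_law c n i st) a \<le> exp (\<kappa> i) * pmf (step_law c' n i st) a"
  shows "pmf (trace_law c n k m st) as \<le> exp (\<Sum>i=m..<m+k. \<kappa> i) * pmf (trace_law c' n k m st) as"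
  using assms
proof (induction k arbitrary: m st as)
  case 0
  thus ?case by simp
next
  case (Suc k)
  show ?case
  proof (cases as)
    case Nil
    thus ?thesis by simp
  next
    case (Cons b bs)
    have "pmf (step_law c n m st) b * pmf (trace_law c n k (Suc m) b) bs
        \<le> (exp (\<kappa> m) * pmf (step_law c' n m st) b)
            * (exp (\<Sum>i=Suc m..<Suc m+k. \<kappa> i) * pmf (trace_law c' n k (Suc m) b) bs)"
      by (intro mult_mono Suc.IH Suc.prems) (auto simp: pmf_nonneg)
    moreover have "(\<Sum>i=m..<m + Suc k. \<kappa> i) = \<kappa> m + (\<Sum>i=Suc m..<Suc m+k. \<kappa> i)"
      by (subst sum.atLeast_Suc_lessThan) auto
    ultimately show ?thesis
      by (simp add: Cons pmf_bind_map_Cons exp_add mult_ac)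
  qed
qed

lemma renyi_le_trace_law:
  assumes "\<And>i st. i < m + k \<Longrightarrow> renyi_le s (\<kappa> i) (step_law c n i st) (step_law c' n i st)"
  shows "renyi_le s (\<Sum>i=m..<m+k. \<kappa> i) (trace_law c n k m st) (trace_law c' n k m st)"
  using assms
proof (induction k arbitrary: m st)
  case 0
  thus ?case by (simp add: renyi_le_return)
next
  case (Suc k)
  have "(\<Sum>i=m..<m + Suc k. \<kappa> i) = \<kappa> m + (\<Sum>i=Suc m..<Suc m+k. \<kappa> i)"
    by (subst sum.atLeast_Suc_lessThan) auto
  moreover have "renyi_le s (\<kappa> m + (\<Sum>i=Suc m..<Suc m+k. \<kappa> i)) (trace_law c n (Suc k) m st) (trace_law c' n (Suc k) m st)"
    unfolding trace_law.simps by (intro renyi_le_bind_Cons Suc.IH Suc.prems) auto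
  ultimately show ?case by simp
qed

text \<open>
  Raising the threshold noise by 1 keeps all earlier queries below the threshold when
  \<open>c\<close> is replaced by \<open>c'\<close>, and raising the noise of the firing query by 2 keeps that one above it.
\<close>

lemma pmf_step_law_le_sparse:
  assumes q: "query_noise m = geo a" and an: "answer_noise m = geo a" and a: "0 < a"
    and c: "\<And>s. 1 \<le> s \<Longrightarrow> s \<le> n \<Longrightarrow> \<bar>c s - c' s\<bar> \<le> 1" and n: "n \<le> T"
    and sparse: "\<not> always m"
  shows "pmf (step_law c n m st) out \<le> exp (4 * a) * pmf (step_law c' n m st) out"
proof -
  obtain t v s w where st: "st = (t, v)" and out: "out = (s, w)"
    by (metis surj_pair)
  define \<eta> :: "nat \<Rightarrow> int" where "\<eta> i = (if i = 0 then 1 else if i = s \<and> s \<le> n then 2 else 0)" for i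
  \<comment> \<open>The answer noise moves by \<open>\<Delta>\<close>, so that the released value
    stays \<open>w\<close>; without a release there is nothing to correct. The moves by 1, 2 and at
    most 1 add up to the factor 4.\<close>
  define \<Delta> where "\<Delta> = (if 1 \<le> s \<and> s \<le> n then c s - c' s else 0)"
  define \<phi> :: "block \<Rightarrow> block" where
    "\<phi> b = (map (\<lambda>i. fst b ! i + \<eta> i) [0..<Suc T], snd b + \<Delta>)" for b
  have len: "length (fst b) = Suc T" if "b \<in> set_pmf (block m)" for b
  proof -
    have "fst b \<in> set_pmf (seq_pmf (replicate (Suc T) (query_noise m)))"
      using that by (auto simp: block_def simp del: replicate_Suc)
    thus ?thesis
      by (auto dest: length_seq_pmf simp del: replicate_Suc)
  qed
  have nth: "fst (\<phi> b) ! i = fst b ! i + \<eta> i" if "i \<le> T" for b i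
    using that by (simp add: \<phi>_def nth_append less_Suc_eq_le[symmetric] del: upt_Suc)
  have fires0: "\<not> fires c' m (\<phi> b) v r"
    if "\<not> fires c m b v r" "r \<noteq> s \<or> n < s" "1 \<le> r" "r \<le> n" for b r
  proof -
    have "fst (\<phi> b) ! 0 = fst b ! 0 + 1" "fst (\<phi> b) ! r = fst b ! r"
      using nth[of 0 b] nth[of r b] that n by (auto simp: \<eta>_def)
    moreover have "\<bar>c' r - v\<bar> \<le> \<bar>c r - v\<bar> + 1"
      using c[OF that(3,4)] by linarith
    ultimately show ?thesis
      using that(1) sparse unfolding fires_def by auto
  qed
  have fires1: "fires c' m (\<phi> b) v s" if "fires c m b v s" "1 \<le> s" "s \<le> n" for b
  proof -
    have "fst (\<phi> b) ! 0 = fst b ! 0 + 1" "fst (\<phi> b) ! s = fst b ! s + 2"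
      using nth[of 0 b] nth[of s b] that n by (auto simp: \<eta>_def)
    moreover have "\<bar>c s - v\<bar> \<le> \<bar>c' s - v\<bar> + 1"
      using c[OF that(2,3)] by linarith
    ultimately show ?thesis
      using that(1) sparse unfolding fires_def by auto
  qed
  have "measure_pmf.prob (block m) {b. advance c n m b (t, v) = (s, w)}
    \<le> exp (4 * a) * measure_pmf.prob (block m) {b. advance c' n m b (t, v) = (s, w)}"
  proof (rule prob_le_prob_by_injection[where \<phi> = \<phi>])
    show "inj_on \<phi> ({b. advance c n m b (t, v) = (s, w)} \<inter> set_pmf (block m))"
    proof (rule inj_onI)
      fix b b' assume "b \<in> {b. advance c n m b (t, v) = (s, w)} \<inter> set_pmf (block m)"
        "b' \<in> {b. advance c n m b (t, v) = (s, w)} \<inter> set_pmf (block m)" and eq: "\<phi> b = \<phi> b'"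
      hence l: "length (fst b) = Suc T" "length (fst b') = Suc T"
        using len by auto
      have "fst b ! i = fst b' ! i" if "i < Suc T" for i
        using nth[of i b] nth[of i b'] that eq by simp
      with l have "fst b = fst b'"
        by (intro nth_equalityI) auto
      moreover have "snd b = snd b'"
        using eq by (simp add: \<phi>_def)
      ultimately show "b = b'" by (rule prod_eqI)
    qed
    fix b assume "b \<in> {b. advance c n m b (t, v) = (s, w)}" and b: "b \<in> set_pmf (block m)"
    hence adv: "advance c n m b (t, v) = (s, w)" by simp
    show "\<phi> b \<in> {b. advance c' n m b (t, v) = (s, w)}"
    proof (cases "s \<le> n")
      case True
      have "t < s" "fires c m b v s" "\<forall>r. t < r \<longrightarrow> r < s \<longrightarrow> \<not> fires c m b v r" "w = c s + snd b"
        using adv unfolding advance_eq_iff[OF True] by auto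
      moreover from this have "c' s + snd (\<phi> b) = c s + snd b"
        using True by (simp add: \<phi>_def \<Delta>_def)
      ultimately show ?thesis
        using True fires1[of b] fires0[of b] by (auto simp: advance_eq_iff)
    next
      case False
      from adv have "s = Suc n"
        by (cases rule: advance_cases[of t n c m b v]) (use False in auto)
      thus ?thesis
        using adv fires0[of b] by (auto simp: advance_eq_Suc_iff)
    qed
    show "pmf (block m) b \<le> exp (4 * a) * pmf (block m) (\<phi> b)"
    proof -
      let ?p = "seq_pmf (replicate (Suc T) (geo a))"
      have fst: "pmf ?p (fst b) \<le> exp (3 * a) * pmf ?p (fst (\<phi> b))"
      proof -
        have "pmf ?p (fst b) = (\<Prod>i<Suc T. pmf (geo a) (fst b ! i))"
          using len[OF b] by (subst pmf_seq_pmf) (simp_all del: replicate_Suc prod.lessThan_Suc)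
        also have "\<dots> \<le> (\<Prod>i<Suc T. exp (a * \<bar>real_of_int (\<eta> i)\<bar>) * pmf (geo a) (fst (\<phi> b) ! i))"
          using a by (intro prod_mono conjI pmf_nonneg) (auto simp: nth intro: pmf_geo_shift)
        also have "\<dots> = exp (a * (\<Sum>i<Suc T. \<bar>real_of_int (\<eta> i)\<bar>)) * pmf ?p (fst (\<phi> b))"
          by (subst pmf_seq_pmf)
            (simp_all add: \<phi>_def prod.distrib exp_sum sum_distrib_left del: replicate_Suc prod.lessThan_Suc sum.lessThan_Suc upt_Suc)
        also have "(\<Sum>i<Suc T. \<bar>real_of_int (\<eta> i)\<bar>)
            \<le> (\<Sum>i<Suc T. (if i = 0 then 1 else 0) + (if i = s then 2 else 0))"
          by (intro sum_mono) (auto simp: \<eta>_def)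
        also have "\<dots> \<le> 3"
          unfolding sum.distrib by (subst (1 2) sum.delta) auto
        finally show ?thesis
          using a by (simp add: mult_right_mono pmf_nonneg mult.commute)
      qed
      have snd: "pmf (geo a) (snd b) \<le> exp a * pmf (geo a) (snd (\<phi> b))"
      proof -
        have "\<bar>\<Delta>\<bar> \<le> 1"
          using c by (auto simp: \<Delta>_def)
        hence "exp (a * \<bar>real_of_int \<Delta>\<bar>) \<le> exp a"
          using a by simp
        hence "exp (a * \<bar>real_of_int \<Delta>\<bar>) * pmf (geo a) (snd b + \<Delta>) \<le> exp a * pmf (geo a) (snd b + \<Delta>)"
          by (intro mult_right_mono pmf_nonneg)
        thus ?thesis
          using pmf_geo_shift[OF a, of "snd b" \<Delta>] by (simp add: \<phi>_def)
      qed
      have "pmf (block m) b' = pmf ?p (fst b') * pmf (geo a) (snd b')" for b'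
        by (cases b') (simp only: block_def q an pmf_pair fst_conv snd_conv)
      moreover have "exp (4 * a) = exp (3 * a) * exp a"
        by (simp add: exp_add[symmetric])
      ultimately show ?thesis
        using mult_mono[OF fst snd] by (simp add: pmf_nonneg mult_ac)
    qed
  qed simp
  thus ?thesis
    by (simp add: step_law_def pmf_map st out vimage_def)
qed

lemma step_law_always:
  assumes "always m"
  shows "step_law c n m (t, v) =
    (if t < n then map_pmf (\<lambda>N. (Suc t, c (Suc t) + N)) (answer_noise m) else return_pmf (Suc n, v))"
proof -
  have "step_law c n m (t, v)
      = map_pmf (\<lambda>N. if t < n then (Suc t, c (Suc t) + N) else (Suc n, v)) (map_pmf snd (block m))"
    by (simp add: step_law_def advance_always[OF assms] pmf.map_comp o_def)
  thus ?thesis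
    by (simp add: block_def map_snd_pair_pmf map_pmf_const)
qed

lemma pmf_step_law_le_always:
  assumes an: "answer_noise m = geo a" and a: "0 < a"
    and c: "\<And>s. 1 \<le> s \<Longrightarrow> s \<le> n \<Longrightarrow> \<bar>c s - c' s\<bar> \<le> 1" and always: "always m"
  shows "pmf (step_law c n m st) out \<le> exp a * pmf (step_law c' n m st) out"
proof -
  obtain t v s w where st: "st = (t, v)" and out: "out = (s, w)"
    by (metis surj_pair)
  show ?thesis
  proof (cases "t < n")
    case True
    let ?\<Delta> = "c (Suc t) - c' (Suc t)"
    have "\<bar>?\<Delta>\<bar> \<le> 1"
      using c[of "Suc t"] True by simp
    hence "real_of_int \<bar>?\<Delta>\<bar> \<le> 1"
      by linarith
    hence "a * \<bar>real_of_int ?\<Delta>\<bar> \<le> a * 1"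
      using a by (intro mult_left_mono) auto
    hence exp_le: "exp (a * \<bar>real_of_int ?\<Delta>\<bar>) \<le> exp a"
      by simp
    have "measure_pmf.prob (geo a) {N. (Suc t, c (Suc t) + N) = (s, w)}
        \<le> exp a * measure_pmf.prob (geo a) {N. (Suc t, c' (Suc t) + N) = (s, w)}"
    proof (rule prob_le_prob_by_injection[where \<phi> = "\<lambda>N. N + ?\<Delta>"])
      fix N
      have "pmf (geo a) N \<le> exp (a * \<bar>real_of_int ?\<Delta>\<bar>) * pmf (geo a) (N + ?\<Delta>)"
        by (rule pmf_geo_shift[OF a])
      also have "\<dots> \<le> exp a * pmf (geo a) (N + ?\<Delta>)"
        by (intro mult_right_mono exp_le pmf_nonneg)
      finally show "pmf (geo a) N \<le> exp a * pmf (geo a) (N + ?\<Delta>)" .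
    qed (auto simp: inj_on_def)
    thus ?thesis
      using True by (simp add: st out step_law_always[OF always] an pmf_map vimage_def)
  next
    case False
    thus ?thesis
      using a by (simp add: st step_law_always[OF always] mult_le_cancel_right1 indicator_def)
  qed
qed

lemma renyi_le_step_law_always:
  assumes an: "answer_noise m = gauss \<nu>" and \<nu>: "0 < \<nu>"
    and c: "\<And>s. 1 \<le> s \<Longrightarrow> s \<le> n \<Longrightarrow> \<bar>c s - c' s\<bar> \<le> 1" and always: "always m"
  shows "renyi_le s (real s * (real s + 1) / (2 * \<nu>)) (step_law c n m st) (step_law c' n m st)"
proof -
  obtain t v where st: "st = (t, v)"
    by (metis surj_pair)
  show ?thesis
  proof (cases "t < n")
    case True
    thus ?thesis
      unfolding st step_law_always[OF always] an
      by (simp, intro renyi_le_map_gauss[where k = "c (Suc t) - c' (Suc t)"])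
        (use \<nu> c[of "Suc t"] in \<open>auto simp: inj_on_def\<close>)
  next
    case False
    thus ?thesis
      using \<nu> by (auto simp: st step_law_always[OF always] intro!: renyi_le_mono[OF renyi_le_return])
  qed
qed

end

context sparse_release
begin

subsection \<open>Online evaluation\<close>

text \<open>The outputs at all times are a function of the trace, which is why privacy is proved for
  the trace only.\<close>

fun current :: "nat \<Rightarrow> int \<Rightarrow> (nat \<times> int) list \<Rightarrow> int" where
  "current t v [] = v"
| "current t v ((s, w) # tr) = (if s \<le> t then current t w tr else v)"

text \<open>The algorithm must not look ahead, so at time \<open>t\<close> it reruns the releases on
  the prefix seen so far, with the same blocks. Shortening the horizon to \<open>t\<close> only
  affects releases after \<open>t\<close>, which \<open>current t\<close> ignores.\<close>

lemma current_run_prefix: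
  assumes "t0 \<le> t" "t \<le> n" and c: "\<And>s. s \<le> t \<Longrightarrow> c s = c' s"
  shows "current t v (run c n bs m (t0, v)) = current t v (run c' t bs m (t0, v))"
  using assms(1)
proof (induction bs arbitrary: m t0 v)
  case Nil
  thus ?case by simp
next
  case (Cons b bs)
  have fires_iff: "fires c m b v r \<longleftrightarrow> fires c' m b v r" if "r \<le> t" for r
    using c[OF that] by (simp add: fires_def)
  show ?case
  proof (cases rule: advance_cases[of t0 n c m b v])
    case (1 s)
    hence fired: "fires c m b v s" "\<forall>r. t0 < r \<longrightarrow> r < s \<longrightarrow> \<not> fires c m b v r"
      by (auto simp: advance_eq_iff)
    show ?thesis
    proof (cases "s \<le> t")
      case True
      hence "advance c' t m b (t0, v) = (s, c s + snd b)"
        using 1 fired fires_iff c by (auto simp: advance_eq_iff)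
      thus ?thesis
        using True 1 Cons.IH[of s] by simp
    next
      case False
      hence "advance c' t m b (t0, v) = (Suc t, v)"
        using fired fires_iff by (auto simp: advance_eq_Suc_iff)
      thus ?thesis
        using False 1 by simp
    qed
  next
    case 2
    hence "advance c' t m b (t0, v) = (Suc t, v)"
      using fires_iff assms(2) by (auto simp: advance_eq_Suc_iff)
    thus ?thesis
      using 2 assms(2) by simp
  qed
qed

subsection \<open>Accuracy\<close>

definition tame :: "(nat \<Rightarrow> real) \<Rightarrow> (nat \<Rightarrow> real) \<Rightarrow> nat \<Rightarrow> block \<Rightarrow> bool" where
  "tame x y m b \<longleftrightarrow> \<bar>real_of_int (snd b)\<bar> \<le> y m \<and>
     (always m \<or> (\<forall>i\<le>T. \<bar>real_of_int (fst b ! i)\<bar> \<le> x m))"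

text \<open>When the \<open>m\<close>-th test fires, the two noises in the comparison may hide
  \<open>2 * x m\<close> of the threshold, and the old value, released by block
  \<open>m - 1\<close>, may be off by \<open>y (m - 1)\<close>. The rest is true movement of the
  count.\<close>

definition gap :: "(nat \<Rightarrow> real) \<Rightarrow> (nat \<Rightarrow> real) \<Rightarrow> nat \<Rightarrow> real" where
  "gap x y m = threshold m - 2 * x m - y (m - 1)"

text \<open>
  A non-forced release at time \<open>s\<close> certifies that the count has moved by at least \<open>gap m\<close>, hence
  that at least so many flips occurred, since the previous release; being integers, at least one.
\<close>

lemma run_accurate:
  fixes F :: "nat \<Rightarrow> nat"
  assumes F: "\<And>s t. 1 \<le> s \<Longrightarrow> s \<le> t \<Longrightarrow> t \<le> n \<Longrightarrow> \<bar>c t - c s\<bar> + int (F s) \<le> int (F t)"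
    and n: "n \<le> T" and pos: "\<And>i. 1 \<le> i \<Longrightarrow> \<not> always i \<Longrightarrow> 0 < gap x y i"
    and "1 \<le> m" "1 \<le> t0" "t0 \<le> t" "t \<le> n" "\<bar>real_of_int (v - c t0)\<bar> \<le> y (m - 1)"
    and "n - t0 \<le> length bs" "\<forall>i<length bs. tame x y (m + i) (bs ! i)"
  shows "\<exists>k\<ge>m. let e = \<bar>real_of_int (current t v (run c n bs m (t0, v)) - c t)\<bar> in
    (e \<le> y (k - 1) \<or> (\<not> always k \<and> e \<le> threshold k + 2 * x k)) \<and>
    (t0 < t \<or> (k = m \<and> e \<le> y (m - 1))) \<and>
    e \<le> y (k - 1) + (real (F t) - real (F t0)) \<and>
    (\<Sum>i=m..<k. if always i then 0 else max 1 (gap x y i)) \<le> real (F t) - real (F t0)"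
  \<comment> \<open>\<open>k\<close> is the index of the release pending at time \<open>t\<close>:
    the current value comes from block \<open>k - 1\<close>, and the sum counts the flips certified
    by the releases from \<open>m\<close> to \<open>k - 1\<close>. The conjunct with
    \<open>t0 < t\<close> singles out the time of the first release, for the case
    \<open>T = 1\<close>.\<close>
  using assms(4-)
proof (induction bs arbitrary: m t0 v)
  case Nil
  hence "t = t0" by simp
  thus ?case
    using Nil by (intro exI[of _ m]) simp
next
  case (Cons b bs)
  have tame: "tame x y m b"
    using spec[OF Cons.prems(7), of 0] by simp
  have tame': "tame x y (Suc m + i) (bs ! i)" if "i < length bs" for i
    using spec[OF Cons.prems(7), of "Suc i"] that by simp
  have stay: ?case if adv: "t < fst (advance c n m b (t0, v))" and quiet: "\<forall>r. t0 < r \<longrightarrow> r \<le> t \<longrightarrow> \<not> fires c m b v r"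
  proof -
    have cur: "current t v (run c n (b # bs) m (t0, v)) = v"
      using adv by (cases "advance c n m b (t0, v)") simp
    have "\<bar>c t - c t0\<bar> + int (F t0) \<le> int (F t)"
      by (rule F) (use Cons.prems in auto)
    moreover have "\<bar>v - c t\<bar> \<le> \<bar>v - c t0\<bar> + \<bar>c t - c t0\<bar>"
      by linarith
    ultimately have drift: "\<bar>real_of_int (v - c t)\<bar> \<le> \<bar>real_of_int (v - c t0)\<bar> + (real (F t) - real (F t0))"
      and mono: "F t0 \<le> F t"
      by linarith+
    have "\<bar>real_of_int (v - c t)\<bar> \<le> y (m - 1) \<or> (\<not> always m \<and> \<bar>real_of_int (v - c t)\<bar> \<le> threshold m + 2 * x m)"
    proof (cases "t = t0")
      case True
      thus ?thesis using Cons.prems by simp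
    next
      case False
      hence "\<not> fires c m b v t"
        using quiet Cons.prems by auto
      hence al: "\<not> always m" and "\<bar>c t - v\<bar> + fst b ! t < threshold m + fst b ! 0"
        by (auto simp: fires_def)
      moreover have "\<bar>real_of_int (fst b ! t)\<bar> \<le> x m" "\<bar>real_of_int (fst b ! 0)\<bar> \<le> x m"
        using tame al Cons.prems n by (auto simp: tame_def)
      ultimately show ?thesis
        by auto
    qed
    moreover have "t0 < t \<or> \<bar>real_of_int (v - c t)\<bar> \<le> y (m - 1)"
      using Cons.prems(3,5) by (cases "t = t0") auto
    ultimately show ?thesis
      unfolding cur Let_def using drift mono Cons.prems(5) by (intro exI[of _ m]) auto
  qed
  show ?case
  proof (cases rule: advance_cases[of t0 n c m b v])
    case (1 s)
    hence fired: "fires c m b v s" "\<forall>r. t0 < r \<longrightarrow> r < s \<longrightarrow> \<not> fires c m b v r"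
      by (auto simp: advance_eq_iff)
    show ?thesis
    proof (cases "s \<le> t")
      case False
      thus ?thesis
        using 1 fired by (intro stay) auto
    next
      case True
      let ?w = "c s + snd b"
      have cur: "current t v (run c n (b # bs) m (t0, v)) = current t ?w (run c n bs (Suc m) (s, ?w))"
        using 1 True by simp
      have yw: "\<bar>real_of_int (?w - c s)\<bar> \<le> y (Suc m - 1)"
        using tame by (simp add: tame_def)
      have len: "n - s \<le> length bs"
        using 1(1) Cons.prems(6) by simp
      obtain k where k: "k \<ge> Suc m" and acc: "let e = \<bar>real_of_int (current t ?w (run c n bs (Suc m) (s, ?w)) - c t)\<bar> in
          (e \<le> y (k - 1) \<or> (\<not> always k \<and> e \<le> threshold k + 2 * x k)) \<and>
          (s < t \<or> (k = Suc m \<and> e \<le> y (Suc m - 1))) \<and>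
          e \<le> y (k - 1) + (real (F t) - real (F s)) \<and>
          (\<Sum>i=Suc m..<k. if always i then 0 else max 1 (gap x y i)) \<le> real (F t) - real (F s)"
        using Cons.IH[OF _ _ True Cons.prems(4) yw len] tame' 1(1) Cons.prems(2) by auto
      have diff: "\<bar>c s - c t0\<bar> + int (F t0) \<le> int (F s)"
        by (rule F) (use Cons.prems 1 in auto)
      have "(if always m then 0 else max 1 (gap x y m)) \<le> real (F s) - real (F t0)"
      proof (cases "always m")
        case True
        thus ?thesis using diff by simp
      next
        case False
        have "threshold m + fst b ! 0 \<le> \<bar>c s - v\<bar> + fst b ! s"
          using False fired(1) by (simp add: fires_def)
        moreover have "\<bar>real_of_int (fst b ! s)\<bar> \<le> x m" "\<bar>real_of_int (fst b ! 0)\<bar> \<le> x m"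
          using tame False 1 n by (auto simp: tame_def)
        moreover have "\<bar>c s - v\<bar> \<le> \<bar>c s - c t0\<bar> + \<bar>v - c t0\<bar>"
          by linarith
        ultimately have "gap x y m \<le> \<bar>c s - c t0\<bar>"
          using Cons.prems(5) unfolding gap_def by linarith
        also have "\<dots> \<le> real (F s) - real (F t0)"
          using diff by linarith
        finally have le: "gap x y m \<le> real (F s) - real (F t0)" .
        have "0 < real (F s) - real (F t0)"
          using pos[OF Cons.prems(1) False] le by linarith
        hence "F t0 < F s"
          by simp
        hence "1 \<le> real (F s) - real (F t0)"
          by linarith
        thus ?thesis using le False by simp
      qed
      moreover have "(\<Sum>i=m..<k. if always i then 0 else max 1 (gap x y i))
          = (if always m then 0 else max 1 (gap x y m)) + (\<Sum>i=Suc m..<k. if always i then 0 else max 1 (gap x y i))"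
        using k by (subst sum.atLeast_Suc_lessThan) auto
      moreover have "F t0 \<le> F s"
        using diff by linarith
      ultimately show ?thesis
        using acc k 1 True unfolding cur by (intro exI[of _ k]) (auto simp: Let_def)
    qed
  next
    case 2
    show ?thesis
    proof (rule stay)
      show "t < fst (advance c n m b (t0, v))"
        using 2 Cons.prems(4) by simp
      show "\<forall>r. t0 < r \<longrightarrow> r \<le> t \<longrightarrow> \<not> fires c m b v r"
        using 2 Cons.prems(4) by (auto simp: advance_eq_Suc_iff)
    qed
  qed
qed

text \<open>A union bound over the threshold noise, \<open>T\<close> query noises and the answer
  noise: \<open>T + 2\<close> values per sparse block, but a single one per forced block.\<close>

lemma prob_not_tame_le:
  assumes a: "\<And>m. m < T \<Longrightarrow> measure_pmf.prob (answer_noise m) {N. y m < \<bar>real_of_int N\<bar>} \<le> \<tau> m"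
    and q: "\<And>m. m < T \<Longrightarrow> \<not> always m \<Longrightarrow> measure_pmf.prob (query_noise m) {N. x m < \<bar>real_of_int N\<bar>} \<le> \<tau> m"
  shows "measure_pmf.prob (block_list 0 T) {bs. \<exists>m<T. \<not> tame x y m (bs ! m)}
    \<le> (\<Sum>m<T. if always m then \<tau> m else real (T + 2) * \<tau> m)"
proof -
  have block: "measure_pmf.prob (block m) {b. \<not> tame x y m b} \<le> (if always m then \<tau> m else real (T + 2) * \<tau> m)"
    if m: "m < T" for m
  proof -
    have snd: "measure_pmf.prob (block m) (snd -` {N. y m < \<bar>real_of_int N\<bar>}) \<le> \<tau> m"
      using a[OF m] unfolding measure_map_pmf[symmetric] by (simp add: block_def map_snd_pair_pmf)
    show ?thesis
    proof (cases "always m")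
      case True
      hence "{b. \<not> tame x y m b} = snd -` {N. y m < \<bar>real_of_int N\<bar>}"
        by (auto simp: tame_def)
      thus ?thesis using snd True by simp
    next
      case False
      let ?ps = "replicate (Suc T) (query_noise m)"
      let ?B = "{ws. \<exists>i<length ?ps. ws ! i \<in> {N. x m < \<bar>real_of_int N\<bar>}}"
      have "measure_pmf.prob (block m) (fst -` ?B) = measure_pmf.prob (seq_pmf ?ps) ?B"
        unfolding measure_map_pmf[symmetric] by (simp add: block_def map_fst_pair_pmf)
      also have "\<dots> \<le> (\<Sum>i<length ?ps. measure_pmf.prob (?ps ! i) {N. x m < \<bar>real_of_int N\<bar>})"
        by (rule prob_seq_pmf_ex_le)
      also have "\<dots> \<le> (\<Sum>i<Suc T. \<tau> m)"
        unfolding length_replicate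
        by (intro sum_mono) (use q[OF m False] in \<open>simp del: replicate_Suc\<close>)
      finally have fst: "measure_pmf.prob (block m) (fst -` ?B) \<le> real (Suc T) * \<tau> m"
        by simp
      have "{b. \<not> tame x y m b} \<subseteq> snd -` {N. y m < \<bar>real_of_int N\<bar>} \<union> fst -` ?B"
        using False by (auto simp: tame_def less_Suc_eq_le simp del: replicate_Suc)
      hence "measure_pmf.prob (block m) {b. \<not> tame x y m b}
          \<le> measure_pmf.prob (block m) (snd -` {N. y m < \<bar>real_of_int N\<bar>} \<union> fst -` ?B)"
        by (intro measure_pmf.finite_measure_mono) auto
      also have "\<dots> \<le> measure_pmf.prob (block m) (snd -` {N. y m < \<bar>real_of_int N\<bar>})
          + measure_pmf.prob (block m) (fst -` ?B)"
        by (rule measure_Un_le) auto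
      also have "\<dots> \<le> \<tau> m + real (Suc T) * \<tau> m"
        using snd fst by (rule add_mono)
      finally show ?thesis
        using False by (simp add: algebra_simps)
    qed
  qed
  have "measure_pmf.prob (block_list 0 T) {bs. \<exists>m<T. \<not> tame x y m (bs ! m)}
      \<le> (\<Sum>m<T. measure_pmf.prob (block m) {b. \<not> tame x y m b})"
    using prob_seq_pmf_ex_le[of "map block [0..<0 + T]" "\<lambda>m. {b. \<not> tame x y m b}"]
    by (simp add: block_list_def)
  also have "\<dots> \<le> (\<Sum>m<T. if always m then \<tau> m else real (T + 2) * \<tau> m)"
    by (intro sum_mono block) auto
  finally show ?thesis .
qed

end

section \<open>Counts of distinct elements\<close>

lemma present_le_1: "present x i t \<le> 1"
  by (simp add: present_def)

lemma count_distinct_le: "count_distinct d x t \<le> d"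
  using sum_bounded_above[of "{..<d}" "\<lambda>i. present x i t" 1, OF present_le_1] by (simp add: count_distinct_def)

lemma count_distinct_take:
  assumes "s \<le> t"
  shows "count_distinct d (take t x) s = count_distinct d x s"
proof -
  have "(\<Sum>r = 1..s. take t x ! (r - 1) ! i) = (\<Sum>r = 1..s. x ! (r - 1) ! i)" for i
    using assms by (intro sum.cong refl) auto
  thus ?thesis by (simp add: count_distinct_def present_def)
qed

text \<open>A neighbour may change every update of the item, yet the item contributes a single bit
  to each count.\<close>

lemma count_distinct_neighboring:
  assumes "item_neighboring d x y" "s \<le> length x"
  shows "\<bar>int (count_distinct d x s) - int (count_distinct d y s)\<bar> \<le> 1"
proof -
  obtain j where j: "j < d" "\<forall>t\<in>{1..length x}. \<forall>i<d. i \<noteq> j \<longrightarrow> x ! (t - 1) ! i = y ! (t - 1) ! i"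
    using assms by (auto simp: item_neighboring_def)
  have "present x i s = present y i s" if "i < d" "i \<noteq> j" for i
  proof -
    have "(\<Sum>r = 1..s. x ! (r - 1) ! i) = (\<Sum>r = 1..s. y ! (r - 1) ! i)"
      by (intro sum.cong refl) (use j that assms(2) in auto)
    thus ?thesis by (simp add: present_def)
  qed
  hence "(\<Sum>i\<in>{..<d} - {j}. present x i s) = (\<Sum>i\<in>{..<d} - {j}. present y i s)"
    by (intro sum.cong) auto
  moreover have "count_distinct d z s = present z j s + (\<Sum>i\<in>{..<d} - {j}. present z i s)" for z
    unfolding count_distinct_def using j(1) by (subst sum.remove[of _ j]) auto
  ultimately show ?thesis
    using present_le_1[of x j s] present_le_1[of y j s] by simp
qed

definition flips_until :: "nat \<Rightarrow> stream \<Rightarrow> nat \<Rightarrow> nat" where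
  "flips_until d x t = (\<Sum>i<d. \<Sum>s = 2..t. if present x i s \<noteq> present x i (s - 1) then 1 else 0)"

lemma flips_until_Suc:
  assumes "1 \<le> t"
  shows "flips_until d x (Suc t)
    = flips_until d x t + (\<Sum>i<d. if present x i (Suc t) \<noteq> present x i t then 1 else 0)"
  using assms by (simp add: flips_until_def sum.distrib)

lemma count_distinct_diff_le_flips:
  assumes "1 \<le> s" "s \<le> t"
  shows "\<bar>int (count_distinct d x t) - int (count_distinct d x s)\<bar> + int (flips_until d x s) \<le> int (flips_until d x t)"
  using assms(2,1)
proof (induction t rule: dec_induct)
  case base
  thus ?case by simp
next
  case (step t)
  have "\<bar>int (count_distinct d x (Suc t)) - int (count_distinct d x t)\<bar>
      = \<bar>\<Sum>i<d. int (present x i (Suc t)) - int (present x i t)\<bar>"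
    by (simp add: count_distinct_def sum_subtractf)
  also have "\<dots> \<le> (\<Sum>i<d. \<bar>int (present x i (Suc t)) - int (present x i t)\<bar>)"
    by (rule sum_abs)
  also have "\<dots> \<le> (\<Sum>i<d. int (if present x i (Suc t) \<noteq> present x i t then 1 else 0))"
    by (intro sum_mono) (auto simp: present_def)
  also have "\<dots> = int (flips_until d x (Suc t)) - int (flips_until d x t)"
    using step by (simp add: flips_until_Suc)
  finally show ?case
    using step by linarith
qed

section \<open>Algorithms with discrete coins\<close>

text \<open>Clamping depends on the released value alone, so it costs no privacy; it yields the term
  \<open>d\<close> of the minimum.\<close>

lemma clamp_error_le:
  fixes c d w :: real
  assumes "0 \<le> c" "c \<le> d"
  shows "\<bar>max 0 (min d w) - c\<bar> \<le> \<bar>w - c\<bar>" "\<bar>max 0 (min d w) - c\<bar> \<le> d"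
  using assms by linarith+

text \<open>Coins must be real sequences, so the single coin \<open>c\<close> is stored as its code
  in a constant sequence and read back from entry 0. As all sets are measurable for
  \<open>measure_pmf\<close>, \<open>f\<close> can be arbitrary.\<close>

definition discrete_algorithm :: "'c::countable pmf \<Rightarrow> ('c \<Rightarrow> stream \<Rightarrow> real) \<Rightarrow> algorithm" where
  "discrete_algorithm p f =
     \<lparr>coins = measure_pmf (map_pmf (\<lambda>c _. real (to_nat c)) p),
      answer = \<lambda>\<omega>. f (from_nat (nat \<lfloor>\<omega> 0\<rfloor>))\<rparr>"

lemma continual_discrete_algorithm: "continual_algorithm (discrete_algorithm p f)"
  by (simp add: continual_algorithm_def discrete_algorithm_def measure_pmf.prob_space_axioms)

lemma measure_output_law_discrete_algorithm:
  assumes "S \<in> sets (output_space (length x))"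
  shows "measure (output_law (discrete_algorithm p f) x) S
    = measure_pmf.prob p {c. restrict (\<lambda>t. f c (take t x)) {1..length x} \<in> S}"
proof -
  let ?A = "discrete_algorithm p f"
  have meas: "(\<lambda>\<omega>. restrict (output_at ?A x \<omega>) {1..length x})
      \<in> measurable (coins ?A) (output_space (length x))"
    by (simp add: discrete_algorithm_def output_space_def space_PiM)
  have "measure (output_law ?A x) S
      = measure (coins ?A) ((\<lambda>\<omega>. restrict (output_at ?A x \<omega>) {1..length x}) -` S \<inter> space (coins ?A))"
    unfolding output_law_def by (rule measure_distr[OF meas assms])
  also have "\<dots> = measure_pmf.prob p {c. restrict (\<lambda>t. f c (take t x)) {1..length x} \<in> S}"
    by (simp add: discrete_algorithm_def output_at_def[abs_def] vimage_def)
  finally show ?thesis .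
qed

lemma count_distinct_accurate_discrete_algorithm:
  assumes "\<And>x. x \<in> streams d T \<Longrightarrow> measure_pmf.prob p
    {c. \<exists>t\<in>{1..length x}. err (total_flippancy d x) < \<bar>f c (take t x) - real (count_distinct d x t)\<bar>} \<le> \<beta>"
  shows "count_distinct_accurate d T \<beta> err (discrete_algorithm p f)"
  unfolding count_distinct_accurate_def
proof
  fix x assume x: "x \<in> streams d T"
  let ?bad = "{c. \<exists>t\<in>{1..length x}. err (total_flippancy d x) < \<bar>f c (take t x) - real (count_distinct d x t)\<bar>}"
  have "measure (coins (discrete_algorithm p f))
      {\<omega> \<in> space (coins (discrete_algorithm p f)). \<forall>t\<in>{1..length x}.
        \<bar>output_at (discrete_algorithm p f) x \<omega> t - real (count_distinct d x t)\<bar> \<le> err (total_flippancy d x)}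
    = measure_pmf.prob p (- ?bad)"
    by (simp add: discrete_algorithm_def output_at_def vimage_def Compl_eq not_less)
  also have "\<dots> = 1 - measure_pmf.prob p ?bad"
    using measure_pmf.prob_compl[of ?bad p] by (simp add: Compl_eq_Diff_UNIV)
  finally show "1 - \<beta> \<le> measure (coins (discrete_algorithm p f))
      {\<omega> \<in> space (coins (discrete_algorithm p f)). \<forall>t\<in>{1..length x}.
        \<bar>output_at (discrete_algorithm p f) x \<omega> t - real (count_distinct d x t)\<bar> \<le> err (total_flippancy d x)}"
    using assms[OF x] by simp
qed

context sparse_release
begin

definition release :: "nat \<Rightarrow> block list \<Rightarrow> stream \<Rightarrow> real" where
  "release d bs p = max 0 (min (real d) (real_of_int
     (current (length p) 0 (run (\<lambda>s. int (count_distinct d p s)) (length p) bs 0 (0, 0)))))"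

lemma release_take:
  assumes "t \<le> length x"
  shows "release d bs (take t x) = max 0 (min (real d) (real_of_int
     (current t 0 (run (\<lambda>s. int (count_distinct d x s)) (length x) bs 0 (0, 0)))))"
proof -
  have "length (take t x) = t"
    using assms by simp
  moreover have "current t 0 (run (\<lambda>s. int (count_distinct d x s)) (length x) bs 0 (0, 0))
      = current t 0 (run (\<lambda>s. int (count_distinct d (take t x) s)) t bs 0 (0, 0))"
    by (rule current_run_prefix) (use assms in \<open>auto simp: count_distinct_take\<close>)
  ultimately show ?thesis
    by (simp add: release_def)
qed

text \<open>Only the fact that neighbouring counts differ by at most 1 is kept, so streams give way
  to arbitrary integer sequences, and output sequences to traces.\<close>

lemma item_dp_release:
  assumes "\<And>c c' n A. n \<le> T \<Longrightarrow> (\<And>s. 1 \<le> s \<Longrightarrow> s \<le> n \<Longrightarrow> \<bar>c s - c' s\<bar> \<le> 1) \<Longrightarrow>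
    measure_pmf.prob (trace_law c n T 0 (0, 0)) A
      \<le> exp \<epsilon> * measure_pmf.prob (trace_law c' n T 0 (0, 0)) A + \<delta>"
  shows "item_dp d T \<epsilon> \<delta> (discrete_algorithm (block_list 0 T) (release d))"
  unfolding item_dp_def
proof (intro ballI impI)
  fix x y S
  assume x: "x \<in> streams d T" and nb: "item_neighboring d x y" and S: "S \<in> sets (output_space (length x))"
  let ?A = "discrete_algorithm (block_list 0 T) (release d)" and ?n = "length x"
  have len: "length y = ?n" "?n \<le> T"
    using nb x by (auto simp: item_neighboring_def streams_def)
  let ?S = "{tr. restrict (\<lambda>t. max 0 (min (real d) (real_of_int (current t 0 tr)))) {1..?n} \<in> S}"
  have law: "measure (output_law ?A z) S
      = measure_pmf.prob (trace_law (\<lambda>s. int (count_distinct d z s)) ?n T 0 (0, 0)) ?S"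
    if z: "length z = ?n" for z
  proof -
    have "measure (output_law ?A z) S
        = measure_pmf.prob (block_list 0 T) {bs. restrict (\<lambda>t. release d bs (take t z)) {1..?n} \<in> S}"
      using measure_output_law_discrete_algorithm[of S z "block_list 0 T" "release d"] S z by simp
    also have "{bs. restrict (\<lambda>t. release d bs (take t z)) {1..?n} \<in> S}
        = (\<lambda>bs. run (\<lambda>s. int (count_distinct d z s)) ?n bs 0 (0, 0)) -` ?S"
    proof -
      have "restrict (\<lambda>t. release d bs (take t z)) {1..?n}
        = restrict (\<lambda>t. max 0 (min (real d) (real_of_int (current t 0
            (run (\<lambda>s. int (count_distinct d z s)) ?n bs 0 (0, 0)))))) {1..?n}" for bs
        by (intro restrict_ext) (use z in \<open>simp add: release_take\<close>)
      thus ?thesis by auto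
    qed
    finally show ?thesis
      unfolding measure_map_pmf[symmetric] map_run_block_list .
  qed
  show "measure (output_law ?A x) S \<le> exp \<epsilon> * measure (output_law ?A y) S + \<delta>"
    unfolding law[OF refl] law[OF len(1)]
    by (rule assms) (use len nb in \<open>auto intro: count_distinct_neighboring\<close>)
qed

text \<open>Leaves pure arithmetic: \<open>k\<close> is the index of the pending release, and
  \<open>err\<close> has to bound every \<open>e\<close> compatible with tame noise and
  \<open>K\<close> flips.\<close>

lemma count_distinct_accurate_release:
  assumes prob: "measure_pmf.prob (block_list 0 T) {bs. \<exists>m<T. \<not> tame x y m (bs ! m)} \<le> \<beta>"
    and always: "always 0" and pos: "\<And>i. 1 \<le> i \<Longrightarrow> \<not> always i \<Longrightarrow> 0 < gap x y i"
    and err: "\<And>K k e. 1 \<le> k \<Longrightarrow> e \<le> real d \<Longrightarrow>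
      e \<le> y (k - 1) \<or> (\<not> always k \<and> e \<le> threshold k + 2 * x k) \<Longrightarrow>
      2 \<le> T \<or> (k = 1 \<and> e \<le> y 0) \<Longrightarrow> e \<le> y (k - 1) + real K \<Longrightarrow>
      (\<Sum>i=1..<k. if always i then 0 else max 1 (gap x y i)) \<le> real K \<Longrightarrow> e \<le> err K"
  shows "count_distinct_accurate d T \<beta> err (discrete_algorithm (block_list 0 T) (release d))"
proof (rule count_distinct_accurate_discrete_algorithm)
  fix z assume z: "z \<in> streams d T"
  let ?n = "length z" and ?c = "\<lambda>s. int (count_distinct d z s)" and ?F = "flips_until d z"
  let ?K = "total_flippancy d z"
  have n: "?n \<le> T"
    using z by (simp add: streams_def)
  have good: "\<bar>release d bs (take t z) - real (count_distinct d z t)\<bar> \<le> err ?K"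
    if len: "length bs = T" and tame: "\<forall>m<T. tame x y m (bs ! m)" and t: "1 \<le> t" "t \<le> ?n" for bs t
  proof -
    obtain b bs' where bs: "bs = b # bs'"
      using len t n by (cases bs) auto
    let ?w = "?c 1 + snd b"
    define w where "w = current t 0 (run ?c ?n bs 0 (0, 0))"
    have w: "w = current t ?w (run ?c ?n bs' 1 (1, ?w))"
    proof -
      have "z \<noteq> []"
        using t by auto
      thus ?thesis
        using t always by (simp add: w_def bs advance_always)
    qed
    define e where "e = \<bar>real_of_int (w - ?c t)\<bar>"
    have e: "\<exists>k\<ge>1. let e = \<bar>real_of_int (current t ?w (run ?c ?n bs' 1 (1, ?w)) - ?c t)\<bar> in
      (e \<le> y (k - 1) \<or> (\<not> always k \<and> e \<le> threshold k + 2 * x k)) \<and>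
      (1 < t \<or> (k = 1 \<and> e \<le> y (1 - 1))) \<and>
      e \<le> y (k - 1) + (real (?F t) - real (?F 1)) \<and>
      (\<Sum>i=1..<k. if always i then 0 else max 1 (gap x y i)) \<le> real (?F t) - real (?F 1)"
    proof (rule run_accurate[OF count_distinct_diff_le_flips n pos])
      show "\<bar>real_of_int (?w - ?c 1)\<bar> \<le> y (1 - 1)"
        using tame t n by (auto simp: bs tame_def dest!: spec[of _ 0])
      show "\<forall>i<length bs'. tame x y (1 + i) (bs' ! i)"
        using tame len by (auto simp: bs)
      show "?n - 1 \<le> length bs'"
        using len n by (simp add: bs)
    qed (use t in auto)
    have "?F t \<le> ?F ?n"
      using count_distinct_diff_le_flips[of t ?n d z] t by linarith
    also have "?F ?n = ?K"
      by (simp add: flips_until_def total_flippancy_def)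
    finally have F: "real (?F t) - real (?F 1) \<le> real ?K"
      by linarith
    have c: "real (count_distinct d z t) \<le> real d" "0 \<le> real (count_distinct d z t)"
      using count_distinct_le[of d z t] by auto
    let ?e = "\<bar>release d bs (take t z) - real (count_distinct d z t)\<bar>"
    have rel: "release d bs (take t z) = max 0 (min (real d) (real_of_int w))"
      using release_take[OF t(2)] by (simp add: w_def)
    have le_e: "?e \<le> e" and le_d: "?e \<le> real d"
      using clamp_error_le[OF c(2,1), of "real_of_int w"] by (simp_all add: rel e_def)
    obtain k where k: "1 \<le> k" "e \<le> y (k - 1) \<or> (\<not> always k \<and> e \<le> threshold k + 2 * x k)"
      "1 < t \<or> (k = 1 \<and> e \<le> y 0)" "e \<le> y (k - 1) + (real (?F t) - real (?F 1))"
      "(\<Sum>i=1..<k. if always i then 0 else max 1 (gap x y i)) \<le> real (?F t) - real (?F 1)"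
      using e[folded w, folded e_def] unfolding Let_def by auto
    show ?thesis
    proof (rule err[of k])
      show "?e \<le> y (k - 1) \<or> \<not> always k \<and> ?e \<le> threshold k + 2 * x k"
        using k(2) le_e by linarith
      show "2 \<le> T \<or> k = 1 \<and> ?e \<le> y 0"
        using k(3) le_e t n by linarith
      show "?e \<le> y (k - 1) + real ?K"
        using k(4) le_e F by linarith
      show "(\<Sum>i=1..<k. if always i then 0 else max 1 (gap x y i)) \<le> real ?K"
        using k(5) F by linarith
    qed (use k le_d in auto)
  qed
  have "measure_pmf.prob (block_list 0 T)
      {bs. \<exists>t\<in>{1..?n}. err ?K < \<bar>release d bs (take t z) - real (count_distinct d z t)\<bar>}
    \<le> measure_pmf.prob (block_list 0 T) {bs. \<exists>m<T. \<not> tame x y m (bs ! m)}"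
  proof (rule measure_pmf.finite_measure_mono_AE[OF AE_pmfI])
    fix bs assume "bs \<in> set_pmf (block_list 0 T)"
    hence len: "length bs = T"
      by (auto simp: block_list_def dest: length_seq_pmf)
    show "bs \<in> {bs. \<exists>t\<in>{1..?n}. err ?K < \<bar>release d bs (take t z) - real (count_distinct d z t)\<bar>} \<longrightarrow>
        bs \<in> {bs. \<exists>m<T. \<not> tame x y m (bs ! m)}"
    proof (intro impI, rule ccontr)
      assume "bs \<notin> {bs. \<exists>m<T. \<not> tame x y m (bs ! m)}"
      hence "\<bar>release d bs (take t z) - real (count_distinct d z t)\<bar> \<le> err ?K" if "1 \<le> t" "t \<le> ?n" for t
        using good[OF len _ that] by blast
      moreover assume "bs \<in> {bs. \<exists>t\<in>{1..?n}. err ?K < \<bar>release d bs (take t z) - real (count_distinct d z t)\<bar>}"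
      ultimately show False
        by (auto simp: not_le[symmetric])
    qed
  qed simp
  thus "measure_pmf.prob (block_list 0 T)
      {bs. \<exists>t\<in>{1..?n}. err ?K < \<bar>release d bs (take t z) - real (count_distinct d z t)\<bar>} \<le> \<beta>"
    using prob by simp
qed

end

section \<open>The sequence of noise levels\<close>

definition growth :: "nat \<Rightarrow> real" where
  "growth m = (real m + 2) * (ln (real m + 2))\<^sup>2"

lemma growth_mono: "i \<le> j \<Longrightarrow> growth i \<le> growth j"
  unfolding growth_def by (intro mult_mono power_mono) auto

text \<open>Doubling the index costs 2 in the linear factor and 4 in the squared logarithm, as
  \<open>2 * (i + 2) \<le> (i + 2)\<^sup>2\<close>.\<close>

lemma growth_le_growth_half:
  assumes "j \<le> 2 * i"
  shows "growth j \<le> 8 * growth i"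
proof -
  have "real j + 2 \<le> (real i + 2)\<^sup>2"
  proof -
    have "real j \<le> real (2 * i)"
      using assms by (rule of_nat_mono)
    hence "real j + 2 \<le> 2 * (real i + 2)"
      by simp
    also have "\<dots> \<le> (real i + 2) * (real i + 2)"
      by (intro mult_right_mono) auto
    finally show ?thesis
      by (simp add: power2_eq_square)
  qed
  hence "ln (real j + 2) \<le> ln ((real i + 2)\<^sup>2)"
    by (intro ln_mono) auto
  also have "\<dots> = 2 * ln (real i + 2)"
    by (simp add: ln_realpow)
  finally have "(ln (real j + 2))\<^sup>2 \<le> (2 * ln (real i + 2))\<^sup>2"
    by (intro power_mono) auto
  hence "growth j \<le> (2 * (real i + 2)) * (2 * ln (real i + 2))\<^sup>2"
    unfolding growth_def using assms by (intro mult_mono) auto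
  thus ?thesis
    by (simp add: growth_def power_mult_distrib algebra_simps)
qed

lemma ln_3_gt_1: "1 < ln (3 :: real)"
proof -
  have "exp 1 < (3 :: real)"
    using e_less_272 by simp
  hence "ln (exp 1) < ln (3 :: real)"
    by (subst ln_less_cancel_iff) auto
  thus ?thesis by simp
qed

lemma growth_1: "3 \<le> growth 1" "growth 1 \<le> 12"
proof -
  have "ln (3 :: real) \<le> 3 - 1"
    by (rule ln_le_minus_one) simp
  hence "(ln (3 :: real))\<^sup>2 \<le> 2\<^sup>2"
    using ln_3_gt_1 by (intro power_mono) auto
  thus "growth 1 \<le> 12"
    by (simp add: growth_def)
  have "1\<^sup>2 \<le> (ln (3 :: real))\<^sup>2"
    using ln_3_gt_1 by (intro power_mono) auto
  thus "3 \<le> growth 1"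
    by (simp add: growth_def)
qed

lemma growth_ge_3: "1 \<le> m \<Longrightarrow> 3 \<le> growth m"
  using growth_1(1) growth_mono[of 1 m] by linarith

lemma growth_2_ge_4: "4 \<le> growth 2"
proof -
  have "ln (3 :: real) \<le> ln 4"
    by simp
  hence "1 \<le> ln (4 :: real)"
    using ln_3_gt_1 by linarith
  hence "1\<^sup>2 \<le> (ln (4 :: real))\<^sup>2"
    by (intro power_mono) auto
  thus ?thesis
    by (simp add: growth_def)
qed

text \<open>The sum telescopes, since \<open>1 / growth m \<le> 1 / ln (m + 1) - 1 / ln (m + 2)\<close>.\<close>

lemma sum_inverse_growth_le: "(\<Sum>m=1..<k. 1 / growth m) \<le> 2"
proof (cases "k = 0")
  case False
  hence "1 \<le> k" by simp
  hence "(\<Sum>m=1..<k. 1 / growth m) \<le> 1 / ln 2 - 1 / ln (real k + 1)"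
  proof (induction k rule: dec_induct)
    case base
    thus ?case by simp
  next
    case (step m)
    let ?a = "ln (real m + 1)" and ?b = "ln (real m + 2)"
    have ab: "0 < ?a" "?a \<le> ?b"
      using step(1) by auto
    have "ln ((real m + 1) / (real m + 2)) \<le> (real m + 1) / (real m + 2) - 1"
      by (rule ln_le_minus_one) simp
    hence "1 / (real m + 2) \<le> ?b - ?a"
      by (simp add: ln_div field_simps)
    hence "1 / (real m + 2) / ?b\<^sup>2 \<le> (?b - ?a) / (?a * ?b)"
      using ab by (intro frac_le) (auto simp: power2_eq_square)
    also have "\<dots> = 1 / ?a - 1 / ?b"
      using ab by (simp add: field_simps)
    finally have "1 / growth m \<le> 1 / ?a - 1 / ?b"
      by (simp add: growth_def)
    thus ?case
      using step by (simp add: add_ac)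
  qed
  also have "\<dots> \<le> 1 / ln 2"
    using \<open>1 \<le> k\<close> by simp
  also have "\<dots> \<le> 2"
    using ln2_ge_two_thirds by (simp add: field_simps)
  finally show ?thesis .
qed simp

lemma lnK_ge_1: "1 \<le> lnK K"
proof -
  have "ln (3 :: real) \<le> lnK K"
    unfolding lnK_def by (subst ln_le_cancel_iff) auto
  thus ?thesis
    using ln_3_gt_1 by simp
qed

text \<open>There are at most \<open>K\<close> sparse releases, so the logarithm of the index of a
  release can be replaced by that of \<open>K\<close>. The 8 comes from
  \<open>j + 2 \<le> 2 * j\<close> and the square of
  \<open>ln (j + 2) \<le> 2 * lnK K\<close>.\<close>

lemma growth_le_lnK:
  assumes "2 \<le> j" "j \<le> Suc K"
  shows "growth j \<le> 8 * real j * (lnK K)\<^sup>2"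
proof -
  let ?M = "max 3 (real K)"
  have "real j + 2 \<le> real K + 3"
    using assms by linarith
  also have "\<dots> \<le> 3 * ?M"
    by linarith
  also have "\<dots> \<le> ?M * ?M"
    by (intro mult_right_mono) auto
  finally have "real j + 2 \<le> ?M\<^sup>2"
    by (simp add: power2_eq_square)
  hence "ln (real j + 2) \<le> ln (?M\<^sup>2)"
    by (intro ln_mono) auto
  also have "\<dots> = 2 * lnK K"
    by (simp add: lnK_def ln_realpow)
  finally have "(ln (real j + 2))\<^sup>2 \<le> (2 * lnK K)\<^sup>2"
    by (intro power_mono) auto
  hence "growth j \<le> (2 * real j) * (2 * lnK K)\<^sup>2"
    unfolding growth_def using assms(1) by (intro mult_mono) auto
  thus ?thesis
    by (simp add: power_mult_distrib)
qed

section \<open>From noise levels to error bounds\<close>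

text \<open>Chosen for the union bound: \<open>T\<close> blocks with
  \<open>T + 2 \<le> 3 * T\<close> noises each, every one large with probability at most
  \<open>2 * exp (- deviation T \<beta>)\<close>, fail with probability at most
  \<open>\<beta> / 2\<close>.\<close>

definition deviation :: "nat \<Rightarrow> real \<Rightarrow> real" where
  "deviation T \<beta> = ln (12 * (real T)\<^sup>2 / \<beta>)"

lemma exp_minus_deviation:
  assumes "1 \<le> T" "0 < \<beta>"
  shows "exp (- deviation T \<beta>) = \<beta> / (12 * (real T)\<^sup>2)"
  using assms by (simp add: deviation_def exp_minus)

lemma ln_4_le_deviation:
  assumes "1 \<le> T" "0 < \<beta>"
  shows "ln (4 / \<beta>) \<le> deviation T \<beta>"
proof -
  have "1 \<le> (real T)\<^sup>2"
    using assms by (intro one_le_power) auto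
  hence "4 \<le> 12 * (real T)\<^sup>2"
    by linarith
  hence "4 / \<beta> \<le> 12 * (real T)\<^sup>2 / \<beta>"
    using assms by (intro divide_right_mono) auto
  thus ?thesis
    unfolding deviation_def using assms by (intro ln_mono) auto
qed

text \<open>\<open>12 \<le> T ^ 4\<close> needs \<open>2 \<le> T\<close>. No such bound can hold for
  \<open>T = 1\<close>, where the right-hand side tends to 0 as \<open>\<beta>\<close> tends to
  1.\<close>

lemma deviation_le:
  assumes "2 \<le> T" "0 < \<beta>" "\<beta> < 1"
  shows "deviation T \<beta> \<le> 6 * ln (real T / \<beta>)"
proof -
  have "2 ^ 4 \<le> (real T) ^ 4"
    using assms by (intro power_mono) auto
  hence "12 * (real T)\<^sup>2 \<le> (real T) ^ 4 * (real T)\<^sup>2"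
    by (intro mult_right_mono) auto
  also have "\<dots> = (real T) ^ 6"
    by (simp flip: power_add)
  finally have "12 * (real T)\<^sup>2 / \<beta> \<le> (real T) ^ 6 / \<beta>"
    using assms by (intro divide_right_mono) auto
  also have "\<beta> ^ 6 \<le> \<beta> ^ 1"
    using assms by (intro power_decreasing) auto
  hence "(real T) ^ 6 / \<beta> \<le> (real T) ^ 6 / \<beta> ^ 6"
    using assms by (intro divide_left_mono) auto
  also have "\<dots> = (real T / \<beta>) ^ 6"
    by (simp add: power_divide)
  finally have "deviation T \<beta> \<le> ln ((real T / \<beta>) ^ 6)"
    unfolding deviation_def using assms by (intro ln_mono) auto
  also have "\<dots> = 6 * ln (real T / \<beta>)"
    using assms by (simp add: ln_realpow)
  finally show ?thesis .
qed

text \<open>The indices from half of \<open>k\<close> on number at least \<open>k / 4\<close>, and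
  only there must \<open>X\<close> be large.\<close>

lemma sum_ge_upper_half:
  fixes X :: "nat \<Rightarrow> real"
  assumes k: "2 \<le> k" and L: "0 \<le> L" and X: "\<And>i. 1 \<le> i \<Longrightarrow> i < k \<Longrightarrow> 0 \<le> X i"
    and ge: "\<And>i. 1 \<le> i \<Longrightarrow> i < k \<Longrightarrow> k \<le> 2 * i \<Longrightarrow> L \<le> X i"
  shows "real k * L \<le> 4 * (\<Sum>i=1..<k. X i)"
proof -
  have "real k * L \<le> 4 * (real (k - (k + 1) div 2) * L)"
  proof -
    have "k \<le> 4 * (k - (k + 1) div 2)"
      using k by linarith
    hence "real k \<le> 4 * real (k - (k + 1) div 2)"
      by linarith
    hence "real k * L \<le> 4 * real (k - (k + 1) div 2) * L"
      using L by (rule mult_right_mono)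
    thus ?thesis
      by (simp only: mult.assoc)
  qed
  also have "real (k - (k + 1) div 2) * L = (\<Sum>i=(k+1) div 2..<k. L)"
    by simp
  also have "\<dots> \<le> (\<Sum>i=(k+1) div 2..<k. X i)"
    using k by (intro sum_mono ge) auto
  also have "\<dots> \<le> (\<Sum>i=1..<k. X i)"
    using k X by (intro sum_mono2) auto
  finally show ?thesis by simp
qed

context sparse_release
begin

text \<open>
  \<open>X m\<close> bounds the noise of the \<open>m\<close>-th sparse release. \<open>G\<close> is the noise level at which sparse
  releases stop paying off, and the algorithm switches to a release at every time step. In the
  bound for \<open>e\<close>, \<open>j - 1\<close> is the number of sparse releases that have been made.
\<close>

lemma count_distinct_accurate_levels:
  assumes T: "1 \<le> T" and \<beta>: "0 < \<beta>"
    and always: "\<And>m. always m \<longleftrightarrow> m = 0 \<or> (2 \<le> m \<and> G < H m)"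
    and mono: "\<And>i j. 1 \<le> i \<Longrightarrow> i \<le> j \<Longrightarrow> H i \<le> H j"
    and half: "\<And>i j. 1 \<le> i \<Longrightarrow> j \<le> 2 * i \<Longrightarrow> H j \<le> 8 * H i"
    and G: "0 \<le> G" and H: "\<And>m. 1 \<le> m \<Longrightarrow> 0 < H m"
    and X1: "0 < X 1" "min (H 1) G \<le> X 1" and X: "\<And>m. 2 \<le> m \<Longrightarrow> X m = H m"
    and thr: "\<And>m. \<not> always m \<Longrightarrow> threshold m = 4 * X m"
    and x: "\<And>m. \<not> always m \<Longrightarrow> x m \<le> X m" and y: "\<And>m. \<not> always m \<Longrightarrow> y m \<le> X m"
    and y': "\<And>m. \<not> always m \<Longrightarrow> y (m - 1) \<le> X m"
    and yG: "\<And>m. 2 \<le> m \<Longrightarrow> always m \<Longrightarrow> y m \<le> G" and y0: "0 \<le> y 0"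
    and tail0: "measure_pmf.prob (answer_noise 0) {N. y 0 < \<bar>real_of_int N\<bar>} \<le> \<beta> / 2"
    and tail_answer: "\<And>m. 1 \<le> m \<Longrightarrow> measure_pmf.prob (answer_noise m) {N. y m < \<bar>real_of_int N\<bar>}
      \<le> 2 * exp (- deviation T \<beta>)"
    and tail_query: "\<And>m. \<not> always m \<Longrightarrow> measure_pmf.prob (query_noise m) {N. x m < \<bar>real_of_int N\<bar>}
      \<le> 2 * exp (- deviation T \<beta>)"
    and err0: "\<And>K e. e \<le> y 0 \<Longrightarrow> e \<le> err K"
    and err: "\<And>K e Y. e \<le> real d \<Longrightarrow> 2 \<le> T \<Longrightarrow> 0 \<le> Y \<Longrightarrow> Y \<le> G \<Longrightarrow>
      Y = 0 \<or> (\<exists>j\<ge>2. j \<le> Suc K \<and> Y \<le> H j \<and> real j * Y \<le> 32 * real K) \<Longrightarrow>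
      e \<le> y 0 + 6 * min (real K) (X 1) + 6 * Y \<Longrightarrow> e \<le> err K"
  shows "count_distinct_accurate d T \<beta> err (discrete_algorithm (block_list 0 T) (release d))"
proof (rule count_distinct_accurate_release)
  let ?\<tau> = "\<lambda>m. if m = 0 then \<beta> / 2 else 2 * exp (- deviation T \<beta>)"
  have "measure_pmf.prob (block_list 0 T) {bs. \<exists>m<T. \<not> tame x y m (bs ! m)}
      \<le> (\<Sum>m<T. if always m then ?\<tau> m else real (T + 2) * ?\<tau> m)"
    by (rule prob_not_tame_le) (use tail0 tail_answer tail_query always in auto)
  also have "\<dots> \<le> (\<Sum>m<T. (if m = 0 then \<beta> / 2 else 0) + real (T + 2) * (2 * exp (- deviation T \<beta>)))"
    using always \<beta> by (intro sum_mono) (auto simp: algebra_simps)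
  also have "\<dots> = \<beta> / 2 + real T * (real (T + 2) * (2 * exp (- deviation T \<beta>)))"
    using T by (simp add: sum.distrib)
  also have "\<dots> \<le> \<beta> / 2 + real T * (real (3 * T) * (2 * exp (- deviation T \<beta>)))"
    using T by (intro add_left_mono mult_left_mono mult_right_mono) auto
  also have "\<dots> = \<beta>"
    using T \<beta> by (simp add: exp_minus_deviation power2_eq_square)
  finally show "measure_pmf.prob (block_list 0 T) {bs. \<exists>m<T. \<not> tame x y m (bs ! m)} \<le> \<beta>" .
  show "always 0"
    by (simp add: always)
  have X_pos: "0 < X m" if "1 \<le> m" for m
    using that X1 X[of m] H[of m] by (cases "m = 1") auto
  have gap: "X m \<le> gap x y m" if "\<not> always m" for m
    using that thr x y' by (fastforce simp: gap_def)
  show "0 < gap x y i" if "1 \<le> i" "\<not> always i" for i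
    using gap[OF that(2)] X_pos[OF that(1)] by linarith
  fix K k e
  assume k: "1 \<le> k" and e_d: "e \<le> real d"
    and e: "e \<le> y (k - 1) \<or> (\<not> always k \<and> e \<le> threshold k + 2 * x k)"
    and T2: "2 \<le> T \<or> (k = 1 \<and> e \<le> y 0)" and e_K: "e \<le> y (k - 1) + real K"
    and sum: "(\<Sum>i=1..<k. if always i then 0 else max 1 (gap x y i)) \<le> real K"
  have not_always_1: "\<not> always 1"
    by (simp add: always)
  have e': "e \<le> y (k - 1) \<or> (\<not> always k \<and> e \<le> 6 * X k)"
    using e thr[of k] x[of k] by auto
  show "e \<le> err K"
  proof (cases "e \<le> y 0 \<or> T < 2")
    case True
    thus ?thesis
      using T2 err0 by auto
  next
    case False
    hence T2: "2 \<le> T" by simp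
    show ?thesis
    proof (cases "k = 1")
      case True
      \<comment> \<open>No sparse release has been made yet: drift bounds the error by
        \<open>y 0 + K\<close>, the pending test by \<open>6 * X 1\<close>. This is the case
        \<open>Y = 0\<close>.\<close>
      hence "e \<le> y 0 + 6 * min (real K) (X 1)"
        using e' e_K y0 X1 by (auto simp: min_def)
      thus ?thesis
        using err[of e 0 K] e_d T2 G by auto
    next
      case False
      \<comment> \<open>All releases before \<open>j\<close>, apart from the initial one, were
        sparse tests that fired, so each of them certifies flips.\<close>
      define j where "j = (LEAST i. 2 \<le> i \<and> (always i \<or> i = k))"
      have "2 \<le> j \<and> (always j \<or> j = k)"
        unfolding j_def by (rule LeastI[of _ k]) (use k False in auto)
      moreover have "j \<le> k"
        unfolding j_def by (rule Least_le) (use k False in auto)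
      ultimately have j: "2 \<le> j" "always j \<or> j = k" "j \<le> k" by auto
      have sparse: "\<not> always i" if "1 \<le> i" "i < j" for i
        using that not_less_Least[of i "\<lambda>i. 2 \<le> i \<and> (always i \<or> i = k)"] not_always_1
        by (cases "i = 1") (auto simp: j_def[symmetric])
      have "(\<Sum>i=1..<j. max 1 (X i)) \<le> (\<Sum>i=1..<j. if always i then 0 else max 1 (gap x y i))"
      proof (rule sum_mono)
        fix i assume "i \<in> {1..<j}"
        hence "\<not> always i"
          using sparse by simp
        thus "max 1 (X i) \<le> (if always i then 0 else max 1 (gap x y i))"
          using gap[of i] by auto
      qed
      also have "\<dots> \<le> (\<Sum>i=1..<k. if always i then 0 else max 1 (gap x y i))"
        using j by (intro sum_mono2) auto
      finally have sum_j: "(\<Sum>i=1..<j. max 1 (X i)) \<le> real K"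
        using sum by linarith
      have sum_X: "(\<Sum>i=1..<j. X i) \<le> real K"
        by (rule order_trans[OF sum_mono sum_j]) simp
      have "real (j - 1) = (\<Sum>i=1..<j. 1)"
        by simp
      also have "\<dots> \<le> (\<Sum>i=1..<j. max 1 (X i))"
        by (intro sum_mono) simp
      finally have j_K: "j \<le> Suc K"
        using sum_j by linarith
      have "X 1 \<le> (\<Sum>i=1..<j. X i)"
        using j X_pos by (intro member_le_sum) (auto simp: less_imp_le)
      hence X1_K: "X 1 \<le> real K"
        using sum_X by linarith
      \<comment> \<open>The error level up to a constant: that of the pending test, or that of the
        forced releases if the algorithm has switched.\<close>
      define Y where "Y = min (H j) G"
      have Y: "0 \<le> Y" "Y \<le> G" "Y \<le> H j"
        using H[of j] G j by (auto simp: Y_def)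
      \<comment> \<open>By the doubling property all levels from index \<open>j / 2\<close> on are
        at least \<open>Y / 8\<close>, also \<open>X 1\<close> thanks to
        \<open>min (H 1) G \<le> X 1\<close>. Together they certify at most \<open>K\<close>
        flips.\<close>
      have "real j * (Y / 8) \<le> 4 * (\<Sum>i=1..<j. X i)"
      proof (rule sum_ge_upper_half[OF j(1)])
        fix i assume i: "1 \<le> i" "i < j" "j \<le> 2 * i"
        have "Y / 8 \<le> H i" "Y / 8 \<le> G"
          using half[OF i(1,3)] Y by linarith+
        thus "Y / 8 \<le> X i"
          using X1 X[of i] i by (cases "i = 1") auto
      qed (use Y X_pos in \<open>auto simp: less_imp_le\<close>)
      hence j_Y: "real j * Y \<le> 32 * real K"
        using sum_X by simp
      have "e \<le> 6 * max (X 1) Y"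
      proof (cases "always j")
        case True
        hence "G < H j"
          using j by (auto simp: always)
        hence al: "always i" if "j \<le> i" for i
          using that mono[of j i] j by (auto simp: always)
        have "e \<le> y (k - 1)"
          using e' al[of k] j by auto
        show ?thesis
        proof (cases "j = k")
          \<comment> \<open>The forced release is pending but has not happened, so the value still
            comes from the sparse release \<open>k - 1\<close>.\<close>
          case True
          hence "\<not> always (k - 1)"
            using sparse[of "k - 1"] j by auto
          hence "y (k - 1) \<le> X (k - 1)" "k - 1 = 1 \<or> (H (k - 1) \<le> G \<and> X (k - 1) = H (k - 1))"
            using y X[of "k - 1"] j True by (auto simp: always)
          moreover have "H (k - 1) \<le> H j"
            using True j by (intro mono) auto
          ultimately have "y (k - 1) \<le> max (X 1) Y"
            by (auto simp: Y_def)
          thus ?thesis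
            using \<open>e \<le> y (k - 1)\<close> X1 by linarith
        next
          case False
          hence "y (k - 1) \<le> G"
            using al[of "k - 1"] j by (intro yG) auto
          thus ?thesis
            using \<open>e \<le> y (k - 1)\<close> \<open>G < H j\<close> G by (auto simp: Y_def)
        qed
      next
        case False
        hence jk: "j = k" using j by auto
        hence "\<not> always (k - 1)"
          using sparse[of "k - 1"] j by auto
        hence "y (k - 1) \<le> X (k - 1)" "k - 1 = 1 \<or> (H (k - 1) \<le> G \<and> X (k - 1) = H (k - 1))"
          using y X[of "k - 1"] j jk by (auto simp: always)
        moreover have "H (k - 1) \<le> H j"
          using jk j by (intro mono) auto
        ultimately have "y (k - 1) \<le> max (X 1) Y"
          by (auto simp: Y_def)
        moreover have "X k \<le> Y"
          using False jk X[of k] j by (auto simp: always Y_def)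
        ultimately show ?thesis
          using e' X1 by auto
      qed
      hence "e \<le> y 0 + 6 * min (real K) (X 1) + 6 * Y"
        using X1_K X1 Y y0 by auto
      thus ?thesis
        using err[OF e_d T2 Y(1,2)] j(1) j_K j_Y Y(3) by blast
    qed
  qed
qed

end

section \<open>Constants of the error bounds and the additive term\<close>

definition initial_factor :: real where
  "initial_factor = 1 + ln 4 / ln (ln 3)"

definition additive_error :: "real \<Rightarrow> real \<Rightarrow> nat \<Rightarrow> real" where
  "additive_error \<epsilon> \<beta> K = 1 / \<epsilon> * (lnK K)\<^sup>2 * ln (lnK K / \<beta>)"

lemma initial_factor_ge_1: "1 \<le> initial_factor"
  unfolding initial_factor_def using ln_3_gt_1 by simp

text \<open>The initial error has \<open>ln (4 / \<beta>)\<close> where the additive term has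
  \<open>ln (lnK K / \<beta>)\<close>, which is at least
  \<open>ln (ln 3) + ln (1 / \<beta>)\<close>. As \<open>ln (ln 3)\<close> is small but positive,
  \<open>ln 4\<close> is absorbed at the price \<open>initial_factor\<close>, uniformly in
  \<open>\<beta>\<close>.\<close>

lemma
  assumes \<epsilon>: "0 < \<epsilon>" and \<beta>: "0 < \<beta>" "\<beta> < 1"
  shows ln_4_le_additive_error: "ln (4 / \<beta>) / \<epsilon> \<le> initial_factor * additive_error \<epsilon> \<beta> K"
    and ln_inverse_le_additive_error: "ln (1 / \<beta>) / \<epsilon> \<le> additive_error \<epsilon> \<beta> K"
    and additive_error_nonneg: "0 \<le> additive_error \<epsilon> \<beta> K"
proof -
  let ?q = "ln (ln (3 :: real))"
  have q: "0 < ?q"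
    using ln_3_gt_1 by simp
  have "ln 3 \<le> lnK K"
    unfolding lnK_def by (subst ln_le_cancel_iff) auto
  hence "?q \<le> ln (lnK K)"
    using ln_3_gt_1 by (intro ln_mono) auto
  hence ln: "?q + ln (1 / \<beta>) \<le> ln (lnK K / \<beta>)"
    using \<beta> lnK_ge_1[of K] by (simp add: ln_div)
  have b: "0 < ln (1 / \<beta>)"
    using \<beta> by simp
  have "1\<^sup>2 \<le> (lnK K)\<^sup>2"
    using lnK_ge_1 by (intro power_mono) auto
  moreover have "0 \<le> ln (lnK K / \<beta>)"
    using ln q b by linarith
  ultimately have "1 * ln (lnK K / \<beta>) \<le> (lnK K)\<^sup>2 * ln (lnK K / \<beta>)"
    by (intro mult_right_mono) auto
  hence "ln (lnK K / \<beta>) / \<epsilon> \<le> ((lnK K)\<^sup>2 * ln (lnK K / \<beta>)) / \<epsilon>"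
    using \<epsilon> by (intro divide_right_mono) auto
  hence add: "ln (lnK K / \<beta>) / \<epsilon> \<le> additive_error \<epsilon> \<beta> K"
    by (simp add: additive_error_def)
  have "ln (1 / \<beta>) \<le> ln (lnK K / \<beta>)"
    using ln q by linarith
  hence "ln (1 / \<beta>) / \<epsilon> \<le> ln (lnK K / \<beta>) / \<epsilon>"
    using \<epsilon> by (intro divide_right_mono) auto
  thus 1: "ln (1 / \<beta>) / \<epsilon> \<le> additive_error \<epsilon> \<beta> K"
    using add by linarith
  have "0 \<le> ln (1 / \<beta>) / \<epsilon>"
    using b \<epsilon> by simp
  thus "0 \<le> additive_error \<epsilon> \<beta> K"
    using 1 by linarith
  define r where "r = ln 4 / ?q"
  have "0 \<le> r * ln (1 / \<beta>)"
    using q b by (simp add: r_def)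
  moreover have "ln (4 / \<beta>) = r * ?q + ln (1 / \<beta>)"
    using q \<beta> by (simp add: r_def ln_div)
  ultimately have "ln (4 / \<beta>) \<le> (1 + r) * (?q + ln (1 / \<beta>))"
    using q by (simp add: ring_distribs)
  also have "1 + r = initial_factor"
    by (simp add: r_def initial_factor_def)
  also have "initial_factor * (?q + ln (1 / \<beta>)) \<le> initial_factor * ln (lnK K / \<beta>)"
    using ln initial_factor_ge_1 by (intro mult_left_mono) auto
  finally have "ln (4 / \<beta>) / \<epsilon> \<le> initial_factor * (ln (lnK K / \<beta>) / \<epsilon>)"
    using \<epsilon> by (simp add: divide_right_mono)
  also have "\<dots> \<le> initial_factor * additive_error \<epsilon> \<beta> K"
    using add initial_factor_ge_1 by (intro mult_left_mono) auto
  finally show "ln (4 / \<beta>) / \<epsilon> \<le> initial_factor * additive_error \<epsilon> \<beta> K" .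
qed

lemma le_of_square_le:
  fixes z :: real
  assumes "z\<^sup>2 \<le> c\<^sup>2 * r" "0 \<le> c"
  shows "z \<le> c * sqrt r"
proof -
  have "z \<le> sqrt (z\<^sup>2)" by simp
  also have "\<dots> \<le> sqrt (c\<^sup>2 * r)"
    by (rule real_sqrt_le_mono[OF assms(1)])
  also have "\<dots> = c * sqrt r"
    using assms(2) by (simp add: real_sqrt_mult)
  finally show ?thesis .
qed

lemma le_of_cube_le:
  fixes z :: real
  assumes "z ^ 3 \<le> c ^ 3 * r"
  shows "z \<le> c * root 3 r"
proof -
  have "z = root 3 (z ^ 3)"
    by (simp add: odd_real_root_power_cancel)
  also have "\<dots> \<le> root 3 (c ^ 3 * r)"
    using assms by simp
  also have "\<dots> = c * root 3 r"
    by (simp add: real_root_mult odd_real_root_power_cancel)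
  finally show ?thesis .
qed

definition bound_factor :: real where
  "bound_factor = 8000 * initial_factor"

text \<open>Here 2304 is \<open>6 * 384\<close>, from the first level under approximate privacy, and
  8000 exceeds all coefficients of \<open>m\<close> that occur; the largest is
  \<open>72 * 96 + 6 * 24\<close>, in the pure bound linear in \<open>T\<close>.\<close>

lemma le_bound_factor_Min:
  assumes S: "finite S" "S \<noteq> {}" "\<And>m. m \<in> S \<Longrightarrow> 0 \<le> m" and a: "0 \<le> a"
    and e: "\<And>m. m \<in> S \<Longrightarrow> e \<le> 8 * initial_factor * a + 2304 * a + 8000 * m"
  shows "e \<le> bound_factor * (Min S + a)"
proof -
  have Min: "Min S \<in> S"
    using S by simp
  have "1 * a \<le> initial_factor * a" "1 * Min S \<le> initial_factor * Min S"
    using initial_factor_ge_1 a S(3)[OF Min] by (intro mult_right_mono; simp)+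
  moreover have "bound_factor * (Min S + a) = 8000 * (initial_factor * Min S) + 8000 * (initial_factor * a)"
    by (simp add: bound_factor_def algebra_simps)
  moreover have "8 * initial_factor * a = 8 * (initial_factor * a)"
    by simp
  ultimately show ?thesis
    using e[OF Min] a S(3)[OF Min] by linarith
qed

lemma ln_4_over_pos: "0 < \<beta> \<Longrightarrow> \<beta> < 1 \<Longrightarrow> 0 < ln (4 / \<beta> :: real)"
  by (rule ln_gt_zero) (simp add: field_simps)

lemma deviation_pos:
  assumes "1 \<le> T" "0 < \<beta>" "\<beta> < 1"
  shows "0 < deviation T \<beta>"
  using ln_4_over_pos[OF assms(2,3)] ln_4_le_deviation[OF assms(1,2)] by linarith

lemma initial_error_le_additive:
  assumes \<epsilon>: "0 < \<epsilon>" and \<beta>: "0 < \<beta>" "\<beta> < 1" and q: "0 \<le> q" "q \<le> 8"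
  shows "q * ln (4 / \<beta>) / \<epsilon> \<le> 8 * initial_factor * additive_error \<epsilon> \<beta> K"
proof -
  have "q * (ln (4 / \<beta>) / \<epsilon>) \<le> 8 * (initial_factor * additive_error \<epsilon> \<beta> K)"
    using ln_4_le_additive_error[OF \<epsilon> \<beta>, of K] q ln_4_over_pos[OF \<beta>] \<epsilon> by (intro mult_mono) auto
  thus ?thesis by simp
qed

section \<open>Pure differential privacy\<close>

text \<open>The bound \<open>Y \<le> B * growth j\<close> increases with \<open>j\<close>, while
  \<open>j * Y \<le> 32 * K\<close> bounds \<open>Y\<close> by a decreasing function of
  \<open>j\<close>. Their product eliminates \<open>j\<close> and bounds the square of
  \<open>Y\<close>.\<close>

lemma pure_error_le:
  assumes T: "2 \<le> T" and \<beta>: "0 < \<beta>" "\<beta> < 1" and \<epsilon>: "0 < \<epsilon>"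
    and e_d: "e \<le> real d" and Y: "0 \<le> Y" "Y \<le> 4 * real T * deviation T \<beta> / \<epsilon>"
    and j: "Y = 0 \<or> (\<exists>j\<ge>2. j \<le> Suc K \<and> Y \<le> 16 * deviation T \<beta> / \<epsilon> * growth j \<and> real j * Y \<le> 32 * real K)"
    and e: "e \<le> 4 * ln (4 / \<beta>) / \<epsilon> + 6 * min (real K) (16 * deviation T \<beta> / \<epsilon> * growth 1) + 6 * Y"
  shows "e \<le> bound_factor * pure_bound d T \<beta> \<epsilon> K"
proof -
  define L where "L = ln (real T / \<beta>)"
  define Q where "Q = 1 / \<epsilon> * real K * L"
  define B where "B = 16 * deviation T \<beta> / \<epsilon>"
  define Z where "Z = min (real K) (B * growth 1)"
  let ?a = "additive_error \<epsilon> \<beta> K"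
  have "1 < real T / \<beta>"
    using T \<beta> by (simp add: field_simps)
  hence L: "0 < L"
    unfolding L_def by simp
  have dev: "0 \<le> deviation T \<beta>" "deviation T \<beta> \<le> 6 * L"
    using deviation_le[OF T \<beta>] deviation_pos[of T \<beta>] T \<beta> by (auto simp: L_def)
  have B: "0 \<le> B" "B \<le> 96 * (1 / \<epsilon> * L)"
    using dev \<epsilon> by (auto simp: B_def field_simps)
  have BK: "B * real K \<le> 96 * Q"
    using mult_right_mono[OF B(2), of "real K"] by (simp add: Q_def mult_ac)
  have K2: "1 * 1 \<le> (lnK K)\<^sup>2" and lnK: "1 \<le> lnK K"
    using lnK_ge_1[of K] by (auto intro: one_le_power)
  have Q: "0 \<le> Q"
    using \<epsilon> L by (simp add: Q_def)
  have BT: "B \<le> 96 * (1 / \<epsilon> * real T * L)"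
  proof -
    have "1 * (1 / \<epsilon> * L) \<le> real T * (1 / \<epsilon> * L)"
      using T \<epsilon> L by (intro mult_right_mono) auto
    hence "B \<le> 96 * (real T * (1 / \<epsilon> * L))"
      using B(2) by linarith
    thus ?thesis
      by (simp only: mult_ac)
  qed
  have y0: "4 * ln (4 / \<beta>) / \<epsilon> \<le> 8 * initial_factor * ?a" and a: "0 \<le> ?a"
    using initial_error_le_additive[OF \<epsilon> \<beta>, of 4 K] additive_error_nonneg[OF \<epsilon> \<beta>, of K] by auto
  have Z: "0 \<le> Z" "Z \<le> real K" "Z \<le> 12 * B"
    using B(1) growth_1 mult_left_mono[OF growth_1(2) B(1)] by (auto simp: Z_def)
  have Z_sqrt: "Z \<le> 34 * (lnK K * sqrt Q)"
  proof -
    \<comment> \<open>The product of the two bounds on \<open>Z\<close>; 34 and, below, 157 are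
      rounded up square roots of \<open>12 * 96\<close> and \<open>256 * 96\<close>.\<close>
    have "Z\<^sup>2 \<le> real K * (12 * B)"
      unfolding power2_eq_square using Z by (intro mult_mono) auto
    also have "\<dots> \<le> 34\<^sup>2 * Q"
      using BK Q by simp
    finally have "Z \<le> 34 * sqrt Q"
      by (rule le_of_square_le) simp
    also have "\<dots> \<le> 34 * (lnK K * sqrt Q)"
      using mult_right_mono[OF lnK, of "sqrt Q"] Q by simp
    finally show ?thesis .
  qed
  have Y_sqrt: "Y \<le> 157 * (lnK K * sqrt Q)" and Y_K: "Y \<le> 16 * real K"
  proof -
    have "Y \<le> 157 * (lnK K * sqrt Q) \<and> Y \<le> 16 * real K"
    proof (cases "Y = 0")
      case True
      thus ?thesis using lnK Q by simp
    next
      case False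
      then obtain i where i: "2 \<le> i" "i \<le> Suc K" "Y \<le> B * growth i" "real i * Y \<le> 32 * real K"
        using j by (auto simp: B_def)
      have "2 * Y \<le> real i * Y"
        using i Y by (intro mult_right_mono) auto
      hence YK: "Y \<le> 16 * real K"
        using i by linarith
      have "Y \<le> B * (8 * real i * (lnK K)\<^sup>2)"
        using i(3) mult_left_mono[OF growth_le_lnK[OF i(1,2)] B(1)] by linarith
      hence "Y * Y \<le> B * (8 * real i * (lnK K)\<^sup>2) * Y"
        using Y by (intro mult_right_mono) auto
      also have "\<dots> = 8 * B * (lnK K)\<^sup>2 * (real i * Y)"
        by simp
      also have "\<dots> \<le> 8 * B * (lnK K)\<^sup>2 * (32 * real K)"
        using i B by (intro mult_left_mono) auto
      also have "\<dots> = (lnK K)\<^sup>2 * (256 * (B * real K))"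
        by simp
      also have "\<dots> \<le> (lnK K)\<^sup>2 * (157\<^sup>2 * Q)"
        using BK Q by (intro mult_left_mono) auto
      finally have "Y\<^sup>2 \<le> (157 * lnK K)\<^sup>2 * Q"
        by (simp add: power2_eq_square mult_ac)
      hence "Y \<le> (157 * lnK K) * sqrt Q"
        by (rule le_of_square_le) (use lnK in simp)
      thus ?thesis using YK by simp
    qed
    thus "Y \<le> 157 * (lnK K * sqrt Q)" "Y \<le> 16 * real K" by auto
  qed
  have Y_T: "Y \<le> 24 * (1 / \<epsilon> * real T * L)"
  proof -
    have "4 * real T * deviation T \<beta> / \<epsilon> \<le> 4 * real T * (6 * L) / \<epsilon>"
      using dev \<epsilon> by (intro divide_right_mono mult_left_mono) auto
    thus ?thesis using Y by simp
  qed
  have e': "e \<le> 8 * initial_factor * ?a + 6 * Z + 6 * Y"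
    using e y0 by (simp add: Z_def B_def)
  have "e \<le> bound_factor * (Min {real d, real K, lnK K * sqrt Q, 1 / \<epsilon> * real T * L} + ?a)"
  proof (rule le_bound_factor_Min)
    fix m assume m: "m \<in> {real d, real K, lnK K * sqrt Q, 1 / \<epsilon> * real T * L}"
    show m0: "0 \<le> m"
      using m lnK Q \<epsilon> L by auto
    have ia: "0 \<le> 8 * initial_factor * ?a"
      using a initial_factor_ge_1 by simp
    from m show "e \<le> 8 * initial_factor * ?a + 2304 * ?a + 8000 * m"
    proof (elim insertE emptyE)
      assume "m = real d"
      thus ?thesis using e_d ia a by simp
    next
      assume "m = real K"
      thus ?thesis using e' Z(2) Y_K a m0 by linarith
    next
      assume "m = lnK K * sqrt Q"
      thus ?thesis using e' Z_sqrt Y_sqrt a m0 by linarith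
    next
      assume "m = 1 / \<epsilon> * real T * L"
      thus ?thesis using e' Z(3) BT Y_T a m0 by linarith
    qed
  qed (use a in auto)
  thus ?thesis
    by (simp add: pure_bound_def additive_error_def L_def Q_def)
qed

lemma initial_error_le_pure_bound:
  assumes T: "1 \<le> T" and \<beta>: "0 < \<beta>" "\<beta> < 1" and \<epsilon>: "0 < \<epsilon>" and e: "e \<le> 4 * ln (4 / \<beta>) / \<epsilon>"
  shows "e \<le> bound_factor * pure_bound d T \<beta> \<epsilon> K"
proof -
  have ge1: "1 \<le> real T / \<beta>"
    using T \<beta> by (simp add: field_simps)
  have y0: "4 * ln (4 / \<beta>) / \<epsilon> \<le> 8 * initial_factor * additive_error \<epsilon> \<beta> K" and a: "0 \<le> additive_error \<epsilon> \<beta> K"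
    using initial_error_le_additive[OF \<epsilon> \<beta>, of 4 K] additive_error_nonneg[OF \<epsilon> \<beta>, of K] by auto
  show ?thesis
    unfolding pure_bound_def additive_error_def[symmetric]
  proof (rule le_bound_factor_Min)
    fix m assume "m \<in> {real d, real K, lnK K * sqrt (1 / \<epsilon> * real K * ln (real T / \<beta>)), 1 / \<epsilon> * real T * ln (real T / \<beta>)}"
    thus "0 \<le> m"
      using ge1 \<epsilon> lnK_ge_1[of K] by auto
    thus "e \<le> 8 * initial_factor * additive_error \<epsilon> \<beta> K + 2304 * additive_error \<epsilon> \<beta> K + 8000 * m"
      using e y0 a by linarith
  qed (use a in auto)
qed

theorem pure_private_count_distinct:
  assumes T: "1 \<le> T" and \<beta>: "0 < \<beta>" "\<beta> < 1" and \<epsilon>: "0 < \<epsilon>"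
  shows "\<exists>A. continual_algorithm A \<and> pure_item_dp d T \<epsilon> A \<and>
    count_distinct_accurate d T \<beta> (\<lambda>K. bound_factor * pure_bound d T \<beta> \<epsilon> K) A"
proof -
  define \<Lambda> where "\<Lambda> = deviation T \<beta>"
  define H where "H m = 16 * \<Lambda> / \<epsilon> * growth m" for m
  define G where "G = 4 * real T * \<Lambda> / \<epsilon>"
  define al where "al m \<longleftrightarrow> m = 0 \<or> (2 \<le> m \<and> G < H m)" for m
  \<comment> \<open>The shares of \<open>\<epsilon>\<close>: \<open>1 / 4\<close> for the first
    release, \<open>1 / 4\<close> for at most \<open>T\<close> forced ones, and \<open>1 / 2\<close>
    for the sparse ones, each of which costs \<open>4 * rate m\<close>. \<open>G\<close> and
    \<open>H m\<close> are \<open>\<Lambda> / rate m\<close> in the respective modes.\<close>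
  define rate where "rate m = (if m = 0 then \<epsilon> / 4 else if al m then \<epsilon> / (4 * real T) else \<epsilon> / (16 * growth m))" for m
  define y where "y m = (if m = 0 then 4 * ln (4 / \<beta>) / \<epsilon> else \<Lambda> / rate m)" for m
  interpret sparse_release T al "\<lambda>m. 4 * H m" "\<lambda>m. geo (rate m)" "\<lambda>m. geo (rate m)" .
  have rate: "0 < rate m" for m
    using \<epsilon> T growth_ge_3[of m] by (auto simp: rate_def)
  have ln4: "0 < ln (4 / \<beta>)" "ln (4 / \<beta>) \<le> \<Lambda>" and \<Lambda>: "0 < \<Lambda>"
    using ln_4_over_pos[OF \<beta>] ln_4_le_deviation[OF T \<beta>(1)] deviation_pos[OF T \<beta>] by (auto simp: \<Lambda>_def)
  have H_mono: "H i \<le> H j" if "i \<le> j" for i j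
    unfolding H_def using \<Lambda> \<epsilon> growth_mono[OF that] by (intro mult_left_mono) auto
  have H_pos: "0 < H m" if "1 \<le> m" for m
    unfolding H_def using \<Lambda> \<epsilon> growth_ge_3[OF that] by (intro mult_pos_pos) auto
  have y_H: "y m = H m" if "\<not> al m" for m
  proof -
    have "m \<noteq> 0"
      using that by (auto simp: al_def)
    thus ?thesis
      using that by (simp add: y_def rate_def H_def)
  qed
  have y0_H1: "y 0 \<le> H 1"
  proof -
    have "16 * \<Lambda> * 3 \<le> 16 * \<Lambda> * growth 1"
      using growth_1(1) \<Lambda> by (intro mult_left_mono) auto
    hence "4 * ln (4 / \<beta>) \<le> 16 * \<Lambda> * growth 1"
      using ln4 by linarith
    hence "4 * ln (4 / \<beta>) / \<epsilon> \<le> 16 * \<Lambda> * growth 1 / \<epsilon>"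
      using \<epsilon> by (intro divide_right_mono) auto
    thus ?thesis by (simp add: y_def H_def)
  qed
  have "count_distinct_accurate d T \<beta> (\<lambda>K. bound_factor * pure_bound d T \<beta> \<epsilon> K)
      (discrete_algorithm (block_list 0 T) (release d))"
  proof (rule count_distinct_accurate_levels[where X = H and H = H and G = G and x = y and y = y])
    show "H j \<le> 8 * H i" if "j \<le> 2 * i" for i j
    proof -
      have "16 * \<Lambda> / \<epsilon> * growth j \<le> 16 * \<Lambda> / \<epsilon> * (8 * growth i)"
        using growth_le_growth_half[OF that] \<Lambda> \<epsilon> by (intro mult_left_mono) auto
      thus ?thesis by (simp add: H_def)
    qed
    show "0 \<le> G"
      using \<Lambda> \<epsilon> by (simp add: G_def)
    show "y (m - 1) \<le> H m" if m: "\<not> al m" for m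
    proof (cases "m = 1")
      case False
      have "m \<noteq> 0"
        using m by (auto simp: al_def)
      hence "\<not> al (m - 1)"
        using m False H_mono[of "m - 1" m] by (auto simp: al_def)
      thus ?thesis
        using y_H H_mono[of "m - 1" m] by simp
    qed (use y0_H1 in simp)
    show "y m \<le> G" if "2 \<le> m" "al m" for m
      using that by (simp add: y_def rate_def G_def mult_ac)
    have "exp (- rate 0 * y 0) = \<beta> / 4"
      using \<epsilon> \<beta> by (simp add: y_def rate_def exp_minus)
    thus "measure_pmf.prob (geo (rate 0)) {N. y 0 < \<bar>real_of_int N\<bar>} \<le> \<beta> / 2"
      using prob_geo_gt[OF rate[of 0], of "y 0"] ln4 \<epsilon> by (simp add: y_def)
    have tail: "measure_pmf.prob (geo (rate m)) {N. y m < \<bar>real_of_int N\<bar>} \<le> 2 * exp (- deviation T \<beta>)"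
      if "m \<noteq> 0" for m
      using prob_geo_gt[OF rate[of m], of "y m"] that \<Lambda> rate[of m] by (simp add: y_def \<Lambda>_def)
    show "measure_pmf.prob (geo (rate m)) {N. y m < \<bar>real_of_int N\<bar>} \<le> 2 * exp (- deviation T \<beta>)"
      if "1 \<le> m" for m
      using that by (intro tail) auto
    show "measure_pmf.prob (geo (rate m)) {N. y m < \<bar>real_of_int N\<bar>} \<le> 2 * exp (- deviation T \<beta>)"
      if "\<not> al m" for m
      using that by (intro tail) (auto simp: al_def)
    show "e \<le> bound_factor * pure_bound d T \<beta> \<epsilon> K" if "e \<le> y 0" for K e
      using initial_error_le_pure_bound[OF T \<beta> \<epsilon>] that by (simp add: y_def)
    show "e \<le> bound_factor * pure_bound d T \<beta> \<epsilon> K"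
      if "e \<le> real d" "2 \<le> T" "0 \<le> Y" "Y \<le> G"
        "Y = 0 \<or> (\<exists>j\<ge>2. j \<le> Suc K \<and> Y \<le> H j \<and> real j * Y \<le> 32 * real K)"
        "e \<le> y 0 + 6 * min (real K) (H 1) + 6 * Y" for K e Y
      using that pure_error_le[OF that(2) \<beta> \<epsilon> that(1,3), of K] by (simp add: G_def H_def y_def \<Lambda>_def)
  qed (use T \<beta> H_mono H_pos y_H ln4 \<epsilon> in \<open>auto simp: al_def y_def\<close>)
  moreover have "item_dp d T \<epsilon> 0 (discrete_algorithm (block_list 0 T) (release d))"
  proof (rule item_dp_release)
    fix c c' :: "nat \<Rightarrow> int" and n A
    assume n: "n \<le> T" and c: "\<And>s. 1 \<le> s \<Longrightarrow> s \<le> n \<Longrightarrow> \<bar>c s - c' s\<bar> \<le> 1"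
    define \<kappa> where "\<kappa> m = (if al m then rate m else 4 * rate m)" for m
    have step: "pmf (step_law c n m st) a \<le> exp (\<kappa> m) * pmf (step_law c' n m st) a" for m st a
    proof (cases "al m")
      case True
      thus ?thesis
        using pmf_step_law_le_always[where m = m and n = n, OF refl rate c True] by (simp add: \<kappa>_def)
    next
      case False
      thus ?thesis
        using pmf_step_law_le_sparse[where m = m, OF refl refl rate c n False] by (simp add: \<kappa>_def)
    qed
    have "(\<Sum>m=0..<0+T. \<kappa> m) = \<kappa> 0 + (\<Sum>m=1..<T. \<kappa> m)"
      using T by (subst sum.atLeast_Suc_lessThan) auto
    also have "\<kappa> 0 = \<epsilon> / 4"
      by (simp add: \<kappa>_def rate_def al_def)
    also have "(\<Sum>m=1..<T. \<kappa> m) \<le> (\<Sum>m=1..<T. \<epsilon> / (4 * real T) + \<epsilon> / 4 * (1 / growth m))"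
    proof (rule sum_mono)
      fix m assume "m \<in> {1..<T}"
      thus "\<kappa> m \<le> \<epsilon> / (4 * real T) + \<epsilon> / 4 * (1 / growth m)"
        using \<epsilon> growth_ge_3[of m] by (auto simp: \<kappa>_def rate_def)
    qed
    also have "\<dots> = real (T - 1) * (\<epsilon> / (4 * real T)) + \<epsilon> / 4 * (\<Sum>m=1..<T. 1 / growth m)"
      by (simp add: sum.distrib sum_distrib_left)
    also have "\<dots> \<le> real T * (\<epsilon> / (4 * real T)) + \<epsilon> / 4 * 2"
      using \<epsilon> sum_inverse_growth_le[of T] by (intro add_mono mult_right_mono mult_left_mono) auto
    also have "\<epsilon> / 4 + (real T * (\<epsilon> / (4 * real T)) + \<epsilon> / 4 * 2) = \<epsilon>"
      using T by simp
    finally have sum: "(\<Sum>m=0..<0+T. \<kappa> m) \<le> \<epsilon>" by simp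
    have "pmf (trace_law c n T 0 (0, 0)) tr \<le> exp \<epsilon> * pmf (trace_law c' n T 0 (0, 0)) tr" for tr
    proof -
      have "pmf (trace_law c n T 0 (0, 0)) tr \<le> exp (\<Sum>m=0..<0+T. \<kappa> m) * pmf (trace_law c' n T 0 (0, 0)) tr"
        by (rule pmf_trace_law_le) (rule step)
      also have "\<dots> \<le> exp \<epsilon> * pmf (trace_law c' n T 0 (0, 0)) tr"
        using sum by (intro mult_right_mono) auto
      finally show ?thesis .
    qed
    thus "measure_pmf.prob (trace_law c n T 0 (0, 0)) A
        \<le> exp \<epsilon> * measure_pmf.prob (trace_law c' n T 0 (0, 0)) A + 0"
      by (simp add: prob_le_prob_pointwise)
  qed
  ultimately show ?thesis
    unfolding pure_item_dp_def using continual_discrete_algorithm by blast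
qed

section \<open>Approximate differential privacy\<close>

text \<open>As \<open>ln T \<le> T / 2\<close>, at least half of a logarithm that exceeds
  \<open>T\<close> comes from \<open>1 / \<beta>\<close>, and the additive term can pay for
  it.\<close>

lemma half_le_ln_inverse:
  assumes T: "1 \<le> T" and \<beta>: "0 < \<beta>" and L: "real T \<le> ln (real T / \<beta>)"
  shows "ln (real T / \<beta>) \<le> 2 * ln (1 / \<beta>)"
proof -
  have "ln (real T) = 2 * ln (sqrt (real T))"
    using T by (simp add: ln_sqrt)
  also have "\<dots> \<le> 2 * (sqrt (real T) - 1)"
    using T by (intro mult_left_mono ln_le_minus_one) auto
  also have "\<dots> \<le> real T / 2"
  proof -
    have "0 \<le> (sqrt (real T) - 2)\<^sup>2"
      by simp
    thus ?thesis
      by (simp add: power2_diff)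
  qed
  finally have "2 * ln (real T) \<le> ln (real T / \<beta>)"
    using L by simp
  thus ?thesis
    using T \<beta> by (simp add: ln_div)
qed

lemma ln_inv_ge: "1 \<le> ln_inv \<delta>" "0 < \<delta> \<Longrightarrow> exp (- ln_inv \<delta>) \<le> \<delta>"
proof -
  show "1 \<le> ln_inv \<delta>"
    by (simp add: ln_inv_def)
  assume "0 < \<delta>"
  hence "exp (- ln_inv \<delta>) \<le> exp (- ln (1 / \<delta>))"
    by (simp add: ln_inv_def)
  thus "exp (- ln_inv \<delta>) \<le> \<delta>"
    using \<open>0 < \<delta>\<close> by (simp add: ln_div)
qed

text \<open>This is \<open>deviation / rate\<close> for the rate
  \<open>\<epsilon> / (30 * sqrt (ln_inv \<delta> * growth m))\<close>. The Renyi budget sums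
  squares of rates; 30 makes \<open>16 * 5 / 900\<close> at most \<open>1 / 8\<close>.\<close>

definition approx_level :: "nat \<Rightarrow> real \<Rightarrow> real \<Rightarrow> real \<Rightarrow> nat \<Rightarrow> real" where
  "approx_level T \<beta> \<epsilon> \<delta> m = 30 * deviation T \<beta> / \<epsilon> * sqrt (ln_inv \<delta> * growth m)"

text \<open>With a Renyi order \<open>s \<le> 5 * ln_inv \<delta> / \<epsilon>\<close>, the factor
  20 leaves each of \<open>T\<close> Gaussian releases the share
  \<open>s * \<epsilon> / (4 * T)\<close>.\<close>

definition gauss_var :: "nat \<Rightarrow> real \<Rightarrow> real \<Rightarrow> real" where
  "gauss_var T \<epsilon> \<delta> = 20 * real T * ln_inv \<delta> / \<epsilon>\<^sup>2"

definition gauss_level :: "nat \<Rightarrow> real \<Rightarrow> real \<Rightarrow> real \<Rightarrow> real" where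
  "gauss_level T \<beta> \<epsilon> \<delta> = sqrt (2 * deviation T \<beta> * gauss_var T \<epsilon> \<delta>)"

text \<open>The first argument of \<open>max\<close> is the noise bound of the first test, of rate
  \<open>\<epsilon> / 32\<close>. The second one may raise the threshold: it keeps the first level
  comparable with the later ones, as the counting of flips requires.\<close>

definition first_level :: "nat \<Rightarrow> real \<Rightarrow> real \<Rightarrow> real \<Rightarrow> real" where
  "first_level T \<beta> \<epsilon> \<delta> =
     max (32 * deviation T \<beta> / \<epsilon>) (min (approx_level T \<beta> \<epsilon> \<delta> 1) (gauss_level T \<beta> \<epsilon> \<delta>))"

lemma approx_level_square:
  assumes "0 < \<epsilon>"
  shows "(approx_level T \<beta> \<epsilon> \<delta> m)\<^sup>2 = 900 * (deviation T \<beta>)\<^sup>2 * ln_inv \<delta> / \<epsilon>\<^sup>2 * growth m"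
proof -
  have "0 \<le> ln_inv \<delta> * growth m"
    using ln_inv_ge(1)[of \<delta>] by (simp add: growth_def)
  thus ?thesis
    by (simp add: approx_level_def power_mult_distrib power_divide)
qed

text \<open>The index \<open>j\<close> is eliminated as under pure privacy, but now the square of
  \<open>Y\<close> is linear in \<open>j\<close> up to logarithms, so the product with
  \<open>j * Y\<close> bounds the cube.\<close>

lemma approx_error_le:
  assumes T: "2 \<le> T" and \<beta>: "0 < \<beta>" "\<beta> < 1" and \<epsilon>: "0 < \<epsilon>"
    and e_d: "e \<le> real d" and Y: "0 \<le> Y" "Y \<le> gauss_level T \<beta> \<epsilon> \<delta>"
    and j: "Y = 0 \<or> (\<exists>j\<ge>2. j \<le> Suc K \<and> Y \<le> approx_level T \<beta> \<epsilon> \<delta> j \<and> real j * Y \<le> 32 * real K)"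
    and e: "e \<le> 8 * ln (4 / \<beta>) / \<epsilon> + 6 * min (real K) (first_level T \<beta> \<epsilon> \<delta>) + 6 * Y"
  shows "e \<le> bound_factor * approx_bound d T \<beta> \<epsilon> \<delta> K"
proof -
  define L where "L = ln (real T / \<beta>)"
  define \<Lambda> where "\<Lambda> = deviation T \<beta>"
  define l where "l = ln_inv \<delta>"
  define R where "R = 1 / \<epsilon>\<^sup>2 * real K * (lnK K)\<^sup>2 * l * L\<^sup>2"
  define W where "W = 1 / \<epsilon> * sqrt (real T * l * L)"
  define B2 where "B2 = 900 * \<Lambda>\<^sup>2 * l / \<epsilon>\<^sup>2"
  define Z where "Z = min (real K) (first_level T \<beta> \<epsilon> \<delta>)"
  let ?a = "additive_error \<epsilon> \<beta> K"
  have "1 < real T / \<beta>"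
    using T \<beta> by (simp add: field_simps)
  hence L: "0 < L"
    unfolding L_def by simp
  have \<Lambda>: "0 \<le> \<Lambda>" "\<Lambda> \<le> 6 * L"
    using deviation_le[OF T \<beta>] deviation_pos[of T \<beta>] T \<beta> by (auto simp: L_def \<Lambda>_def)
  have l: "1 \<le> l"
    by (simp add: l_def ln_inv_ge)
  have K2: "1 \<le> (lnK K)\<^sup>2" and lnK: "1 \<le> lnK K"
    using lnK_ge_1[of K] by (auto intro: one_le_power)
  have R: "0 \<le> R" and W: "0 \<le> W"
    using l L \<epsilon> by (auto simp: R_def W_def)
  have B2: "0 \<le> B2" "B2 \<le> 32400 * (1 / \<epsilon>\<^sup>2 * l * L\<^sup>2)"
  proof -
    have "\<Lambda>\<^sup>2 \<le> (6 * L)\<^sup>2"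
      using \<Lambda> by (intro power_mono) auto
    hence "900 * \<Lambda>\<^sup>2 * l / \<epsilon>\<^sup>2 \<le> 900 * (6 * L)\<^sup>2 * l / \<epsilon>\<^sup>2"
      using l by (intro divide_right_mono mult_right_mono mult_left_mono) auto
    also have "\<dots> = 32400 * (1 / \<epsilon>\<^sup>2 * l * L\<^sup>2)"
      by (simp add: power_mult_distrib)
    finally show "B2 \<le> 32400 * (1 / \<epsilon>\<^sup>2 * l * L\<^sup>2)"
      by (simp add: B2_def)
  qed (use l in \<open>simp add: B2_def\<close>)
  have B2K: "B2 * real K * (lnK K)\<^sup>2 \<le> 32400 * R"
  proof -
    have "B2 * (real K * (lnK K)\<^sup>2) \<le> 32400 * (1 / \<epsilon>\<^sup>2 * l * L\<^sup>2) * (real K * (lnK K)\<^sup>2)"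
      using B2 by (intro mult_right_mono) auto
    thus ?thesis
      by (simp add: R_def mult_ac)
  qed
  have level: "(approx_level T \<beta> \<epsilon> \<delta> m)\<^sup>2 = B2 * growth m" for m
    unfolding B2_def \<Lambda>_def l_def by (rule approx_level_square[OF \<epsilon>])
  have y0: "8 * ln (4 / \<beta>) / \<epsilon> \<le> 8 * initial_factor * ?a" and a: "0 \<le> ?a"
    using initial_error_le_additive[OF \<epsilon> \<beta>, of 8 K] additive_error_nonneg[OF \<epsilon> \<beta>, of K] by auto
  have G_W: "gauss_level T \<beta> \<epsilon> \<delta> \<le> 16 * W"
  proof -
    have "2 * \<Lambda> * gauss_var T \<epsilon> \<delta> \<le> 2 * (6 * L) * gauss_var T \<epsilon> \<delta>"
      using \<Lambda> l by (intro mult_right_mono) (auto simp: gauss_var_def l_def)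
    also have "\<dots> \<le> (16 / \<epsilon>)\<^sup>2 * (real T * l * L)"
      using l L \<epsilon> by (simp add: gauss_var_def l_def[symmetric] power_divide field_simps)
    finally have "sqrt (2 * \<Lambda> * gauss_var T \<epsilon> \<delta>) \<le> sqrt ((16 / \<epsilon>)\<^sup>2 * (real T * l * L))"
      by (rule real_sqrt_le_mono)
    also have "\<dots> = 16 * W"
      using \<epsilon> by (simp add: W_def real_sqrt_mult)
    finally show ?thesis
      by (simp add: gauss_level_def \<Lambda>_def)
  qed
  \<comment> \<open>The first level is linear in the logarithm \<open>L\<close>, the target has its
    square root. For \<open>L \<le> T * l\<close> a factor \<open>sqrt L\<close> is traded for
    \<open>sqrt (T * l)\<close>; otherwise the additive term takes over.\<close>
  have L_W: "L / \<epsilon> \<le> W + 2 * ?a"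
  proof (cases "L \<le> real T * l")
    case True
    have "L = sqrt (L * L)"
      using L by simp
    also have "\<dots> \<le> sqrt (real T * l * L)"
      using True L by (intro real_sqrt_le_mono mult_right_mono) auto
    finally have "L / \<epsilon> \<le> W"
      using \<epsilon> by (simp add: W_def divide_right_mono)
    thus ?thesis using a by linarith
  next
    case False
    have "real T * 1 \<le> real T * l"
      using l by (intro mult_left_mono) auto
    hence "real T \<le> L"
      using False by linarith
    hence "L \<le> 2 * ln (1 / \<beta>)"
      unfolding L_def using T \<beta> by (intro half_le_ln_inverse) auto
    hence "L / \<epsilon> \<le> 2 * ln (1 / \<beta>) / \<epsilon>"
      using \<epsilon> by (intro divide_right_mono) auto
    thus ?thesis
      using ln_inverse_le_additive_error[OF \<epsilon> \<beta>, of K] W by simp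
  qed
  have X1_nonneg: "0 \<le> first_level T \<beta> \<epsilon> \<delta>"
    using \<Lambda> \<epsilon> by (simp add: first_level_def \<Lambda>_def[symmetric] le_max_iff_disj)
  have X1_W: "first_level T \<beta> \<epsilon> \<delta> \<le> 208 * W + 384 * ?a"
  proof -
    have "32 * \<Lambda> / \<epsilon> \<le> 32 * (6 * L) / \<epsilon>"
      using \<Lambda> \<epsilon> by (intro divide_right_mono mult_left_mono) auto
    hence "32 * \<Lambda> / \<epsilon> \<le> 192 * W + 384 * ?a"
      using L_W by simp
    thus ?thesis
      using G_W W a by (auto simp: first_level_def \<Lambda>_def[symmetric])
  qed
  have X1_sq: "(first_level T \<beta> \<epsilon> \<delta>)\<^sup>2 \<le> 16 * B2"
  proof -
    have "(32 * \<Lambda> / \<epsilon>)\<^sup>2 \<le> 16 * B2"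
    proof -
      have "1024 * \<Lambda>\<^sup>2 \<le> 14400 * \<Lambda>\<^sup>2 * l"
      proof -
        have "\<Lambda>\<^sup>2 * 1 \<le> \<Lambda>\<^sup>2 * l"
          using l by (intro mult_left_mono) auto
        moreover have "0 \<le> \<Lambda>\<^sup>2"
          by simp
        ultimately show ?thesis by linarith
      qed
      thus ?thesis
        using \<epsilon> by (simp add: B2_def power_mult_distrib power_divide divide_right_mono)
    qed
    moreover have "(min (approx_level T \<beta> \<epsilon> \<delta> 1) (gauss_level T \<beta> \<epsilon> \<delta>))\<^sup>2 \<le> 16 * B2"
    proof -
      have "0 \<le> gauss_level T \<beta> \<epsilon> \<delta>" "0 \<le> approx_level T \<beta> \<epsilon> \<delta> 1"
        using Y \<Lambda> \<epsilon> l growth_1 by (auto simp: approx_level_def \<Lambda>_def l_def)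
      hence "(min (approx_level T \<beta> \<epsilon> \<delta> 1) (gauss_level T \<beta> \<epsilon> \<delta>))\<^sup>2 \<le> (approx_level T \<beta> \<epsilon> \<delta> 1)\<^sup>2"
        by (intro power_mono) auto
      also have "\<dots> \<le> B2 * 12"
        unfolding level using B2 growth_1 by (intro mult_left_mono) auto
      finally show ?thesis using B2 by simp
    qed
    ultimately show ?thesis
      by (auto simp: first_level_def \<Lambda>_def[symmetric] max_def)
  qed
  have Z: "0 \<le> Z" "Z \<le> real K" "Z \<le> first_level T \<beta> \<epsilon> \<delta>"
    using X1_nonneg by (auto simp: Z_def)
  \<comment> \<open>Here 81 and, below, 203 are rounded up cube roots of \<open>16 * 32400\<close>
    and \<open>256 * 32400\<close>.\<close>
  have Z_root: "Z \<le> 81 * root 3 R"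
  proof (rule le_of_cube_le)
    have Z_sq: "Z\<^sup>2 \<le> 16 * B2"
      using power_mono[OF Z(3,1), of 2] X1_sq by linarith
    have "Z ^ 3 = Z * Z\<^sup>2"
      by (simp add: power3_eq_cube power2_eq_square)
    also have "\<dots> \<le> real K * (16 * B2)"
      using Z Z_sq by (intro mult_mono) auto
    also have "\<dots> \<le> real K * (16 * B2) * (lnK K)\<^sup>2"
      using mult_left_mono[OF K2, of "real K * (16 * B2)"] B2 by simp
    also have "\<dots> = 16 * (B2 * real K * (lnK K)\<^sup>2)"
      by simp
    also have "\<dots> \<le> 81 ^ 3 * R"
      using B2K R by simp
    finally show "Z ^ 3 \<le> 81 ^ 3 * R" .
  qed
  have Y_root: "Y \<le> 203 * root 3 R" and Y_K: "Y \<le> 16 * real K"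
  proof -
    have "Y \<le> 203 * root 3 R \<and> Y \<le> 16 * real K"
    proof (cases "Y = 0")
      case True
      thus ?thesis using R by simp
    next
      case False
      then obtain i where i: "2 \<le> i" "i \<le> Suc K" "Y \<le> approx_level T \<beta> \<epsilon> \<delta> i" "real i * Y \<le> 32 * real K"
        using j by auto
      have "2 * Y \<le> real i * Y"
        using i Y by (intro mult_right_mono) auto
      hence YK: "Y \<le> 16 * real K"
        using i by linarith
      have "Y\<^sup>2 \<le> B2 * growth i"
        unfolding level[symmetric] using i(3) Y(1) by (rule power_mono)
      also have "\<dots> \<le> B2 * (8 * real i * (lnK K)\<^sup>2)"
        using B2 growth_le_lnK[OF i(1,2)] by (intro mult_left_mono)
      finally have "Y\<^sup>2 * Y \<le> B2 * (8 * real i * (lnK K)\<^sup>2) * Y"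
        using Y by (intro mult_right_mono) auto
      also have "\<dots> = 8 * B2 * (lnK K)\<^sup>2 * (real i * Y)"
        by simp
      also have "\<dots> \<le> 8 * B2 * (lnK K)\<^sup>2 * (32 * real K)"
        using i B2 by (intro mult_left_mono) auto
      also have "\<dots> = 256 * (B2 * real K * (lnK K)\<^sup>2)"
        by simp
      also have "\<dots> \<le> 203 ^ 3 * R"
        using B2K R by simp
      finally have "Y ^ 3 \<le> 203 ^ 3 * R"
        by (simp add: power3_eq_cube power2_eq_square)
      thus ?thesis
        using YK le_of_cube_le by blast
    qed
    thus "Y \<le> 203 * root 3 R" "Y \<le> 16 * real K" by auto
  qed
  have e': "e \<le> 8 * initial_factor * ?a + 6 * Z + 6 * Y"
    using e y0 by (simp add: Z_def)
  have "e \<le> bound_factor * (Min {real d, real K, root 3 R, W} + ?a)"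
  proof (rule le_bound_factor_Min)
    fix m assume m: "m \<in> {real d, real K, root 3 R, W}"
    show m0: "0 \<le> m"
      using m R W by auto
    have ia: "0 \<le> 8 * initial_factor * ?a"
      using a initial_factor_ge_1 by simp
    from m show "e \<le> 8 * initial_factor * ?a + 2304 * ?a + 8000 * m"
    proof (elim insertE emptyE)
      assume "m = real d"
      thus ?thesis using e_d ia a by simp
    next
      assume "m = real K"
      thus ?thesis using e' Z(2) Y_K a m0 by linarith
    next
      assume "m = root 3 R"
      thus ?thesis using e' Z_root Y_root a m0 by linarith
    next
      assume "m = W"
      thus ?thesis using e' Z(3) X1_W Y(2) G_W a m0 by linarith
    qed
  qed (use a in auto)
  thus ?thesis
    by (simp add: approx_bound_def additive_error_def L_def R_def W_def l_def)
qed

lemma initial_error_le_approx_bound: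
  assumes T: "1 \<le> T" and \<beta>: "0 < \<beta>" "\<beta> < 1" and \<epsilon>: "0 < \<epsilon>" and e: "e \<le> 8 * ln (4 / \<beta>) / \<epsilon>"
  shows "e \<le> bound_factor * approx_bound d T \<beta> \<epsilon> \<delta> K"
proof -
  have "1 \<le> real T / \<beta>"
    using T \<beta> by (simp add: field_simps)
  hence L: "0 \<le> ln (real T / \<beta>)" by simp
  have l: "0 \<le> ln_inv \<delta>"
    using ln_inv_ge(1)[of \<delta>] by linarith
  have y0: "8 * ln (4 / \<beta>) / \<epsilon> \<le> 8 * initial_factor * additive_error \<epsilon> \<beta> K" and a: "0 \<le> additive_error \<epsilon> \<beta> K"
    using initial_error_le_additive[OF \<epsilon> \<beta>, of 8 K] additive_error_nonneg[OF \<epsilon> \<beta>, of K] by auto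
  show ?thesis
    unfolding approx_bound_def additive_error_def[symmetric]
  proof (rule le_bound_factor_Min)
    fix m assume "m \<in> {real d, real K, root 3 (1 / \<epsilon>\<^sup>2 * real K * (lnK K)\<^sup>2 * ln_inv \<delta> * (ln (real T / \<beta>))\<^sup>2),
      1 / \<epsilon> * sqrt (real T * ln_inv \<delta> * ln (real T / \<beta>))}"
    thus "0 \<le> m"
      using L l \<epsilon> by auto
    thus "e \<le> 8 * initial_factor * additive_error \<epsilon> \<beta> K + 2304 * additive_error \<epsilon> \<beta> K + 8000 * m"
      using e y0 a by linarith
  qed (use a in auto)
qed

text \<open>
  The first sparse release gets a constant share of the budget under pure privacy, so its noise is
  \<open>O(deviation / \<epsilon>)\<close>, without the factor \<open>sqrt (ln_inv \<delta>)\<close> that the sublinear composition of the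
  later releases costs: that factor would be too large when \<open>deviation\<close> exceeds \<open>T\<close>.
\<close>

theorem approx_private_count_distinct:
  assumes T: "1 \<le> T" and \<beta>: "0 < \<beta>" "\<beta> < 1" and \<delta>: "0 < \<delta>" and \<epsilon>: "0 < \<epsilon>" "\<epsilon> < 1"
  shows "\<exists>A. continual_algorithm A \<and> item_dp d T \<epsilon> \<delta> A \<and>
    count_distinct_accurate d T \<beta> (\<lambda>K. bound_factor * approx_bound d T \<beta> \<epsilon> \<delta> K) A"
proof -
  define \<Lambda> where "\<Lambda> = deviation T \<beta>"
  define l where "l = ln_inv \<delta>"
  define H where "H = approx_level T \<beta> \<epsilon> \<delta>"
  define G where "G = gauss_level T \<beta> \<epsilon> \<delta>"
  define \<nu> where "\<nu> = gauss_var T \<epsilon> \<delta>"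
  define X where "X m = (if m = 1 then first_level T \<beta> \<epsilon> \<delta> else H m)" for m
  define al where "al m \<longleftrightarrow> m = 0 \<or> (2 \<le> m \<and> G < H m)" for m
  define rate where "rate m = (if m = 0 then \<epsilon> / 8 else if m = 1 then \<epsilon> / 32 else \<epsilon> / (30 * sqrt (l * growth m)))" for m
  define an where "an m = (if 2 \<le> m \<and> al m then gauss \<nu> else geo (rate m))" for m
  define y where "y m = (if m = 0 then 8 * ln (4 / \<beta>) / \<epsilon> else if al m then G else \<Lambda> / rate m)" for m
  interpret sparse_release T al "\<lambda>m. 4 * X m" "\<lambda>m. geo (rate m)" an .
  have l: "1 \<le> l"
    by (simp add: l_def ln_inv_ge)
  have rate: "0 < rate m" for m
    using \<epsilon> T l growth_ge_3[of m] by (auto simp: rate_def)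
  have ln4: "0 < ln (4 / \<beta>)" "ln (4 / \<beta>) \<le> \<Lambda>" and \<Lambda>: "0 < \<Lambda>"
    using ln_4_over_pos[OF \<beta>] ln_4_le_deviation[OF T \<beta>(1)] deviation_pos[OF T \<beta>] by (auto simp: \<Lambda>_def)
  have \<nu>: "0 < \<nu>"
    using T l \<epsilon> by (simp add: \<nu>_def gauss_var_def l_def)
  have G: "0 < G" "G\<^sup>2 = 2 * \<Lambda> * \<nu>"
    using \<Lambda> \<nu> by (auto simp: G_def gauss_level_def \<Lambda>_def \<nu>_def)
  have H: "H m = 30 * \<Lambda> / \<epsilon> * sqrt (l * growth m)" for m
    by (simp add: H_def approx_level_def \<Lambda>_def l_def)
  have H_mono: "H i \<le> H j" if "i \<le> j" for i j
    unfolding H using \<Lambda> \<epsilon> l growth_mono[OF that] by (intro mult_left_mono real_sqrt_le_mono) auto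
  have H_pos: "0 < H m" if "1 \<le> m" for m
    unfolding H using \<Lambda> \<epsilon> l growth_ge_3[OF that] by (intro mult_pos_pos) auto
  have X1: "32 * \<Lambda> / \<epsilon> \<le> X 1" "min (H 1) G \<le> X 1" "0 < X 1"
  proof -
    show *: "32 * \<Lambda> / \<epsilon> \<le> X 1" "min (H 1) G \<le> X 1"
      by (auto simp: X_def first_level_def \<Lambda>_def H_def G_def)
    have "0 < 32 * \<Lambda> / \<epsilon>"
      using \<Lambda> \<epsilon> by simp
    thus "0 < X 1" using * by linarith
  qed
  have rate_H: "\<Lambda> / rate m = H m" if "2 \<le> m" for m
    using that by (simp add: rate_def H mult_ac)
  have rate_X: "\<Lambda> / rate m \<le> X m" if "\<not> al m" for m
  proof (cases "m = 1")
    case True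
    thus ?thesis
      using X1(1) by (simp add: rate_def mult_ac)
  next
    case False
    hence "2 \<le> m"
      using that by (auto simp: al_def)
    thus ?thesis
      using rate_H[of m] by (simp add: X_def)
  qed
  have y_X: "y m \<le> X m" if "\<not> al m" for m
    using rate_X[OF that] that by (auto simp: y_def al_def)
  have "count_distinct_accurate d T \<beta> (\<lambda>K. bound_factor * approx_bound d T \<beta> \<epsilon> \<delta> K)
      (discrete_algorithm (block_list 0 T) (release d))"
  proof (rule count_distinct_accurate_levels[where X = X and H = H and G = G and x = "\<lambda>m. \<Lambda> / rate m" and y = y])
    show "H j \<le> 8 * H i" if "j \<le> 2 * i" for i j
    proof -
      have "0 \<le> growth i"
        by (simp add: growth_def)
      hence "growth j \<le> 8\<^sup>2 * growth i"
        using growth_le_growth_half[OF that] by simp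
      hence "l * growth j \<le> 8\<^sup>2 * (l * growth i)"
        using mult_left_mono[of "growth j" "8\<^sup>2 * growth i" l] l by (simp add: mult_ac)
      hence "sqrt (l * growth j) \<le> sqrt (8\<^sup>2 * (l * growth i))"
        by (rule real_sqrt_le_mono)
      hence "sqrt (l * growth j) \<le> 8 * sqrt (l * growth i)"
        by (simp only: real_sqrt_mult real_sqrt_abs abs_numeral)
      hence "30 * \<Lambda> / \<epsilon> * sqrt (l * growth j) \<le> 30 * \<Lambda> / \<epsilon> * (8 * sqrt (l * growth i))"
        using \<Lambda> \<epsilon> by (intro mult_left_mono) auto
      thus ?thesis by (simp add: H)
    qed
    show "y (m - 1) \<le> X m" if m: "\<not> al m" for m
    proof -
      have "m \<noteq> 0"
        using m by (auto simp: al_def)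
      then consider "m = 1" | "m = 2" | "3 \<le> m" by linarith
      thus ?thesis
      proof cases
        case 1
        have "8 * ln (4 / \<beta>) / \<epsilon> \<le> 32 * \<Lambda> / \<epsilon>"
          using ln4 \<epsilon> by (intro divide_right_mono) auto
        thus ?thesis
          using X1(1) 1 by (simp add: y_def)
      next
        \<comment> \<open>The first two tests follow different noise schedules, so the noise of the
          first answer is compared with the second level by hand: 32 against
          \<open>30 * 2\<close>.\<close>
        case 2
        have "2\<^sup>2 \<le> l * growth 2"
          using mult_mono[OF l growth_2_ge_4] l by simp
        hence "2 \<le> sqrt (l * growth 2)"
          by (rule real_le_rsqrt)
        hence "30 * \<Lambda> / \<epsilon> * 2 \<le> H 2"
          unfolding H using \<Lambda> \<epsilon> by (intro mult_left_mono) auto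
        moreover have "32 * \<Lambda> / \<epsilon> \<le> 30 * \<Lambda> / \<epsilon> * 2"
          using \<Lambda> \<epsilon> by (simp add: field_simps)
        moreover have "y 1 = 32 * \<Lambda> / \<epsilon>"
          by (simp add: y_def al_def rate_def mult_ac)
        ultimately show ?thesis
          using 2 by (simp add: X_def)
      next
        case 3
        hence "\<not> al (m - 1)"
          using m H_mono[of "m - 1" m] by (auto simp: al_def)
        hence "y (m - 1) = H (m - 1)"
          using 3 rate_H[of "m - 1"] by (simp add: y_def)
        thus ?thesis
          using 3 H_mono[of "m - 1" m] by (simp add: X_def)
      qed
    qed
    show "measure_pmf.prob (an 0) {N. y 0 < \<bar>real_of_int N\<bar>} \<le> \<beta> / 2"
    proof -
      have "exp (- rate 0 * y 0) = \<beta> / 4"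
        using \<epsilon> \<beta> by (simp add: y_def rate_def exp_minus)
      thus ?thesis
        using prob_geo_gt[OF rate[of 0], of "y 0"] ln4 \<epsilon> by (simp add: y_def an_def)
    qed
    have tail: "measure_pmf.prob (geo (rate m)) {N. \<Lambda> / rate m < \<bar>real_of_int N\<bar>} \<le> 2 * exp (- deviation T \<beta>)" for m
      using prob_geo_gt[OF rate[of m], of "\<Lambda> / rate m"] \<Lambda> rate[of m] by (simp add: \<Lambda>_def)
    show "measure_pmf.prob (an m) {N. y m < \<bar>real_of_int N\<bar>} \<le> 2 * exp (- deviation T \<beta>)"
      if "1 \<le> m" for m
    proof (cases "al m")
      case True
      hence "an m = gauss \<nu>" "y m = G"
        using that by (auto simp: an_def y_def al_def)
      moreover have "- G\<^sup>2 / (2 * \<nu>) = - \<Lambda>"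
        using \<nu> by (simp add: G)
      ultimately show ?thesis
        using prob_gauss_gt[OF \<nu>, of G] G(1) by (simp add: \<Lambda>_def)
    next
      case False
      hence "an m = geo (rate m)" "y m = \<Lambda> / rate m"
        using that by (auto simp: an_def y_def)
      thus ?thesis
        using tail by simp
    qed
    show "measure_pmf.prob (geo (rate m)) {N. \<Lambda> / rate m < \<bar>real_of_int N\<bar>} \<le> 2 * exp (- deviation T \<beta>)" for m
      by (rule tail)
    show "e \<le> bound_factor * approx_bound d T \<beta> \<epsilon> \<delta> K" if "e \<le> y 0" for K e
      using initial_error_le_approx_bound[OF T \<beta> \<epsilon>(1)] that by (simp add: y_def)
    show "e \<le> bound_factor * approx_bound d T \<beta> \<epsilon> \<delta> K"
      if "e \<le> real d" "2 \<le> T" "0 \<le> Y" "Y \<le> G"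
        "Y = 0 \<or> (\<exists>j\<ge>2. j \<le> Suc K \<and> Y \<le> H j \<and> real j * Y \<le> 32 * real K)"
        "e \<le> y 0 + 6 * min (real K) (X 1) + 6 * Y" for K e Y
      using that by (intro approx_error_le[OF that(2) \<beta> \<epsilon>(1) that(1,3)]) (auto simp: G_def H_def X_def y_def)
  qed (use T \<beta> H_mono H_pos X1 y_X rate_X ln4 \<epsilon> G in \<open>auto simp: al_def y_def X_def less_imp_le\<close>)
  moreover have "item_dp d T \<epsilon> \<delta> (discrete_algorithm (block_list 0 T) (release d))"
  proof (rule item_dp_release)
    fix c c' :: "nat \<Rightarrow> int" and n A
    assume n: "n \<le> T" and c: "\<And>s. 1 \<le> s \<Longrightarrow> s \<le> n \<Longrightarrow> \<bar>c s - c' s\<bar> \<le> 1"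
    have c': "\<And>s. 1 \<le> s \<Longrightarrow> s \<le> n \<Longrightarrow> \<bar>c' s - c s\<bar> \<le> 1"
      using c by (simp add: abs_minus_commute)
    \<comment> \<open>All shares add up to \<open>3 / 4 * s * \<epsilon>\<close>, so the failure
      probability is at most \<open>exp (- s * \<epsilon> / 4)\<close>, and
      \<open>4 * l / \<epsilon> \<le> s\<close> brings it below \<open>\<delta>\<close>. Rounding up
      adds at most 1, hence at most \<open>l / \<epsilon>\<close>.\<close>
    define s where "s = nat \<lceil>4 * l / \<epsilon>\<rceil>"
    have "1 \<le> l / \<epsilon>"
      using l \<epsilon> by (simp add: field_simps)
    hence s: "4 * l / \<epsilon> \<le> real s" "real s \<le> 5 * l / \<epsilon>" "1 \<le> real s"
      unfolding s_def by linarith+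
    have s\<epsilon>: "4 * l \<le> real s * \<epsilon>" "real s * \<epsilon> \<le> 5 * l"
      using s(1,2) \<epsilon> by (simp_all add: field_simps)
    define \<kappa> where "\<kappa> m = (if m \<le> 1 then real s * \<epsilon> / 8
      else if al m then (real s)\<^sup>2 / \<nu> else 16 * (real s)\<^sup>2 * (rate m)\<^sup>2)" for m
    have step: "renyi_le s (\<kappa> m) (step_law c n m st) (step_law c' n m st)" for m st
    proof -
      have s1: "real s * (real s + 1) \<le> 2 * (real s)\<^sup>2"
        using s(3) by (simp add: power2_eq_square)
      consider "m = 0" | "m = 1" | "2 \<le> m" "al m" | "2 \<le> m" "\<not> al m" by linarith
      thus ?thesis
      proof cases
        case 1
        hence "renyi_le s (real s * (\<epsilon> / 8)) (step_law c n m st) (step_law c' n m st)"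
          by (intro renyi_le_of_pmf_le pmf_step_law_le_always c)
            (use \<epsilon> in \<open>auto simp: an_def rate_def al_def\<close>)
        thus ?thesis
          using 1 by (simp add: \<kappa>_def)
      next
        case 2
        hence "renyi_le s (real s * (4 * (\<epsilon> / 32))) (step_law c n m st) (step_law c' n m st)"
          by (intro renyi_le_of_pmf_le pmf_step_law_le_sparse c n)
            (use \<epsilon> in \<open>auto simp: an_def rate_def al_def\<close>)
        thus ?thesis
          using 2 by (simp add: \<kappa>_def)
      next
        case 3
        have "renyi_le s (real s * (real s + 1) / (2 * \<nu>)) (step_law c n m st) (step_law c' n m st)"
          by (rule renyi_le_step_law_always[OF _ \<nu> c]) (use 3 in \<open>auto simp: an_def\<close>)
        moreover have "real s * (real s + 1) / (2 * \<nu>) \<le> 2 * (real s)\<^sup>2 / (2 * \<nu>)"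
          using s1 \<nu> by (intro divide_right_mono) auto
        ultimately have "renyi_le s (2 * (real s)\<^sup>2 / (2 * \<nu>)) (step_law c n m st) (step_law c' n m st)"
          by (rule renyi_le_mono)
        thus ?thesis
          using 3 by (simp add: \<kappa>_def)
      next
        case 4
        hence an: "an m = geo (rate m)"
          by (simp add: an_def)
        have "renyi_le s (real s * (real s + 1) * (4 * rate m)\<^sup>2 / 2) (step_law c n m st) (step_law c' n m st)"
          by (intro renyi_le_of_pmf_le_both pmf_step_law_le_sparse[where m = m, OF refl an rate _ n 4(2)] c c')
            (use s rate[of m] in auto)
        moreover have "real s * (real s + 1) * (4 * rate m)\<^sup>2 / 2 \<le> 2 * (real s)\<^sup>2 * (4 * rate m)\<^sup>2 / 2"
          using s1 by (intro divide_right_mono mult_right_mono) auto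
        ultimately have "renyi_le s (2 * (real s)\<^sup>2 * (4 * rate m)\<^sup>2 / 2) (step_law c n m st) (step_law c' n m st)"
          by (rule renyi_le_mono)
        moreover have "2 * (real s)\<^sup>2 * (4 * rate m)\<^sup>2 / 2 = \<kappa> m"
          using 4 by (simp add: \<kappa>_def power_mult_distrib)
        ultimately show ?thesis by simp
      qed
    qed
    have sq: "(real s)\<^sup>2 * \<epsilon>\<^sup>2 \<le> 5 * l * (real s * \<epsilon>)"
      using mult_right_mono[OF s\<epsilon>(2), of "real s * \<epsilon>"] s \<epsilon> by (simp add: power2_eq_square mult_ac)
    have gaussian: "(real s)\<^sup>2 / \<nu> \<le> real s * \<epsilon> / (4 * real T)"
    proof -
      have "(real s)\<^sup>2 / \<nu> = (real s)\<^sup>2 * \<epsilon>\<^sup>2 / (20 * real T * l)"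
        using \<epsilon> by (simp add: \<nu>_def gauss_var_def l_def)
      also have "\<dots> \<le> 5 * l * (real s * \<epsilon>) / (20 * real T * l)"
        using sq T l by (intro divide_right_mono) auto
      also have "\<dots> = real s * \<epsilon> / (4 * real T)"
        using l by simp
      finally show ?thesis .
    qed
    have sparse: "16 * (real s)\<^sup>2 * (rate m)\<^sup>2 \<le> real s * \<epsilon> / 8 * (1 / growth m)" if "2 \<le> m" for m
    proof -
      have g: "0 < growth m"
        using growth_ge_3[of m] that by simp
      have "16 * (real s)\<^sup>2 * (rate m)\<^sup>2 = 16 * ((real s)\<^sup>2 * \<epsilon>\<^sup>2) / (900 * l * growth m)"
        using that g l by (simp add: rate_def power_divide power_mult_distrib)
      also have "\<dots> \<le> 16 * (5 * l * (real s * \<epsilon>)) / (900 * l * growth m)"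
        using sq g l by (intro divide_right_mono mult_left_mono) auto
      also have "\<dots> = (80 / 900) * (real s * \<epsilon>) / growth m"
        using l g by (simp add: field_simps)
      also have "\<dots> \<le> (1 / 8) * (real s * \<epsilon>) / growth m"
        using s \<epsilon> g by (intro divide_right_mono mult_right_mono) auto
      finally show ?thesis by simp
    qed
    have "(\<Sum>m=0..<0+T. \<kappa> m) = \<kappa> 0 + (\<Sum>m=1..<T. \<kappa> m)"
      using T by (subst sum.atLeast_Suc_lessThan) auto
    also have "\<kappa> 0 = real s * \<epsilon> / 8"
      by (simp add: \<kappa>_def)
    also have "(\<Sum>m=1..<T. \<kappa> m)
        \<le> (\<Sum>m=1..<T. (if m = 1 then real s * \<epsilon> / 8 else 0)
            + (real s * \<epsilon> / (4 * real T) + real s * \<epsilon> / 8 * (1 / growth m)))"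
    proof (rule sum_mono)
      fix m assume "m \<in> {1..<T}"
      hence "1 \<le> m" by simp
      moreover have "0 \<le> real s * \<epsilon> / (4 * real T)" "0 \<le> real s * \<epsilon> / 8 * (1 / growth m)"
        using \<epsilon> growth_ge_3[OF \<open>1 \<le> m\<close>] by auto
      ultimately show "\<kappa> m \<le> (if m = 1 then real s * \<epsilon> / 8 else 0)
          + (real s * \<epsilon> / (4 * real T) + real s * \<epsilon> / 8 * (1 / growth m))"
        using gaussian sparse[of m] by (auto simp: \<kappa>_def)
    qed
    also have "\<dots> = (\<Sum>m=1..<T. if m = 1 then real s * \<epsilon> / 8 else 0)
        + (real (T - 1) * (real s * \<epsilon> / (4 * real T)) + real s * \<epsilon> / 8 * (\<Sum>m=1..<T. 1 / growth m))"
      by (simp add: sum.distrib sum_distrib_left)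
    also have "\<dots> \<le> real s * \<epsilon> / 8 + (real T * (real s * \<epsilon> / (4 * real T)) + real s * \<epsilon> / 8 * 2)"
      using \<epsilon> sum_inverse_growth_le[of T] by (intro add_mono mult_right_mono mult_left_mono) (auto simp: sum.delta)
    also have "real s * \<epsilon> / 8 + (real s * \<epsilon> / 8 + (real T * (real s * \<epsilon> / (4 * real T)) + real s * \<epsilon> / 8 * 2))
        = 3 / 4 * (real s * \<epsilon>)"
      using T by (simp add: field_simps)
    finally have "(\<Sum>m=0..<0+T. \<kappa> m) \<le> 3 / 4 * (real s * \<epsilon>)" by simp
    moreover have "renyi_le s (\<Sum>m=0..<0+T. \<kappa> m) (trace_law c n T 0 (0, 0)) (trace_law c' n T 0 (0, 0))"
      by (rule renyi_le_trace_law) (rule step)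
    ultimately have "renyi_le s (3 / 4 * (real s * \<epsilon>)) (trace_law c n T 0 (0, 0)) (trace_law c' n T 0 (0, 0))"
      by (rule renyi_le_mono[rotated])
    hence "measure_pmf.prob (trace_law c n T 0 (0, 0)) A
        \<le> exp \<epsilon> * measure_pmf.prob (trace_law c' n T 0 (0, 0)) A + exp (3 / 4 * (real s * \<epsilon>) - real s * \<epsilon>)"
      by (rule prob_le_of_renyi_le)
    also have "exp (3 / 4 * (real s * \<epsilon>) - real s * \<epsilon>) \<le> exp (- l)"
      unfolding exp_le_cancel_iff using s\<epsilon>(1) by linarith
    also have "\<dots> \<le> \<delta>"
      unfolding l_def by (rule ln_inv_ge(2)[OF \<delta>])
    finally show "measure_pmf.prob (trace_law c n T 0 (0, 0)) A
        \<le> exp \<epsilon> * measure_pmf.prob (trace_law c' n T 0 (0, 0)) A + \<delta>"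
      by simp
  qed
  ultimately show ?thesis
    using continual_discrete_algorithm by blast
qed

theorem theoremA3:
  shows "\<exists>C>0. \<forall>(d::nat) (T::nat) (\<beta>::real). d \<ge> 1 \<longrightarrow> T \<ge> 1 \<longrightarrow> 0 < \<beta> \<longrightarrow> \<beta> < 1 \<longrightarrow>
    (\<forall>\<epsilon>>0. \<exists>A. continual_algorithm A \<and> pure_item_dp d T \<epsilon> A \<and>
        count_distinct_accurate d T \<beta> (\<lambda>K. C * pure_bound d T \<beta> \<epsilon> K) A) \<and>
    (\<forall>\<delta> \<epsilon>. 0 < \<delta> \<longrightarrow> \<delta> < 1 \<longrightarrow> 0 < \<epsilon> \<longrightarrow> \<epsilon> < 1 \<longrightarrow>
      (\<exists>A. continual_algorithm A \<and> item_dp d T \<epsilon> \<delta> A \<and>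
        count_distinct_accurate d T \<beta> (\<lambda>K. C * approx_bound d T \<beta> \<epsilon> \<delta> K) A))"
proof (intro exI[of _ bound_factor] conjI allI impI)
  show "0 < bound_factor"
    using initial_factor_ge_1 by (simp add: bound_factor_def)
qed (intro pure_private_count_distinct approx_private_count_distinct; assumption)+

end
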